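(* Let $\lambda_0\in\mathbb{R}$ and let $g$ be any exchangeable prior distribution of $\tau_0$. A pseudo symmetric approximate design $d$ is ${\cal A}_{g,\lambda_0}$-optimal if and only if $q_d(x_d)>0$ and $$\max_{s\in{\cal S}}\left(\pi_d\frac{q_s(x_d)}{q_d(x_d)}+(1-\pi_d)\frac{q_s(\lambda_0)}{q_d(\lambda_0)}\right)=1,\qquad \pi_d=\frac{q_d(\lambda_0)}{q_d(\lambda_0)+(t-2)q_d(x_d)}.$$ Moreover, in that case every sequence $s$ in the design $d$ (i.e. with $p_s>0$) attains this maximum.
   Context: Fix integers $p\ge2$ (periods), $t\ge2$ (treatments), $n\ge1$ (subjects) and a symmetric positive definite real $p\times p$ matrix $\Sigma$ (within-subject covariance). $1_k$ is the all-ones vector of length $k$, $J_k=1_k1_k'$, $B_k=I_k-J_k/k$, prime denotes transpose, and $\tilde B=\Sigma^{-1}-\Sigma^{-1}J_p\Sigma^{-1}/(1_p'\Sigma^{-1}1_p)$. Let ${\cal S}=\{1,\dots,t\}^p$ be the set of treatment sequences. For $s=(t_1,\dots,t_p)\in{\cal S}$, $T_s$ is the $p\times t$ matrix with $(k,i)$ entry $1$ if $t_k=i$ and $0$ otherwise; $F_s$ is the $p\times t$ matrix with zero first row and, for $k\ge2$, $(k,i)$ entry $1$ if $t_{k-1}=i$ and $0$ otherwise. An (approximate) design $d$ is a vector $P_d=(p_s)_{s\in{\cal S}}$ with $p_s\ge0$, $\sum_sp_s=1$. For $1\le i,j\le2$ put $\hat C_{sij}=B_tG_{s,i}'\tilde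 BG_{s,j}B_t$ with $G_{s,1}=T_s$, $G_{s,2}=F_s$, $\hat C_{dij}=n\sum_sp_s\hat C_{sij}$, $C_{dij}=\hat C_{dij}-nG_i'\tilde BG_j$ with $G_1=\sum_sp_sT_sB_t$, $G_2=\sum_sp_sF_sB_t$; $c_{sij}=\mathrm{tr}(\hat C_{sij})$, $c_{dij}=n\sum_sp_sc_{sij}$; $q_s(x)=c_{s11}+2c_{s12}x+c_{s22}x^2$, $q_d(x)=\sum_sp_sq_s(x)$, $x_d=-c_{d12}/c_{d22}$. A design $d$ is pseudo symmetric if all treatments are equally replicated in each period (for all $k,i$: the sum of $p_s$ over sequences $s$ with $t_k=i$ is $1/t$) and the matrices $C_{dij}$, $1\le i,j\le2$, are completely symmetric (of the form $aI_t+bJ_t$). In the proportional model (carryover effects equal $\lambda$ times direct effects $\tau$), Fisher's information matrix for $\tau$ at $(\tau_0,\lambda_0)$ is $C_{d,\tau_0,\lambda_0}(\tau)=C_{d11}+\lambda_0(C_{d12}+C_{d21})+\lambda_0^2C_{d22}-(C_{d12}+\lambda_0C_{d22})\tau_0(\tau_0'C_{d22}\tau_0)^{-1}\tau_0'(C_{d21}+\lambda_0C_{d22})$, the last term being $0$ if $\tau_0'C_{d22}\tau_0=0$. The prior $g$ is a probability distribution on $\{\tau_0\in\mathbb{R}^t:1_t'\tau_0=0,\ \tau_0\ne0\}$; it is exchangeable if invariant under all permutations of coordinates. For a $t\times t$ nonnegative definite matrix $C$ with zero row and column sums and eigenvalues $0=a_0\le a_1\le\dots\le a_{t-1}$, $\Phi_A(C)=(t-1)(\sum_{i=1}^{t-1}a_i^{-1})^{-1}$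 (equal to $0$ if $a_1=0$). ${\cal A}_{g,\lambda_0}(d)=\mathbb{E}_g[\Phi_A(C_{d,\tau_0,\lambda_0}(\tau))]$, and a design is ${\cal A}_{g,\lambda_0}$-optimal if it maximizes this over all approximate designs. *)

theory Defs
  imports
    "HOL-Probability.Probability"
    "HOL-Combinatorics.Permutations"
    "Jordan_Normal_Form.Char_Poly"
    "Jordan_Normal_Form.Gauss_Jordan_Elimination"
begin

unbundle no inner_syntax
unbundle no vec_syntax

text \<open>
  Matrices and vectors are indexed from 0. Accordingly the treatments \<open>1, \<dots>, t\<close> are
  represented by \<open>0, \<dots>, t - 1\<close> and the periods \<open>1, \<dots>, p\<close> by \<open>0, \<dots>, p - 1\<close>.
\<close>

definition ones_vec :: "nat \<Rightarrow> real vec" where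
  "ones_vec k = vec k (\<lambda>_. 1)"

definition J_mat :: "nat \<Rightarrow> real mat" where
  "J_mat k = mat k k (\<lambda>_. 1)"

definition B_mat :: "nat \<Rightarrow> real mat" where
  "B_mat k = 1\<^sub>m k - (1 / real k) \<cdot>\<^sub>m J_mat k"

definition trace_mat :: "real mat \<Rightarrow> real" where
  "trace_mat A = sum_list (diag_mat A)"

definition symmetric_pos_def :: "nat \<Rightarrow> real mat \<Rightarrow> bool" where
  "symmetric_pos_def p A \<longleftrightarrow> A \<in> carrier_mat p p \<and> A\<^sup>T = A \<and>
     (\<forall>v \<in> carrier_vec p. v \<noteq> 0\<^sub>v p \<longrightarrow> v \<bullet> (A *\<^sub>v v) > 0)"

definition completely_symmetric :: "nat \<Rightarrow> real mat \<Rightarrow> bool" where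
  "completely_symmetric t A \<longleftrightarrow> (\<exists>a b. A = a \<cdot>\<^sub>m 1\<^sub>m t + b \<cdot>\<^sub>m J_mat t)"

definition Btilde :: "nat \<Rightarrow> real mat \<Rightarrow> real mat" where
  "Btilde p \<Sigma> =
     (let S = the (mat_inverse \<Sigma>)
      in S - (1 / (ones_vec p \<bullet> (S *\<^sub>v ones_vec p))) \<cdot>\<^sub>m (S * J_mat p * S))"

subsection \<open>Sequences and designs\<close>

definition seqs :: "nat \<Rightarrow> nat \<Rightarrow> nat list set" where
  "seqs p t = {s. length s = p \<and> set s \<subseteq> {..<t}}"

definition T_mat :: "nat \<Rightarrow> nat \<Rightarrow> nat list \<Rightarrow> real mat" where
  "T_mat p t s = mat p t (\<lambda>(k, i). if s ! k = i then 1 else 0)"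

definition F_mat :: "nat \<Rightarrow> nat \<Rightarrow> nat list \<Rightarrow> real mat" where
  "F_mat p t s = mat p t (\<lambda>(k, i). if k \<noteq> 0 \<and> s ! (k - 1) = i then 1 else 0)"

text \<open>The index \<open>i\<close> of \<open>G_mat\<close> is only meaningful for \<open>i \<in> {1, 2}\<close>.\<close>

definition G_mat :: "nat \<Rightarrow> nat \<Rightarrow> nat \<Rightarrow> nat list \<Rightarrow> real mat" where
  "G_mat p t i s = (if i = 1 then T_mat p t s else F_mat p t s)"

text \<open>A design is a weight function on sequences; its values outside \<open>seqs p t\<close> are irrelevant.\<close>

definition is_design :: "nat \<Rightarrow> nat \<Rightarrow> (nat list \<Rightarrow> real) \<Rightarrow> bool" where
  "is_design p t P \<longleftrightarrow> (\<forall>s \<in> seqs p t. P s \<ge> 0) \<and> (\<Sum>s \<in> seqs p t. P s) = 1"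

text \<open>The entrywise sum \<open>\<Sum>s. P s \<cdot>\<^sub>m M s\<close> of \<open>r \<times> c\<close> matrices; the matrix type has no
  additive monoid instance, so \<open>sum\<close> does not apply.\<close>

definition wsum_mat ::
    "nat \<Rightarrow> nat \<Rightarrow> nat list set \<Rightarrow> (nat list \<Rightarrow> real) \<Rightarrow> (nat list \<Rightarrow> real mat) \<Rightarrow> real mat" where
  "wsum_mat r c S P M = mat r c (\<lambda>ij. \<Sum>s \<in> S. P s * (M s $$ ij))"

definition Chat_seq :: "nat \<Rightarrow> nat \<Rightarrow> real mat \<Rightarrow> nat list \<Rightarrow> nat \<Rightarrow> nat \<Rightarrow> real mat" where
  "Chat_seq p t \<Sigma> s i j =
     B_mat t * (G_mat p t i s)\<^sup>T * Btilde p \<Sigma> * G_mat p t j s * B_mat t"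

definition Chat_design ::
    "nat \<Rightarrow> nat \<Rightarrow> nat \<Rightarrow> real mat \<Rightarrow> (nat list \<Rightarrow> real) \<Rightarrow> nat \<Rightarrow> nat \<Rightarrow> real mat" where
  "Chat_design p t n \<Sigma> P i j =
     real n \<cdot>\<^sub>m wsum_mat t t (seqs p t) P (\<lambda>s. Chat_seq p t \<Sigma> s i j)"

definition G_design :: "nat \<Rightarrow> nat \<Rightarrow> (nat list \<Rightarrow> real) \<Rightarrow> nat \<Rightarrow> real mat" where
  "G_design p t P i = wsum_mat p t (seqs p t) P (\<lambda>s. G_mat p t i s * B_mat t)"

definition C_design ::
    "nat \<Rightarrow> nat \<Rightarrow> nat \<Rightarrow> real mat \<Rightarrow> (nat list \<Rightarrow> real) \<Rightarrow> nat \<Rightarrow> nat \<Rightarrow> real mat" where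
  "C_design p t n \<Sigma> P i j =
     Chat_design p t n \<Sigma> P i j -
     real n \<cdot>\<^sub>m ((G_design p t P i)\<^sup>T * Btilde p \<Sigma> * G_design p t P j)"

definition c_seq :: "nat \<Rightarrow> nat \<Rightarrow> real mat \<Rightarrow> nat list \<Rightarrow> nat \<Rightarrow> nat \<Rightarrow> real" where
  "c_seq p t \<Sigma> s i j = trace_mat (Chat_seq p t \<Sigma> s i j)"

definition c_design ::
    "nat \<Rightarrow> nat \<Rightarrow> nat \<Rightarrow> real mat \<Rightarrow> (nat list \<Rightarrow> real) \<Rightarrow> nat \<Rightarrow> nat \<Rightarrow> real" where
  "c_design p t n \<Sigma> P i j = real n * (\<Sum>s \<in> seqs p t. P s * c_seq p t \<Sigma> s i j)"

definition q_seq :: "nat \<Rightarrow> nat \<Rightarrow> real mat \<Rightarrow> nat list \<Rightarrow> real \<Rightarrow> real" where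
  "q_seq p t \<Sigma> s x =
     c_seq p t \<Sigma> s 1 1 + 2 * c_seq p t \<Sigma> s 1 2 * x + c_seq p t \<Sigma> s 2 2 * x\<^sup>2"

definition q_design :: "nat \<Rightarrow> nat \<Rightarrow> real mat \<Rightarrow> (nat list \<Rightarrow> real) \<Rightarrow> real \<Rightarrow> real" where
  "q_design p t \<Sigma> P x = (\<Sum>s \<in> seqs p t. P s * q_seq p t \<Sigma> s x)"

definition x_design :: "nat \<Rightarrow> nat \<Rightarrow> nat \<Rightarrow> real mat \<Rightarrow> (nat list \<Rightarrow> real) \<Rightarrow> real" where
  "x_design p t n \<Sigma> P = - c_design p t n \<Sigma> P 1 2 / c_design p t n \<Sigma> P 2 2"

definition pseudo_symmetric ::
    "nat \<Rightarrow> nat \<Rightarrow> nat \<Rightarrow> real mat \<Rightarrow> (nat list \<Rightarrow> real) \<Rightarrow> bool" where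
  "pseudo_symmetric p t n \<Sigma> P \<longleftrightarrow>
     (\<forall>k < p. \<forall>i < t. (\<Sum>s \<in> {s \<in> seqs p t. s ! k = i}. P s) = 1 / real t) \<and>
     (\<forall>i \<in> {1, 2}. \<forall>j \<in> {1, 2}. completely_symmetric t (C_design p t n \<Sigma> P i j))"

subsection \<open>Information matrix, prior and criterion\<close>

definition info_mat ::
    "nat \<Rightarrow> nat \<Rightarrow> nat \<Rightarrow> real mat \<Rightarrow> (nat list \<Rightarrow> real) \<Rightarrow> real vec \<Rightarrow> real \<Rightarrow> real mat" where
  "info_mat p t n \<Sigma> P \<tau>0 lam =
     (let C = C_design p t n \<Sigma> P;
          h = \<tau>0 \<bullet> (C 2 2 *\<^sub>v \<tau>0);
          \<tau>\<tau> = mat t t (\<lambda>(i, j). \<tau>0 $ i * \<tau>0 $ j)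
      in C 1 1 + lam \<cdot>\<^sub>m (C 1 2 + C 2 1) + lam\<^sup>2 \<cdot>\<^sub>m C 2 2 -
         (if h = 0 then 0\<^sub>m t t
          else (1 / h) \<cdot>\<^sub>m ((C 1 2 + lam \<cdot>\<^sub>m C 2 2) * \<tau>\<tau> * (C 2 1 + lam \<cdot>\<^sub>m C 2 2))))"

text \<open>The real eigenvalues in increasing order, repeated according to algebraic multiplicity;
  for a symmetric matrix of dimension \<open>t\<close> this list has length \<open>t\<close>.\<close>

definition eigenvalue_list :: "real mat \<Rightarrow> real list" where
  "eigenvalue_list A = sorted_list_of_multiset (proots (char_poly A))"

definition Phi_A :: "nat \<Rightarrow> real mat \<Rightarrow> real" where
  "Phi_A t C =
     (let a = eigenvalue_list C
      in if a ! 1 = 0 then 0 else (real t - 1) * inverse (\<Sum>i = 1..t - 1. inverse (a ! i)))"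

text \<open>A vector \<open>\<tau>0\<close> is represented by the function of its coordinates, extensional on
  \<open>{..<t}\<close>, so that the prior lives on the product Borel space.\<close>

definition is_prior :: "nat \<Rightarrow> (nat \<Rightarrow> real) measure \<Rightarrow> bool" where
  "is_prior t g \<longleftrightarrow> prob_space g \<and> sets g = sets (PiM {..<t} (\<lambda>_. borel)) \<and>
     (AE \<tau> in g. (\<Sum>i<t. \<tau> i) = 0 \<and> (\<exists>i<t. \<tau> i \<noteq> 0))"

definition exchangeable :: "nat \<Rightarrow> (nat \<Rightarrow> real) measure \<Rightarrow> bool" where
  "exchangeable t g \<longleftrightarrow>
     (\<forall>\<sigma>. \<sigma> permutes {..<t} \<longrightarrow> distr g g (\<lambda>\<tau>. \<lambda>i\<in>{..<t}. \<tau> (\<sigma> i)) = g)"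

definition A_crit ::
    "nat \<Rightarrow> nat \<Rightarrow> nat \<Rightarrow> real mat \<Rightarrow> (nat \<Rightarrow> real) measure \<Rightarrow> real \<Rightarrow> (nat list \<Rightarrow> real) \<Rightarrow> real" where
  "A_crit p t n \<Sigma> g lam P = (\<integral>\<tau>. Phi_A t (info_mat p t n \<Sigma> P (vec t \<tau>) lam) \<partial>g)"

definition A_optimal ::
    "nat \<Rightarrow> nat \<Rightarrow> nat \<Rightarrow> real mat \<Rightarrow> (nat \<Rightarrow> real) measure \<Rightarrow> real \<Rightarrow> (nat list \<Rightarrow> real) \<Rightarrow> bool" where
  "A_optimal p t n \<Sigma> g lam P \<longleftrightarrow> is_design p t P \<and>
     (\<forall>P'. is_design p t P' \<longrightarrow> A_crit p t n \<Sigma> g lam P' \<le> A_crit p t n \<Sigma> g lam P)"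

definition pi_design :: "nat \<Rightarrow> nat \<Rightarrow> nat \<Rightarrow> real mat \<Rightarrow> real \<Rightarrow> (nat list \<Rightarrow> real) \<Rightarrow> real" where
  "pi_design p t n \<Sigma> lam P =
     q_design p t \<Sigma> P lam /
     (q_design p t \<Sigma> P lam + (real t - 2) * q_design p t \<Sigma> P (x_design p t n \<Sigma> P))"

definition sensitivity ::
    "nat \<Rightarrow> nat \<Rightarrow> nat \<Rightarrow> real mat \<Rightarrow> real \<Rightarrow> (nat list \<Rightarrow> real) \<Rightarrow> nat list \<Rightarrow> real" where
  "sensitivity p t n \<Sigma> lam P s =
     (let x = x_design p t n \<Sigma> P; \<pi> = pi_design p t n \<Sigma> lam P
      in \<pi> * (q_seq p t \<Sigma> s x / q_design p t \<Sigma> P x) +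
         (1 - \<pi>) * (q_seq p t \<Sigma> s lam / q_design p t \<Sigma> P lam))"

end

theory Submission
  imports Defs "Jordan_Normal_Form.Schur_Decomposition"
begin

text \<open>
  The criterion \<open>\<Phi>\<^sub>A\<close> is concave, so it lies below its supporting hyperplanes; for a fixed direction
  \<open>\<tau>\<close> we use the one at \<open>\<alpha> F + \<beta> E\<close>, where \<open>E\<close> and \<open>F\<close> project onto \<open>\<tau>\<close> and onto the complement of
  \<open>\<tau>\<close> and the all-ones vector. The information matrix is a Schur complement, hence a minimum of quadratic
  forms: along \<open>\<tau>\<close> it is at most \<open>C\<^sub>d(x)\<close> for every \<open>x\<close>, and across \<open>\<tau>\<close> at most \<open>C\<^sub>d(\<lambda>\<^sub>0)\<close>. Exchangeability
  turns \<open>\<tau> \<tau>' / |\<tau>|\<^sup>2\<close> into \<open>B\<^sub>t / (t - 1)\<close> on average, so the criterion of any design is bounded by a linear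
  function of \<open>q\<^sub>d(\<lambda>\<^sub>0)\<close> and \<open>q\<^sub>d(x)\<close>. For a pseudo symmetric design all eigenvalues are explicit and do not
  depend on \<open>\<tau>\<close>, the criterion is \<open>n / ((t - 2) / q\<^sub>d(\<lambda>\<^sub>0) + 1 / q\<^sub>d(x\<^sub>d))\<close>, and the bound at \<open>x = x\<^sub>d\<close> becomes the
  weighted mean of the sensitivities. Conversely, moving a little mass of an optimal design to the
  symmetrization of a sequence \<open>s\<close> cannot increase the criterion, and the derivative gives the
  sensitivity bound for \<open>s\<close>.
\<close>

section \<open>Orthogonal diagonalization\<close>

text \<open>The point \<open>\<alpha> F + \<beta> E\<close> is the information matrix of a pseudo
  symmetric design itself, so the hyperplane bound is tight there. It enters only through its
  Moore-Penrose inverse \<open>x F + y E\<close>. Dividing \<open>y\<close> and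
  \<open>(t - 2) x\<close> by their sum gives exactly \<open>\<pi>_d\<close> and
  \<open>1 - \<pi>_d\<close>; this is the origin of the weight in the statement. The obstacle is
  that \<open>q_d\<close> is built from the uncentred traces \<open>c_dij\<close>, whereas the
  information uses \<open>C_dij\<close>, from which the period means have been removed. For a
  competitor the removed part is nonnegative, so an inequality in the right direction remains; equal
  replication turns it into an equality. Conversely, a perturbed design is in general not pseudo
  symmetric and its own criterion is out of reach. Averaging over relabellings keeps all
  \<open>c_dij\<close>, hence \<open>q_d\<close> and \<open>x_d\<close>, and restores the explicit
  formula. Positivity of \<open>q_d(x_d)\<close> has to be settled before any quotient is formed; it
  comes from the same bound with \<open>(x, y) = (0, 1)\<close>.\<close>

lemma scalar_prod_mult_mat_vec_symmetric:
  fixes A :: "'a :: comm_semiring_0 mat"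
  assumes "A \<in> carrier_mat n n" "A\<^sup>T = A" "v \<in> carrier_vec n" "w \<in> carrier_vec n"
  shows "(A *\<^sub>v v) \<bullet> w = v \<bullet> (A *\<^sub>v w)"
  using assms by (metis transpose_vec_mult_scalar comm_scalar_prod mult_mat_vec_carrier)

text \<open>Over the complex numbers the characteristic polynomial splits. Symmetry gives
  \<open>z |v|^2 = cnj z |v|^2\<close> for an eigenpair, so the root is real and is already a root
  of the real characteristic polynomial.\<close>

lemma symmetric_real_eigenvalue_exists:
  fixes A :: "real mat"
  assumes A: "A \<in> carrier_mat n n" and sym: "A\<^sup>T = A" and n: "n > 0"
  shows "\<exists>e. eigenvalue A e"
proof -
  let ?A = "map_mat complex_of_real A"
  have cA: "?A \<in> carrier_mat n n" using A by simp
  have symc: "?A\<^sup>T = ?A" using sym by (metis map_mat_transpose)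
  obtain as where cp: "char_poly ?A = (\<Prod>a\<leftarrow>as. [:- a, 1:])" and len: "length as = n"
    using char_poly_factorized[OF cA] by blast
  obtain z zs where as: "as = z # zs" using len n by (cases as) auto
  have "eigenvalue ?A z"
    by (simp add: eigenvalue_root_char_poly[OF cA] cp as)
  then obtain v where v: "v \<in> carrier_vec n" and v0: "v \<noteq> 0\<^sub>v n" and ev: "?A *\<^sub>v v = z \<cdot>\<^sub>v v"
    unfolding eigenvalue_def eigenvector_def using cA by auto
  have cv: "conjugate v \<in> carrier_vec n" using v by simp
  have Ac: "?A *\<^sub>v conjugate v = conjugate (?A *\<^sub>v v)"
    using A v by (intro eq_vecI) (auto simp: scalar_prod_def)
  have "z * (v \<bullet>c v) = (?A *\<^sub>v v) \<bullet>c v"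
    using v by (simp add: ev)
  also have "\<dots> = v \<bullet> (?A *\<^sub>v conjugate v)"
    by (rule scalar_prod_mult_mat_vec_symmetric[OF cA symc v cv])
  also have "\<dots> = cnj z * (v \<bullet>c v)"
    using v by (simp add: Ac ev conjugate_smult_vec)
  finally have "z = cnj z"
    using conjugate_square_eq_0_vec[OF v] v0 by simp
  then have z: "z = complex_of_real (Re z)"
    by (simp add: complex_eq_iff)
  have "poly (char_poly ?A) z = 0" by (simp add: cp as)
  then have "poly (char_poly A) (Re z) = 0"
    by (metis z of_real_hom.char_poly_hom[OF A] of_real_hom.poly_map_poly of_real_eq_0_iff)
  then show ?thesis using eigenvalue_root_char_poly[OF A] by blast
qed

text \<open>Gram-Schmidt applied to a basis that starts with \<open>v\<close> leaves
  \<open>v\<close> in first place; only the normalization of the columns has to be added.\<close>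

lemma orthonormal_completion:
  fixes v :: "real vec"
  assumes v: "v \<in> carrier_vec n" and v0: "v \<noteq> 0\<^sub>v n"
  shows "\<exists>W c. W \<in> carrier_mat n n \<and> W\<^sup>T * W = 1\<^sub>m n \<and> col W 0 = c \<cdot>\<^sub>v v \<and> c \<noteq> 0"
proof -
  interpret cof_vec_space n "TYPE(real)" .
  have n: "n > 0" using v v0 by (cases n) auto
  define ws where "ws = gram_schmidt n (basis_completion v)"
  from basis_completion[OF v v0]
  have dist_b: "distinct (basis_completion v)" and indep: "\<not> lin_dep (set (basis_completion v))"
    and b: "set (basis_completion v) \<subseteq> carrier_vec n" and hdb: "hd (basis_completion v) = v"
    and len_b: "length (basis_completion v) = n" by auto
  from hdb len_b n obtain vs where bv: "basis_completion v = v # vs"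
    by (cases "basis_completion v") auto
  from gram_schmidt_result[OF b dist_b indep refl, folded ws_def]
  have ws: "set ws \<subseteq> carrier_vec n" "corthogonal ws" "length ws = n"
    by (auto simp: len_b)
  have hdws: "hd ws = v" using gram_schmidt_hd[OF v, of vs, folded bv] unfolding ws_def .
  have car: "ws ! i \<in> carrier_vec n" if "i < n" for i using ws that by auto
  have orth: "(ws ! i \<bullet> ws ! j = 0) = (i \<noteq> j)" if "i < n" "j < n" for i j
    using corthogonalD[OF ws(2)] that ws(3) by simp
  have pos: "ws ! i \<bullet> ws ! i > 0" if "i < n" for i
    using orth[OF that that] sum_nonneg[of "{0..<dim_vec (ws ! i)}" "\<lambda>k. (ws ! i) $ k * (ws ! i) $ k"]
    by (simp add: scalar_prod_def less_le)
  define c where "c i = 1 / sqrt (ws ! i \<bullet> ws ! i)" for i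
  define W where "W = mat_of_cols n (map (\<lambda>i. c i \<cdot>\<^sub>v ws ! i) [0..<n])"
  have W: "W \<in> carrier_mat n n" unfolding W_def by auto
  have colW: "col W i = c i \<cdot>\<^sub>v ws ! i" if "i < n" for i
    unfolding W_def using that car by (subst col_mat_of_cols) auto
  have "W\<^sup>T * W = 1\<^sub>m n"
  proof (rule eq_matI)
    fix i j assume "i < dim_row (1\<^sub>m n :: real mat)" "j < dim_col (1\<^sub>m n :: real mat)"
    then have i: "i < n" and j: "j < n" by auto
    have "(W\<^sup>T * W) $$ (i, j) = col W i \<bullet> col W j" using W i j by simp
    also have "\<dots> = c i * c j * (ws ! i \<bullet> ws ! j)"
      using car[OF i] car[OF j] by (simp add: colW i j)
    also have "\<dots> = (if i = j then 1 else 0)"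
      using orth[OF i j] pos[OF i] by (auto simp: c_def)
    finally show "(W\<^sup>T * W) $$ (i, j) = 1\<^sub>m n $$ (i, j)" using i j by simp
  qed (use W in auto)
  moreover have "col W 0 = c 0 \<cdot>\<^sub>v v"
    using colW[OF n] hdws ws(3) n by (metis hd_conv_nth less_numeral_extra(3) list.size(3))
  moreover have "c 0 \<noteq> 0" using pos[OF n] by (simp add: c_def)
  ultimately show ?thesis using W by blast
qed

text \<open>Deflation: in an orthonormal basis that starts with an eigenvector, the matrix splits
  into a 1 x 1 block and a symmetric block of size one less. The form \<open>A Q = Q E\<close> lets
  the columns of \<open>Q\<close> be read as eigenvectors.\<close>

theorem symmetric_real_orthogonal_diagonalization:
  fixes A :: "real mat"
  assumes "A \<in> carrier_mat n n" and "A\<^sup>T = A"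
  shows "\<exists>Q es. Q \<in> carrier_mat n n \<and> Q\<^sup>T * Q = 1\<^sub>m n \<and> length es = n \<and>
    A * Q = Q * mat n n (\<lambda>(i, j). if i = j then es ! i else 0)"
  using assms
proof (induction n arbitrary: A)
  case 0
  then show ?case by (intro exI[of _ "1\<^sub>m 0"] exI[of _ "[]"]) auto
next
  case (Suc m)
  let ?n = "Suc m"
  note A = Suc.prems(1) and sym = Suc.prems(2)
  obtain e where "eigenvalue A e"
    using symmetric_real_eigenvalue_exists[OF A sym] by blast
  then obtain v where v: "v \<in> carrier_vec ?n" "v \<noteq> 0\<^sub>v ?n" "A *\<^sub>v v = e \<cdot>\<^sub>v v"
    unfolding eigenvalue_def eigenvector_def using A by auto
  obtain W c where W: "W \<in> carrier_mat ?n ?n" and WW: "W\<^sup>T * W = 1\<^sub>m ?n"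
    and W0: "col W 0 = c \<cdot>\<^sub>v v"
    using orthonormal_completion[OF v(1,2)] by blast
  have WW': "W * W\<^sup>T = 1\<^sub>m ?n"
    using WW W by (metis mat_mult_left_right_inverse transpose_carrier_mat)
  define A' where "A' = W\<^sup>T * A * W"
  have A': "A' \<in> carrier_mat ?n ?n" using W A by (simp add: A'_def)
  have symA': "A'\<^sup>T = A'"
    unfolding A'_def using W A sym
    by (simp add: transpose_mult[of _ ?n ?n _ ?n] assoc_mult_mat[of _ ?n ?n _ ?n _ ?n])
  \<comment> \<open>The first column of \<open>W\<close> is an eigenvector, so the first column of
    \<open>A'\<close> is \<open>e\<close> times a unit vector; symmetry then clears the first row as
    well.\<close>
  have col0: "A' $$ (i, 0) = (if i = 0 then e else 0)" if "i < ?n" for i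
  proof -
    have "A *\<^sub>v col W 0 = e \<cdot>\<^sub>v col W 0"
      using v A by (simp add: W0 mult_mat_vec smult_smult_assoc mult.commute)
    moreover have "col A' 0 = W\<^sup>T *\<^sub>v (A *\<^sub>v col W 0)"
    proof -
      have WT: "W\<^sup>T \<in> carrier_mat ?n ?n" using W by simp
      show ?thesis
        unfolding A'_def assoc_mult_mat[OF WT A W]
        using col_mult2[OF WT mult_carrier_mat[OF A W], of 0] col_mult2[OF A W, of 0] by simp
    qed
    moreover have "W\<^sup>T *\<^sub>v (e \<cdot>\<^sub>v col W 0) = e \<cdot>\<^sub>v col (W\<^sup>T * W) 0"
    proof -
      have WT: "W\<^sup>T \<in> carrier_mat ?n ?n" using W by simp
      have c: "col W 0 \<in> carrier_vec ?n" using W by (intro carrier_vecI) simp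
      show ?thesis
        by (simp only: mult_mat_vec[OF WT c] col_mult2[OF WT W zero_less_Suc])
    qed
    ultimately have "col A' 0 = e \<cdot>\<^sub>v col (W\<^sup>T * W) 0" by simp
    then have "col A' 0 $ i = (e \<cdot>\<^sub>v col (1\<^sub>m ?n) 0) $ i" by (simp add: WW)
    then show ?thesis using that A' by simp
  qed
  define A3 where "A3 = mat m m (\<lambda>(i, j). A' $$ (Suc i, Suc j))"
  have A3: "A3 \<in> carrier_mat m m" by (simp add: A3_def)
  have symA'_ij: "A' $$ (i, j) = A' $$ (j, i)" if "i < ?n" "j < ?n" for i j
    using arg_cong[OF symA', of "\<lambda>M. M $$ (j, i)"] that A' by simp
  have "A3\<^sup>T = A3"
    by (rule eq_matI) (auto simp: A3_def intro: symA'_ij)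
  from Suc.IH[OF A3 this] obtain Q es where Q: "Q \<in> carrier_mat m m" and QQ: "Q\<^sup>T * Q = 1\<^sub>m m"
    and len: "length es = m" and AQ: "A3 * Q = Q * mat m m (\<lambda>(i, j). if i = j then es ! i else 0)"
    by blast
  let ?E = "mat m m (\<lambda>(i, j). if i = j then es ! i else 0)"
  let ?E' = "mat ?n ?n (\<lambda>(i, j). if i = j then (e # es) ! i else 0)"
  define R where "R = four_block_mat (1\<^sub>m 1) (0\<^sub>m 1 m) (0\<^sub>m m 1) Q"
  have R: "R \<in> carrier_mat ?n ?n" using Q by (auto simp: R_def)
  have A'_block: "A' = four_block_mat (e \<cdot>\<^sub>m 1\<^sub>m 1) (0\<^sub>m 1 m) (0\<^sub>m m 1) A3"
    using A' col0 symA'_ij by (intro eq_matI) (auto simp: A3_def)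
  have E'_block: "?E' = four_block_mat (e \<cdot>\<^sub>m 1\<^sub>m 1) (0\<^sub>m 1 m) (0\<^sub>m m 1) ?E"
    by (intro eq_matI) (auto simp: nth_Cons')
  have "R\<^sup>T * R = four_block_mat (1\<^sub>m 1) (0\<^sub>m 1 m) (0\<^sub>m m 1) (1\<^sub>m m)"
    unfolding R_def using Q
    by (simp add: transpose_four_block_mat[of _ 1 1 _ m _ m] mult_four_block_mat[of _ 1 1 _ m _ m _ _ 1 _ m] QQ)
  then have RR: "R\<^sup>T * R = 1\<^sub>m ?n" by simp
  have AR: "A' * R = R * ?E'"
    unfolding R_def A'_block E'_block using Q A3
    by (simp add: mult_four_block_mat[of _ 1 1 _ m _ m _ _ 1 _ m] AQ)
  have "(W * R)\<^sup>T * (W * R) = R\<^sup>T * (W\<^sup>T * W) * R"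
    using W R by (simp add: transpose_mult[of _ ?n ?n _ ?n] assoc_mult_mat[of _ ?n ?n _ ?n _ ?n])
  then have "(W * R)\<^sup>T * (W * R) = 1\<^sub>m ?n" using R by (simp add: WW RR)
  moreover have "A * (W * R) = (W * R) * ?E'"
  proof -
    have "A * (W * R) = (W * W\<^sup>T) * A * (W * R)" using A by (simp add: WW')
    also have "\<dots> = W * (A' * R)"
      unfolding A'_def using W R A by (simp add: assoc_mult_mat[of _ ?n ?n _ ?n _ ?n])
    also have "\<dots> = (W * R) * ?E'"
      unfolding AR using W R by (simp add: assoc_mult_mat[of _ ?n ?n _ ?n _ ?n])
    finally show ?thesis .
  qed
  ultimately show ?case
    using W R len by (intro exI[of _ "W * R"] exI[of _ "e # es"]) auto
qed

text \<open>Here \<open>v i\<close> is the i-th eigenvector. Orthonormality and completeness are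
  both recorded, since each is used as a rewriting rule for sums. Sortedness is what gives the
  entries \<open>a ! 0\<close> and \<open>a ! 1\<close> their meaning in
  \<open>Phi_A\<close>.\<close>

definition eigenbasis :: "real mat \<Rightarrow> real list \<Rightarrow> (nat \<Rightarrow> nat \<Rightarrow> real) \<Rightarrow> bool" where
  "eigenbasis C a v \<longleftrightarrow> (let t = dim_row C in length a = t \<and> sorted a \<and>
     (\<forall>i<t. \<forall>j<t. (\<Sum>k<t. v i k * v j k) = (if i = j then 1 else 0)) \<and>
     (\<forall>j<t. \<forall>k<t. (\<Sum>i<t. v i j * v i k) = (if j = k then 1 else 0)) \<and>
     (\<forall>i<t. \<forall>j<t. (\<Sum>k<t. C $$ (j, k) * v i k) = a ! i * v i j))"

lemma eigenbasisD:
  assumes "eigenbasis C a v" "C \<in> carrier_mat t t"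
  shows "length a = t" "sorted a"
    "i < t \<Longrightarrow> j < t \<Longrightarrow> (\<Sum>k<t. v i k * v j k) = (if i = j then 1 else 0)"
    "j < t \<Longrightarrow> k < t \<Longrightarrow> (\<Sum>i<t. v i j * v i k) = (if j = k then 1 else 0)"
    "i < t \<Longrightarrow> j < t \<Longrightarrow> (\<Sum>k<t. C $$ (j, k) * v i k) = a ! i * v i j"
  using assms unfolding eigenbasis_def Let_def by auto

text \<open>\<open>eigenvalue_list\<close> comes from the roots of the characteristic polynomial,
  the diagonalization from an unordered list \<open>es\<close>. Similarity shows that the multisets
  agree, and a permutation of the columns of \<open>Q\<close> matches the sorted order.\<close>

lemma eigenbasis_exists:
  assumes C: "C \<in> carrier_mat t t" and sym: "C\<^sup>T = C"
  shows "\<exists>v. eigenbasis C (eigenvalue_list C) v"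
proof -
  obtain Q es where Q: "Q \<in> carrier_mat t t" and QQ: "Q\<^sup>T * Q = 1\<^sub>m t" and len: "length es = t"
    and CQ: "C * Q = Q * mat t t (\<lambda>(i, j). if i = j then es ! i else 0)"
    using symmetric_real_orthogonal_diagonalization[OF C sym] by blast
  define E where "E = mat t t (\<lambda>(i, j). if i = j then es ! i else 0)"
  have E: "E \<in> carrier_mat t t" by (simp add: E_def)
  have QT: "Q\<^sup>T \<in> carrier_mat t t" using Q by simp
  have QQ': "Q * Q\<^sup>T = 1\<^sub>m t"
    using mat_mult_left_right_inverse[OF QT Q QQ] .
  have "C = C * (Q * Q\<^sup>T)" using C by (simp add: QQ')
  also have "\<dots> = C * Q * Q\<^sup>T" by (rule assoc_mult_mat[OF C Q QT, symmetric])
  finally have "C = Q * E * Q\<^sup>T" by (simp only: CQ E_def)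
  then have "similar_mat_wit C E Q Q\<^sup>T"
    by (rule similar_mat_witI[OF QQ' QQ _ C E Q QT])
  then have "similar_mat C E" unfolding similar_mat_def by blast
  then have "char_poly C = char_poly E" by (rule char_poly_similar)
  also have "\<dots> = (\<Prod>a\<leftarrow>diag_mat E. [:- a, 1:])"
    by (rule char_poly_upper_triangular[OF E]) (auto simp: E_def)
  also have "diag_mat E = es"
    by (rule nth_equalityI) (auto simp: diag_mat_def E_def len)
  finally have cp: "char_poly C = (\<Prod>a\<leftarrow>es. [:- a, 1:])" .
  have "proots (\<Prod>a\<leftarrow>xs. [:- a, 1:]) = mset xs" for xs :: "real list"
  proof (induction xs)
    case (Cons x xs)
    have "(\<Prod>a\<leftarrow>xs. [:- a, 1:]) \<noteq> 0" by (auto simp: prod_list_zero_iff)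
    then have "proots ([:- x, 1:] * (\<Prod>a\<leftarrow>xs. [:- a, 1:])) = add_mset x (mset xs)"
      by (subst proots_mult) (auto simp: Cons.IH)
    then show ?case by simp
  qed simp
  then have el: "eigenvalue_list C = sort es"
    unfolding eigenvalue_list_def cp by (simp add: sorted_list_of_multiset_mset)
  have "mset (sort es) = mset es" by simp
  then obtain p where p: "p permutes {..<length es}" and pes: "permute_list p es = sort es"
    by (rule mset_eq_permutation)
  have pt: "p permutes {..<t}" using p len by simp
  have pl: "p i < t" if "i < t" for i using permutes_in_image[OF pt, of i] that by simp
  define v where "v i k = Q $$ (k, p i)" for i k
  have orth: "(\<Sum>k<t. v i k * v j k) = (if i = j then 1 else 0)" if "i < t" "j < t" for i j
  proof -
    have "(\<Sum>k<t. v i k * v j k) = (Q\<^sup>T * Q) $$ (p i, p j)"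
      using that pl Q by (simp add: v_def scalar_prod_def lessThan_atLeast0)
    also have "\<dots> = (if i = j then 1 else 0)"
      using that pl inj_eq[OF permutes_inj[OF pt], of i j] by (simp add: QQ)
    finally show ?thesis .
  qed
  have compl: "(\<Sum>i<t. v i j * v i k) = (if j = k then 1 else 0)" if "j < t" "k < t" for j k
  proof -
    have "(\<Sum>i<t. v i j * v i k) = (\<Sum>i<t. Q $$ (j, i) * Q $$ (k, i))"
      using sum.permute[OF pt, of "\<lambda>i. Q $$ (j, i) * Q $$ (k, i)"] by (simp add: v_def o_def)
    also have "\<dots> = (Q * Q\<^sup>T) $$ (j, k)"
      using that Q by (simp add: scalar_prod_def lessThan_atLeast0)
    finally show ?thesis using that by (simp add: QQ')
  qed
  have eig: "(\<Sum>k<t. C $$ (j, k) * v i k) = eigenvalue_list C ! i * v i j" if "i < t" "j < t" for i j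
  proof -
    have "(\<Sum>k<t. C $$ (j, k) * v i k) = (C * Q) $$ (j, p i)"
      using that pl C Q by (simp add: v_def scalar_prod_def lessThan_atLeast0)
    also have "\<dots> = (Q * E) $$ (j, p i)" by (simp only: CQ E_def)
    also have "\<dots> = (\<Sum>k<t. if k = p i then Q $$ (j, k) * es ! k else 0)"
    proof -
      have "(Q * E) $$ (j, p i) = (\<Sum>k<t. Q $$ (j, k) * E $$ (k, p i))"
        using that pl Q E by (simp add: scalar_prod_def lessThan_atLeast0)
      also have "\<dots> = (\<Sum>k<t. if k = p i then Q $$ (j, k) * es ! k else 0)"
        using pl[OF that(1)] by (intro sum.cong) (simp_all add: E_def)
      finally show ?thesis .
    qed
    also have "\<dots> = es ! p i * v i j" using that pl by (simp add: v_def)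
    also have "es ! p i = eigenvalue_list C ! i"
      using permute_list_nth[OF p, of i] that len by (simp add: el pes)
    finally show ?thesis .
  qed
  have "eigenbasis C (eigenvalue_list C) v"
    using C unfolding eigenbasis_def Let_def by (simp add: orth compl eig) (simp add: el len)
  then show ?thesis by blast
qed

section \<open>The A-criterion\<close>

lemma psd_eigenvalue_list_nonneg:
  fixes v :: "nat \<Rightarrow> real"
  assumes psd: "\<And>u :: nat \<Rightarrow> real. (\<Sum>j<t. \<Sum>k<t. C j k * u j * u k) \<ge> 0"
    and orth: "(\<Sum>k<t. v k * v k) = 1"
    and eig: "\<And>j. j < t \<Longrightarrow> (\<Sum>k<t. C j k * v k) = a * v j"
  shows "a \<ge> 0"
proof -
  have "(\<Sum>j<t. \<Sum>k<t. C j k * v j * v k) = (\<Sum>j<t. v j * (\<Sum>k<t. C j k * v k))"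
    by (simp add: sum_distrib_left mult_ac)
  also have "\<dots> = (\<Sum>j<t. v j * (a * v j))"
    by (intro sum.cong refl) (simp add: eig)
  also have "\<dots> = a * (\<Sum>j<t. v j * v j)"
    by (simp add: sum_distrib_left mult_ac)
  finally show ?thesis using psd[of v] orth by simp
qed

lemma trace_orthonormal_basis:
  fixes v :: "nat \<Rightarrow> nat \<Rightarrow> real"
  assumes "\<And>j k. j < t \<Longrightarrow> k < t \<Longrightarrow> (\<Sum>i<t. v i j * v i k) = (if j = k then 1 else 0)"
  shows "(\<Sum>i<t. \<Sum>j<t. v i j * (\<Sum>k<t. D j k * v i k)) = (\<Sum>j<t. D j j)"
proof -
  have "(\<Sum>i<t. \<Sum>j<t. v i j * (\<Sum>k<t. D j k * v i k)) = (\<Sum>i<t. \<Sum>j<t. \<Sum>k<t. D j k * (v i j * v i k))"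
    by (simp add: sum_distrib_left mult_ac)
  also have "\<dots> = (\<Sum>j<t. \<Sum>i<t. \<Sum>k<t. D j k * (v i j * v i k))"
    by (rule sum.swap)
  also have "\<dots> = (\<Sum>j<t. \<Sum>k<t. \<Sum>i<t. D j k * (v i j * v i k))"
    by (intro sum.cong refl sum.swap)
  also have "\<dots> = (\<Sum>j<t. \<Sum>k<t. D j k * (if j = k then 1 else 0))"
    using assms by (intro sum.cong refl) (simp add: sum_distrib_left[symmetric])
  also have "\<dots> = (\<Sum>j<t. D j j)"
    by (intro sum.cong refl) (simp add: if_distrib[of "\<lambda>x. _ * x"] cong: if_cong)
  finally show ?thesis .
qed

text \<open>The all-ones vector is a left null vector, hence orthogonal to every eigenvector of a
  nonzero eigenvalue.\<close>

lemma sum_eigenvector_eq_0: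
  fixes v :: "nat \<Rightarrow> real"
  assumes cols: "\<And>k. k < t \<Longrightarrow> (\<Sum>j<t. C j k) = 0"
    and eig: "\<And>j. j < t \<Longrightarrow> (\<Sum>k<t. C j k * v k) = a * v j" and "a \<noteq> 0"
  shows "(\<Sum>j<t. v j) = 0"
proof -
  have "a * (\<Sum>j<t. v j) = (\<Sum>j<t. \<Sum>k<t. C j k * v k)"
    by (simp add: eig sum_distrib_left)
  also have "\<dots> = (\<Sum>k<t. \<Sum>j<t. C j k * v k)" by (rule sum.swap)
  also have "\<dots> = (\<Sum>k<t. (\<Sum>j<t. C j k) * v k)" by (simp add: sum_distrib_right)
  also have "\<dots> = 0" by (simp add: cols)
  finally show ?thesis using \<open>a \<noteq> 0\<close> by simp
qed

lemma sum_lessThan_head: "t > 0 \<Longrightarrow> (\<Sum>i<t. f i) = f 0 + (\<Sum>i = 1..t - 1. f i)" for t :: nat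
proof -
  assume "t > 0"
  then have "{..<t} = insert 0 {1..t - 1}" by auto
  then show ?thesis by (simp add: sum.insert)
qed

text \<open>Expand the all-ones vector in the basis: only \<open>v 0\<close> has a nonzero
  coefficient, so the all-ones vector is \<open>(\<Sum>j<t. v 0 j)\<close> times
  \<open>v 0\<close>.\<close>

lemma const_if_others_sum_0:
  fixes v :: "nat \<Rightarrow> nat \<Rightarrow> real"
  assumes t: "t > 0"
    and compl: "\<And>j k. j < t \<Longrightarrow> k < t \<Longrightarrow> (\<Sum>i<t. v i j * v i k) = (if j = k then 1 else 0)"
    and z: "\<And>i. 1 \<le> i \<Longrightarrow> i < t \<Longrightarrow> (\<Sum>j<t. v i j) = 0" and k: "k < t"
  shows "v 0 k = 1 / (\<Sum>j<t. v 0 j)"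
proof -
  have "1 = (\<Sum>j<t. \<Sum>i<t. v i j * v i k)"
    using k by (simp add: compl)
  also have "\<dots> = (\<Sum>i<t. \<Sum>j<t. v i j * v i k)" by (rule sum.swap)
  also have "\<dots> = (\<Sum>i<t. (\<Sum>j<t. v i j) * v i k)" by (simp add: sum_distrib_right)
  also have "\<dots> = (\<Sum>j<t. v 0 j) * v 0 k"
  proof -
    have "(\<Sum>i = 1..t - 1. (\<Sum>j<t. v i j) * v i k) = 0"
      using t by (intro sum.neutral) (auto simp: z)
    then show ?thesis
      using sum_lessThan_head[OF t, of "\<lambda>i. (\<Sum>j<t. v i j) * v i k"] by simp
  qed
  finally show ?thesis by (metis mult_zero_left nonzero_mult_div_cancel_left zero_neq_one)
qed

text \<open>Concavity of \<open>Phi_A\<close>: this is its supporting hyperplane at the Moore--Penrose inverse of \<open>D\<close>.\<close>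

lemma Phi_A_le:
  assumes t: "t \<ge> 2" and C: "C \<in> carrier_mat t t" and sym: "C\<^sup>T = C"
    and psd: "\<And>u :: nat \<Rightarrow> real. (\<Sum>j<t. \<Sum>k<t. C $$ (j, k) * u j * u k) \<ge> 0"
    and cols: "\<And>k. k < t \<Longrightarrow> (\<Sum>j<t. C $$ (j, k)) = 0"
    and D1: "\<And>j. j < t \<Longrightarrow> (\<Sum>k<t. D j k) = 0"
  shows "Phi_A t C * (\<Sum>j<t. D j j)\<^sup>2 \<le>
    (real t - 1) * (\<Sum>l<t. \<Sum>j<t. \<Sum>k<t. C $$ (j, k) * D l j * D l k)" (is "_ \<le> _ * ?R")
proof -
  define a where "a = eigenvalue_list C"
  obtain v where v: "eigenbasis C a v" using eigenbasis_exists[OF C sym] unfolding a_def by blast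
  note len = eigenbasisD(1)[OF v C] and srt = eigenbasisD(2)[OF v C] and orth = eigenbasisD(3)[OF v C]
    and compl = eigenbasisD(4)[OF v C] and eig = eigenbasisD(5)[OF v C]
  have R0: "?R \<ge> 0" by (intro sum_nonneg psd)
  show ?thesis
  proof (cases "a ! 1 = 0")
    case True
    then show ?thesis using R0 t by (simp add: Phi_A_def a_def)
  next
    case False
    have nonneg: "a ! i \<ge> 0" if "i < t" for i
      using psd_eigenvalue_list_nonneg[OF psd] orth[OF that that] eig[OF that] by simp
    have pos: "a ! i > 0" if "i \<in> {1..t - 1}" for i
    proof -
      have "a ! 1 \<le> a ! i" using that len t by (intro sorted_nth_mono[OF srt]) auto
      then show ?thesis using False nonneg[of 1] t by linarith
    qed
    have mem: "i \<in> {1..t - 1} \<longleftrightarrow> 1 \<le> i \<and> i < t" for i using t by auto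
    have z: "(\<Sum>j<t. v i j) = 0" if "1 \<le> i" "i < t" for i
    proof (rule sum_eigenvector_eq_0[OF cols eig])
      show "a ! i \<noteq> 0" using that pos[of i] mem[of i] by simp
    qed (use that in auto)
    \<comment> \<open>\<open>w i\<close> is \<open>D v_i\<close>, and \<open>d i\<close> is the
      diagonal entry of \<open>D\<close> at \<open>v_i\<close> in the eigenbasis.\<close>
    define w where "w i j = (\<Sum>k<t. D j k * v i k)" for i j
    define d where "d i = (\<Sum>j<t. v i j * w i j)" for i
    \<comment> \<open>\<open>v 0\<close> is a multiple of the all-ones vector, which
      \<open>D\<close> annihilates. Index 0 therefore drops out of the trace of \<open>D\<close>,
      matching the range \<open>1..t - 1\<close> in \<open>Phi_A\<close>.\<close>
    have v0: "v 0 k = 1 / (\<Sum>j<t. v 0 j)" if "k < t" for k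
      using t that by (intro const_if_others_sum_0[OF _ compl z]) auto
    have "w 0 j = 0" if "j < t" for j
    proof -
      have "w 0 j = (\<Sum>k<t. D j k) * (1 / (\<Sum>j<t. v 0 j))"
        unfolding w_def sum_distrib_right by (intro sum.cong refl arg_cong2[of _ _ _ _ "(*)"] v0) auto
      then show ?thesis by (simp add: D1 that)
    qed
    then have "d 0 = 0" by (simp add: d_def)
    moreover have "(\<Sum>i<t. d i) = (\<Sum>j<t. D j j)"
      unfolding d_def w_def by (rule trace_orthonormal_basis[OF compl])
    ultimately have trD: "(\<Sum>j<t. D j j) = (\<Sum>i = 1..t - 1. d i)"
      using sum_lessThan_head[of t d] t by simp
    have Cdec: "(\<Sum>i<t. a ! i * v i j * v i k) = C $$ (j, k)" if "j < t" "k < t" for j k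
    proof -
      have "(\<Sum>i<t. a ! i * v i j * v i k) = (\<Sum>i<t. (\<Sum>l<t. C $$ (j, l) * v i l) * v i k)"
        using that by (intro sum.cong refl) (simp add: eig)
      also have "\<dots> = (\<Sum>l<t. \<Sum>i<t. C $$ (j, l) * (v i l * v i k))"
        by (subst sum.swap) (simp add: sum_distrib_right mult.assoc)
      also have "\<dots> = (\<Sum>l<t. if l = k then C $$ (j, l) else 0)"
        using that by (intro sum.cong refl) (simp add: sum_distrib_left[symmetric] compl)
      also have "\<dots> = C $$ (j, k)" using that by simp
      finally show ?thesis .
    qed
    have "?R = (\<Sum>l<t. \<Sum>i<t. a ! i * (w i l)\<^sup>2)"
    proof (rule sum.cong[OF refl])
      fix l assume "l \<in> {..<t}"
      have "(\<Sum>j<t. \<Sum>k<t. C $$ (j, k) * D l j * D l k)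
        = (\<Sum>j<t. \<Sum>k<t. \<Sum>i<t. a ! i * (D l j * v i j) * (D l k * v i k))"
        by (intro sum.cong refl) (simp add: Cdec[symmetric] sum_distrib_left sum_distrib_right mult_ac)
      also have "\<dots> = (\<Sum>j<t. \<Sum>i<t. \<Sum>k<t. a ! i * (D l j * v i j) * (D l k * v i k))"
        by (intro sum.cong refl sum.swap)
      also have "\<dots> = (\<Sum>i<t. \<Sum>j<t. \<Sum>k<t. a ! i * (D l j * v i j) * (D l k * v i k))"
        by (rule sum.swap)
      also have "\<dots> = (\<Sum>i<t. a ! i * (w i l)\<^sup>2)"
        by (simp add: w_def power2_eq_square sum_product sum_distrib_left mult_ac)
      finally show "(\<Sum>j<t. \<Sum>k<t. C $$ (j, k) * D l j * D l k) = (\<Sum>i<t. a ! i * (w i l)\<^sup>2)" .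
    qed
    also have "\<dots> = (\<Sum>i<t. a ! i * (\<Sum>l<t. (w i l)\<^sup>2))"
      by (subst sum.swap) (simp add: sum_distrib_left)
    finally have R: "?R = (\<Sum>i<t. a ! i * (\<Sum>l<t. (w i l)\<^sup>2))" .
    \<comment> \<open>Cauchy-Schwarz with the unit vector \<open>v i\<close>.\<close>
    have dw: "(d i)\<^sup>2 \<le> (\<Sum>l<t. (w i l)\<^sup>2)" if "i < t" for i
      using Cauchy_Schwarz_ineq_sum[of "v i" "w i" "{..<t}"] orth[OF that that]
      by (simp add: d_def power2_eq_square)
    have "(\<Sum>i = 1..t - 1. a ! i * (d i)\<^sup>2) \<le> (\<Sum>i = 1..t - 1. a ! i * (\<Sum>l<t. (w i l)\<^sup>2))"
      using pos by (intro sum_mono mult_left_mono dw) (auto simp: less_imp_le)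
    also have "\<dots> \<le> ?R"
      using sum_lessThan_head[of t "\<lambda>i. a ! i * (\<Sum>l<t. (w i l)\<^sup>2)"] t nonneg[of 0]
      by (simp add: R sum_nonneg)
    finally have aR: "(\<Sum>i = 1..t - 1. a ! i * (d i)\<^sup>2) \<le> ?R" .
    define S where "S = (\<Sum>i = 1..t - 1. inverse (a ! i))"
    have S: "S > 0" unfolding S_def using t pos by (intro sum_pos) auto
    \<comment> \<open>A second Cauchy-Schwarz, with the factors \<open>sqrt (a ! i)\<close> and
      their inverses: this is where the harmonic mean of the eigenvalues appears.\<close>
    have "(\<Sum>i = 1..t - 1. d i)\<^sup>2 = (\<Sum>i = 1..t - 1. (sqrt (a ! i) * d i) * inverse (sqrt (a ! i)))\<^sup>2"
      using pos by (intro arg_cong[of _ _ "\<lambda>x. x\<^sup>2"] sum.cong refl) (force simp: field_simps)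
    also have "\<dots> \<le> (\<Sum>i = 1..t - 1. (sqrt (a ! i) * d i)\<^sup>2) * (\<Sum>i = 1..t - 1. (inverse (sqrt (a ! i)))\<^sup>2)"
      by (rule Cauchy_Schwarz_ineq_sum)
    also have "(\<Sum>i = 1..t - 1. (sqrt (a ! i) * d i)\<^sup>2) = (\<Sum>i = 1..t - 1. a ! i * (d i)\<^sup>2)"
      using pos by (intro sum.cong refl) (simp add: power_mult_distrib less_imp_le)
    also have "(\<Sum>i = 1..t - 1. (inverse (sqrt (a ! i)))\<^sup>2) = S"
      unfolding S_def using pos by (intro sum.cong refl) (simp add: power_inverse less_imp_le)
    also have "(\<Sum>i = 1..t - 1. a ! i * (d i)\<^sup>2) * S \<le> ?R * S"
      using aR S by simp
    finally have "(\<Sum>j<t. D j j)\<^sup>2 * inverse S \<le> ?R"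
      using S by (simp add: trD field_simps)
    then have "(real t - 1) * ((\<Sum>j<t. D j j)\<^sup>2 * inverse S) \<le> (real t - 1) * ?R"
      using t by (intro mult_left_mono) auto
    moreover have "Phi_A t C = (real t - 1) * inverse S"
      using False unfolding Phi_A_def a_def S_def Let_def by simp
    ultimately show ?thesis by (simp only: mult_ac)
  qed
qed

text \<open>\<open>D C = B_t\<close> forces \<open>v_i' D v_i = 1 / a_i\<close> on eigenvectors
  orthogonal to the all-ones vector, so the trace of \<open>D\<close> is the sum of the inverse
  eigenvalues. It also forces the null space of \<open>C\<close> to be one-dimensional.\<close>

lemma Phi_A_eq:
  assumes t: "t \<ge> 2" and C: "C \<in> carrier_mat t t" and sym: "C\<^sup>T = C"
    and psd: "\<And>u :: nat \<Rightarrow> real. (\<Sum>j<t. \<Sum>k<t. C $$ (j, k) * u j * u k) \<ge> 0"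
    and cols: "\<And>k. k < t \<Longrightarrow> (\<Sum>j<t. C $$ (j, k)) = 0"
    and D1: "\<And>j. j < t \<Longrightarrow> (\<Sum>k<t. D j k) = 0"
    and DC: "\<And>j l. j < t \<Longrightarrow> l < t \<Longrightarrow> (\<Sum>k<t. D j k * C $$ (k, l)) = (if j = l then 1 else 0) - 1 / real t"
  shows "Phi_A t C = (real t - 1) / (\<Sum>j<t. D j j)"
proof -
  define a where "a = eigenvalue_list C"
  obtain v where v: "eigenbasis C a v" using eigenbasis_exists[OF C sym] unfolding a_def by blast
  note len = eigenbasisD(1)[OF v C] and srt = eigenbasisD(2)[OF v C] and orth = eigenbasisD(3)[OF v C]
    and compl = eigenbasisD(4)[OF v C] and eig = eigenbasisD(5)[OF v C]
  have nonneg: "a ! i \<ge> 0" if "i < t" for i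
    using psd_eigenvalue_list_nonneg[OF psd] orth[OF that that] eig[OF that] by simp
  define w where "w i j = (\<Sum>k<t. D j k * v i k)" for i j
  define d where "d i = (\<Sum>j<t. v i j * w i j)" for i
  \<comment> \<open>\<open>a_i D v_i = D C v_i\<close>, which is \<open>v_i\<close> minus its
    mean.\<close>
  have aw: "a ! i * w i j = v i j - (\<Sum>l<t. v i l) / real t" if "i < t" "j < t" for i j
  proof -
    have "a ! i * w i j = (\<Sum>k<t. D j k * (a ! i * v i k))"
      by (simp add: w_def sum_distrib_left mult_ac)
    also have "\<dots> = (\<Sum>k<t. D j k * (\<Sum>l<t. C $$ (k, l) * v i l))"
      using that by (intro sum.cong refl) (simp add: eig)
    also have "\<dots> = (\<Sum>l<t. (\<Sum>k<t. D j k * C $$ (k, l)) * v i l)"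
      unfolding sum_distrib_left sum_distrib_right mult.assoc by (rule sum.swap)
    also have "\<dots> = (\<Sum>l<t. (if j = l then v i l else 0) - v i l / real t)"
      using that by (intro sum.cong refl) (simp add: DC algebra_simps)
    also have "\<dots> = v i j - (\<Sum>l<t. v i l) / real t"
      using that by (simp add: sum_subtractf sum_divide_distrib)
    finally show ?thesis .
  qed
  \<comment> \<open>Otherwise all eigenvalues are positive and every basis vector sums to 0; then
    \<open>const_if_others_sum_0\<close> yields \<open>v 0 k = 1 / 0 = 0\<close>, against norm
    1.\<close>
  have a0: "a ! 0 = 0"
  proof (rule ccontr)
    assume "a ! 0 \<noteq> 0"
    have "(\<Sum>j<t. v i j) = 0" if "i < t" for i
    proof -
      have "a ! 0 \<le> a ! i" using that len by (intro sorted_nth_mono[OF srt]) auto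
      then have "a ! i \<noteq> 0" using nonneg[of 0] t \<open>a ! 0 \<noteq> 0\<close> by auto
      then show ?thesis by (rule sum_eigenvector_eq_0[OF cols eig[OF that], rotated 2])
    qed
    moreover from this have "v 0 0 = 1 / (\<Sum>j<t. v 0 j)"
      using t by (intro const_if_others_sum_0[OF _ compl]) auto
    moreover have "v 0 k = 1 / (\<Sum>j<t. v 0 j)" if "k < t" for k
      using calculation that t by (intro const_if_others_sum_0[OF _ compl]) auto
    ultimately have "v 0 k = 0" if "k < t" for k using that t by simp
    then show False using orth[of 0 0] t by simp
  qed
  have v0: "v i j = (\<Sum>l<t. v i l) / real t" if "i < t" "j < t" "a ! i = 0" for i j
    using aw[OF that(1,2)] that(3) by simp
  \<comment> \<open>A second null eigenvector would be constant like \<open>v 0\<close>, but two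
    nonzero constant vectors are not orthogonal.\<close>
  have pos: "a ! i > 0" if "i \<in> {1..t - 1}" for i
  proof (rule ccontr)
    assume "\<not> ?thesis"
    moreover have it: "i < t" using that t by auto
    ultimately have "a ! i = 0" using nonneg[of i] by linarith
    define c where "c = (\<Sum>l<t. v 0 l) / real t"
    define e where "e = (\<Sum>l<t. v i l) / real t"
    have c0: "v 0 j = c" if "j < t" for j
      unfolding c_def using that t a0 by (intro v0) auto
    have ci: "v i j = e" if "j < t" for j
      unfolding e_def using that it \<open>a ! i = 0\<close> by (intro v0) auto
    have "real t * (c * e) = (\<Sum>j<t. v 0 j * v i j)"
      by (simp add: c0 ci)
    also have "\<dots> = 0" using orth[of 0 i] it that t by simp
    finally have "c = 0 \<or> e = 0" using t by simp
    moreover have "real t * (c * c) = 1"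
      using orth[of 0 0] t by (simp add: c0)
    moreover have "real t * (e * e) = 1"
      using orth[of i i] it by (simp add: ci)
    ultimately show False by auto
  qed
  have d: "d i = inverse (a ! i)" if "i \<in> {1..t - 1}" for i
  proof -
    have it: "i < t" using that t by auto
    have z: "(\<Sum>j<t. v i j) = 0"
    proof (rule sum_eigenvector_eq_0[OF cols eig[OF it]])
      show "a ! i \<noteq> 0" using pos[OF that] by simp
    qed
    have "a ! i * d i = (\<Sum>j<t. v i j * (a ! i * w i j))"
      by (simp add: d_def sum_distrib_left mult_ac)
    also have "\<dots> = (\<Sum>j<t. v i j * v i j)"
      using it by (simp add: aw z)
    finally show ?thesis using orth[OF it it] pos[OF that] by (simp add: field_simps)
  qed
  have "w 0 j = 0" if "j < t" for j
  proof -
    have "w 0 j = (\<Sum>k<t. D j k) * ((\<Sum>l<t. v 0 l) / real t)"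
      unfolding w_def sum_distrib_right
      using t a0 by (intro sum.cong refl arg_cong2[of _ _ _ _ "(*)"] v0) auto
    then show ?thesis by (simp add: D1 that)
  qed
  then have "d 0 = 0" by (simp add: d_def)
  moreover have "(\<Sum>i<t. d i) = (\<Sum>j<t. D j j)"
    unfolding d_def w_def by (rule trace_orthonormal_basis[OF compl])
  ultimately have "(\<Sum>j<t. D j j) = (\<Sum>i = 1..t - 1. inverse (a ! i))"
    using sum_lessThan_head[of t d] t d by simp
  moreover have "a ! 1 \<noteq> 0"
  proof -
    have "1 \<in> {1..t - 1}" using t by auto
    from pos[OF this] show ?thesis by simp
  qed
  ultimately show ?thesis unfolding Phi_A_def a_def Let_def by (simp add: divide_inverse)
qed

section \<open>Information matrices\<close>

text \<open>Definiteness excludes a kernel, so \<open>mat_inverse\<close> returns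
  \<open>Some\<close> and \<open>the\<close> is meaningful. Positivity transfers through
  \<open>w = S v\<close>, since \<open>v' S v = w' A w\<close>.\<close>

lemma symmetric_pos_def_inverse:
  assumes "symmetric_pos_def p A"
  defines "S \<equiv> the (mat_inverse A)"
  shows "symmetric_pos_def p S"
proof -
  have A: "A \<in> carrier_mat p p" and sym: "A\<^sup>T = A"
    and pd: "\<And>v. v \<in> carrier_vec p \<Longrightarrow> v \<noteq> 0\<^sub>v p \<Longrightarrow> v \<bullet> (A *\<^sub>v v) > 0"
    using assms(1) unfolding symmetric_pos_def_def by auto
  have "Determinant.det A \<noteq> 0"
  proof
    assume "Determinant.det A = 0"
    then obtain v where "v \<in> carrier_vec p" "v \<noteq> 0\<^sub>v p" "A *\<^sub>v v = 0\<^sub>v p"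
      using det_0_iff_vec_prod_zero[OF A] by blast
    then show False using pd[of v] by simp
  qed
  then have "A \<in> Units (ring_mat TYPE(real) p ())"
    by (rule det_non_zero_imp_unit[OF A])
  then have "mat_inverse A \<noteq> None"
    using mat_inverse(1)[OF A, of "()"] by blast
  then have inv: "mat_inverse A = Some S" by (simp add: S_def)
  have S: "S \<in> carrier_mat p p" and AS: "A * S = 1\<^sub>m p" and SA: "S * A = 1\<^sub>m p"
    using mat_inverse(2)[OF A inv] by auto
  have "S\<^sup>T = S\<^sup>T * (A * S)" using S by (simp add: AS)
  also have "\<dots> = (S\<^sup>T * A\<^sup>T) * S" using S A sym by (simp add: assoc_mult_mat[of _ p p _ p _ p])
  also have "S\<^sup>T * A\<^sup>T = (A * S)\<^sup>T" by (rule transpose_mult[OF A S, symmetric])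
  finally have symS: "S\<^sup>T = S" using S by (simp add: AS)
  have "v \<bullet> (S *\<^sub>v v) > 0" if v: "v \<in> carrier_vec p" "v \<noteq> 0\<^sub>v p" for v
  proof -
    define w where "w = S *\<^sub>v v"
    have w: "w \<in> carrier_vec p" using S v by (simp add: w_def)
    have Aw: "A *\<^sub>v w = v"
      using v S A by (simp add: w_def assoc_mult_mat_vec[symmetric] AS)
    have "w \<noteq> 0\<^sub>v p" using Aw A v by auto
    from pd[OF w this] show ?thesis
      using Aw comm_scalar_prod[OF w v(1)] by (simp add: w_def)
  qed
  then show ?thesis using S symS unfolding symmetric_pos_def_def by blast
qed

lemma scalar_prod_mat_vec:
  fixes S :: "real mat"
  assumes "S \<in> carrier_mat p p"
  shows "vec p u \<bullet> (S *\<^sub>v vec p w) = (\<Sum>k<p. \<Sum>l<p. S $$ (k, l) * u k * w l)"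
  using assms
  by (simp add: scalar_prod_def lessThan_atLeast0 sum_distrib_left mult_ac)

section \<open>The bilinear form of \<open>Btilde\<close> on period vectors\<close>

locale within_covariance =
  fixes p :: nat and \<Sigma> :: "real mat"
  assumes p: "p \<ge> 1" and pos_def: "symmetric_pos_def p \<Sigma>"
begin

definition W :: "nat \<Rightarrow> nat \<Rightarrow> real" where
  "W k l = Btilde p \<Sigma> $$ (k, l)"

abbreviation "S \<equiv> the (mat_inverse \<Sigma>)"

lemma S: "S \<in> carrier_mat p p" and S_sym: "k < p \<Longrightarrow> l < p \<Longrightarrow> S $$ (k, l) = S $$ (l, k)"
  and S_pos: "k < p \<Longrightarrow> u k \<noteq> 0 \<Longrightarrow> (\<Sum>k<p. \<Sum>l<p. S $$ (k, l) * u k * u l) > 0"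
proof -
  have spd: "symmetric_pos_def p S" by (rule symmetric_pos_def_inverse[OF pos_def])
  then show S: "S \<in> carrier_mat p p" by (simp add: symmetric_pos_def_def)
  have ST: "S\<^sup>T = S" using spd by (simp add: symmetric_pos_def_def)
  show "S $$ (k, l) = S $$ (l, k)" if "k < p" "l < p"
  proof -
    have "S\<^sup>T $$ (l, k) = S $$ (k, l)" using that S by simp
    then show ?thesis by (simp only: ST)
  qed
  show "(\<Sum>k<p. \<Sum>l<p. S $$ (k, l) * u k * u l) > 0" if "k < p" "u k \<noteq> 0"
  proof -
    have "vec p u \<noteq> 0\<^sub>v p"
    proof
      assume "vec p u = 0\<^sub>v p"
      then have "vec p u $ k = 0\<^sub>v p $ k" by simp
      then show False using that by simp
    qed
    then have "vec p u \<bullet> (S *\<^sub>v vec p u) > 0"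
      using spd by (simp add: symmetric_pos_def_def)
    then show ?thesis by (simp only: scalar_prod_mat_vec[OF S])
  qed
qed

definition "rowsum k = (\<Sum>l<p. S $$ (k, l))"
definition "\<kappa> = (\<Sum>k<p. rowsum k)"

lemma \<kappa>_pos: "\<kappa> > 0"
  using S_pos[of 0 "\<lambda>_. 1"] p by (simp add: \<kappa>_def rowsum_def)

lemma Btilde_carrier: "Btilde p \<Sigma> \<in> carrier_mat p p"
  unfolding Btilde_def Let_def J_mat_def
  using S by (intro minus_carrier_mat smult_carrier_mat mult_carrier_mat[of _ p p]) auto

lemma W_eq: assumes "k < p" "l < p"
  shows "W k l = S $$ (k, l) - rowsum k * rowsum l / \<kappa>"
proof -
  have ones: "ones_vec p \<bullet> (S *\<^sub>v ones_vec p) = \<kappa>"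
    unfolding ones_vec_def \<kappa>_def rowsum_def by (simp only: scalar_prod_mat_vec[OF S]) simp
  have J: "J_mat p \<in> carrier_mat p p" by (simp add: J_mat_def)
  have SJ: "(S * J_mat p) $$ (k, m) = rowsum k" if "m < p" for m
    using assms that S by (simp add: scalar_prod_def J_mat_def rowsum_def lessThan_atLeast0)
  have "(S * J_mat p * S) $$ (k, l) = (\<Sum>m<p. (S * J_mat p) $$ (k, m) * S $$ (m, l))"
  proof -
    have "(M * S) $$ (k, l) = (\<Sum>m<p. M $$ (k, m) * S $$ (m, l))" if "M \<in> carrier_mat p p" for M
      using assms S that by (simp add: scalar_prod_def lessThan_atLeast0)
    then show ?thesis using S J by (meson mult_carrier_mat)
  qed
  also have "\<dots> = (\<Sum>m<p. rowsum k * S $$ (l, m))"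
    using assms by (intro sum.cong refl arg_cong2[of _ _ _ _ "(*)"] SJ S_sym) auto
  also have "\<dots> = rowsum k * rowsum l" by (simp add: rowsum_def sum_distrib_left)
  finally show ?thesis
    using assms S J unfolding W_def Btilde_def Let_def ones by simp
qed

lemma W_sym: "k < p \<Longrightarrow> l < p \<Longrightarrow> W k l = W l k"
  by (simp add: W_eq mult.commute S_sym[of k l])

text \<open>The form \<open>u' Btilde w\<close>, on functions of the period of which only the values
  below \<open>p\<close> count. Functions instead of vectors keep linearity free of dimension
  conditions.\<close>

definition bl :: "(nat \<Rightarrow> real) \<Rightarrow> (nat \<Rightarrow> real) \<Rightarrow> real" where
  "bl u w = (\<Sum>k<p. \<Sum>l<p. W k l * u k * w l)"

text \<open>\<open>Btilde\<close> removes the generalized least squares mean: its quadratic form is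
  that of the inverse of \<open>\<Sigma>\<close> at \<open>u\<close> minus its weighted mean
  \<open>c\<close>. Hence it is nonnegative and vanishes only on constant vectors.\<close>

lemma bl_eq_centred:
  assumes "c = (\<Sum>l<p. rowsum l * u l) / \<kappa>"
  shows "bl u u = (\<Sum>k<p. \<Sum>l<p. S $$ (k, l) * (u k - c) * (u l - c))"
proof -
  have 1: "(\<Sum>l<p. rowsum l * u l) = c * \<kappa>" using \<kappa>_pos assms by simp
  have 2: "(\<Sum>k<p. \<Sum>l<p. S $$ (k, l) * u k) = c * \<kappa>"
    unfolding 1[symmetric] rowsum_def by (simp add: sum_distrib_right)
  have 3: "(\<Sum>k<p. \<Sum>l<p. S $$ (k, l) * u l) = c * \<kappa>"
  proof -
    have "(\<Sum>k<p. \<Sum>l<p. S $$ (k, l) * u l) = (\<Sum>l<p. \<Sum>k<p. S $$ (l, k) * u l)"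
      by (subst sum.swap) (intro sum.cong refl arg_cong2[of _ _ _ _ "(*)"] S_sym, auto)
    then show ?thesis using 2 by simp
  qed
  have 4: "(\<Sum>k<p. \<Sum>l<p. rowsum k * rowsum l * u k * u l) = (c * \<kappa>)\<^sup>2"
    unfolding 1[symmetric] power2_eq_square sum_product by (simp add: mult_ac)
  have "bl u u = (\<Sum>k<p. \<Sum>l<p. S $$ (k, l) * u k * u l - rowsum k * rowsum l * u k * u l / \<kappa>)"
    unfolding bl_def by (intro sum.cong refl) (simp add: W_eq algebra_simps)
  also have "\<dots> = (\<Sum>k<p. \<Sum>l<p. S $$ (k, l) * u k * u l) - (c * \<kappa>)\<^sup>2 / \<kappa>"
    by (simp add: sum_subtractf sum_divide_distrib[symmetric] 4)
  also have "\<dots> = (\<Sum>k<p. \<Sum>l<p. S $$ (k, l) * u k * u l) - c * (c * \<kappa>) - c * (c * \<kappa>) + c\<^sup>2 * \<kappa>"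
    using \<kappa>_pos by (simp add: power2_eq_square)
  also have "\<dots> = (\<Sum>k<p. \<Sum>l<p. S $$ (k, l) * u k * u l)
      - c * (\<Sum>k<p. \<Sum>l<p. S $$ (k, l) * u k) - c * (\<Sum>k<p. \<Sum>l<p. S $$ (k, l) * u l)
      + c\<^sup>2 * (\<Sum>k<p. \<Sum>l<p. S $$ (k, l))"
    unfolding 2 3 by (simp add: \<kappa>_def rowsum_def)
  also have "\<dots> = (\<Sum>k<p. \<Sum>l<p. S $$ (k, l) * (u k - c) * (u l - c))"
    by (simp add: algebra_simps power2_eq_square sum.distrib sum_subtractf sum_distrib_left)
  finally show ?thesis .
qed

lemma bl_nonneg: "bl u u \<ge> 0"
proof -
  define c where "c = (\<Sum>l<p. rowsum l * u l) / \<kappa>"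
  show ?thesis
  proof (cases "\<exists>k<p. u k - c \<noteq> 0")
    case True
    then show ?thesis
      using S_pos[of _ "\<lambda>k. u k - c"] unfolding bl_eq_centred[OF c_def] by (auto simp: less_imp_le)
  next
    case False
    then show ?thesis unfolding bl_eq_centred[OF c_def] by simp
  qed
qed

lemma bl_eq_0_imp_const:
  assumes "bl u u = 0" "k < p" "l < p"
  shows "u k = u l"
proof -
  define c where "c = (\<Sum>l<p. rowsum l * u l) / \<kappa>"
  have "u k = c" if "k < p" for k
    using S_pos[of k "\<lambda>k. u k - c"] that assms(1) unfolding bl_eq_centred[OF c_def] by auto
  then show ?thesis using assms by simp
qed

lemma bl_add_left: "bl (\<lambda>k. u k + v k) w = bl u w + bl v w"
  and bl_add_right: "bl w (\<lambda>k. u k + v k) = bl w u + bl w v"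
  and bl_diff_left: "bl (\<lambda>k. u k - v k) w = bl u w - bl v w"
  and bl_diff_right: "bl w (\<lambda>k. u k - v k) = bl w u - bl w v"
  and bl_scale_left: "bl (\<lambda>k. c * u k) w = c * bl u w"
  and bl_scale_right: "bl w (\<lambda>k. c * u k) = c * bl w u"
  by (simp_all add: bl_def algebra_simps sum.distrib sum_subtractf sum_distrib_left)

lemma bl_commute: "bl u w = bl w u"
  unfolding bl_def by (subst sum.swap, intro sum.cong refl) (simp add: W_sym[of _ _] mult_ac)

lemma bl_0_left: "bl (\<lambda>_. 0) w = 0" and bl_0_right: "bl w (\<lambda>_. 0) = 0"
  by (simp_all add: bl_def)

lemma bl_sum_left: "bl (\<lambda>k. \<Sum>i\<in>I. u i k) w = (\<Sum>i\<in>I. bl (u i) w)"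
  by (induction I rule: infinite_finite_induct) (simp_all add: bl_0_left bl_add_left)

lemma bl_sum_right: "bl w (\<lambda>k. \<Sum>i\<in>I. u i k) = (\<Sum>i\<in>I. bl w (u i))"
  by (induction I rule: infinite_finite_induct) (simp_all add: bl_0_right bl_add_right)

lemma bl_cong: "(\<And>k. k < p \<Longrightarrow> u k = u' k) \<Longrightarrow> (\<And>k. k < p \<Longrightarrow> w k = w' k) \<Longrightarrow> bl u w = bl u' w'"
  unfolding bl_def by (intro sum.cong refl) simp

end

section \<open>The matrices \<open>C_dij\<close> as weighted covariances of incidence
  columns\<close>

locale crossover = within_covariance +
  fixes t n :: nat
  assumes t: "t \<ge> 2" and n: "n \<ge> 1" and p2: "p \<ge> 2"
begin

text \<open>Column \<open>a\<close> of the incidence matrix after centring over treatments, as a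
  function of the period, so that entries of \<open>Chat_seq\<close> become values of
  \<open>bl\<close>.\<close>

definition g :: "nat \<Rightarrow> nat list \<Rightarrow> nat \<Rightarrow> nat \<Rightarrow> real" where
  "g i s a k = (G_mat p t i s * B_mat t) $$ (k, a)"

lemma B_mat_carrier [simp]: "B_mat t \<in> carrier_mat t t"
  by (auto simp: B_mat_def J_mat_def)

lemma B_mat_index: "a < t \<Longrightarrow> b < t \<Longrightarrow> B_mat t $$ (a, b) = (if a = b then 1 else 0) - 1 / real t"
  by (simp add: B_mat_def J_mat_def)

lemma B_mat_transpose: "(B_mat t)\<^sup>T = B_mat t"
  by (rule eq_matI) (auto simp: B_mat_def J_mat_def)

lemma G_mat_carrier [simp]: "G_mat p t i s \<in> carrier_mat p t"
  by (simp add: G_mat_def T_mat_def F_mat_def)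

lemma G_B_carrier: "G_mat p t i s * B_mat t \<in> carrier_mat p t"
  by (rule mult_carrier_mat[OF G_mat_carrier B_mat_carrier])

lemma finite_seqs [simp]: "finite (seqs p t)"
  using finite_lists_length_eq[of "{..<t}" p] by (simp add: seqs_def conj_commute)

lemma seqs_nth: "s \<in> seqs p t \<Longrightarrow> k < p \<Longrightarrow> s ! k < t"
  by (metis (mono_tags, lifting) lessThan_iff mem_Collect_eq nth_mem seqs_def subsetD)

lemma g_eq_G_mat:
  assumes "a < t" "k < p"
  shows "g i s a k = G_mat p t i s $$ (k, a) - (\<Sum>m<t. G_mat p t i s $$ (k, m)) / real t"
proof -
  have "g i s a k = (\<Sum>m<t. G_mat p t i s $$ (k, m) * B_mat t $$ (m, a))"
    using assms carrier_matD[OF G_mat_carrier, of i s] carrier_matD[OF B_mat_carrier]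
    by (simp add: g_def scalar_prod_def lessThan_atLeast0)
  also have "\<dots> = (\<Sum>m<t. (if m = a then G_mat p t i s $$ (k, m) else 0) - G_mat p t i s $$ (k, m) / real t)"
    using assms by (intro sum.cong refl) (simp add: B_mat_index algebra_simps)
  finally show ?thesis using assms by (simp add: sum_subtractf sum_divide_distrib)
qed

text \<open>The first row of \<open>F_mat\<close> is zero and so is its mean; centring leaves it 0
  instead of producing \<open>- 1 / t\<close>.\<close>

lemma g_eq:
  assumes "s \<in> seqs p t" "a < t" "k < p"
  shows "g i s a k = (if i = 1 then (if s ! k = a then 1 else 0) - 1 / real t
    else if k = 0 then 0 else (if s ! (k - 1) = a then 1 else 0) - 1 / real t)"
  using assms seqs_nth[of s k] seqs_nth[of s "k - 1"]
  by (simp add: g_eq_G_mat G_mat_def T_mat_def F_mat_def)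

lemma g_sum_0: "k < p \<Longrightarrow> (\<Sum>a<t. g i s a k) = 0"
  using t by (simp add: g_eq_G_mat sum_subtractf)

lemma bl_mat:
  assumes X: "X \<in> carrier_mat p t" and Y: "Y \<in> carrier_mat p t" and ab: "a < t" "b < t"
  shows "(X\<^sup>T * Btilde p \<Sigma> * Y) $$ (a, b) = bl (\<lambda>k. X $$ (k, a)) (\<lambda>k. Y $$ (k, b))"
proof -
  let ?V = "Btilde p \<Sigma>"
  note V = Btilde_carrier
  have "(X\<^sup>T * ?V * Y) $$ (a, b) = (\<Sum>l<p. (X\<^sup>T * ?V) $$ (a, l) * Y $$ (l, b))"
  proof -
    have "(M * Y) $$ (a, b) = (\<Sum>l<p. M $$ (a, l) * Y $$ (l, b))" if "M \<in> carrier_mat t p" for M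
      using that Y ab by (simp add: scalar_prod_def lessThan_atLeast0)
    then show ?thesis using X V by (meson mult_carrier_mat transpose_carrier_mat)
  qed
  also have "\<dots> = (\<Sum>l<p. (\<Sum>k<p. X $$ (k, a) * W k l) * Y $$ (l, b))"
    using X V ab by (intro sum.cong refl) (simp add: scalar_prod_def lessThan_atLeast0 W_def)
  also have "\<dots> = (\<Sum>k<p. \<Sum>l<p. W k l * X $$ (k, a) * Y $$ (l, b))"
    unfolding sum_distrib_right by (subst sum.swap) (simp add: mult_ac)
  finally show ?thesis by (simp add: bl_def)
qed

lemma Chat_seq_eq:
  "Chat_seq p t \<Sigma> s i j = (G_mat p t i s * B_mat t)\<^sup>T * Btilde p \<Sigma> * (G_mat p t j s * B_mat t)"
proof -
  have GT: "(G_mat p t i s)\<^sup>T \<in> carrier_mat t p" by simp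
  have "(G_mat p t i s * B_mat t)\<^sup>T = B_mat t * (G_mat p t i s)\<^sup>T"
    using transpose_mult[OF G_mat_carrier B_mat_carrier] by (simp add: B_mat_transpose)
  moreover have "B_mat t * (G_mat p t i s)\<^sup>T * Btilde p \<Sigma> * G_mat p t j s * B_mat t =
      B_mat t * (G_mat p t i s)\<^sup>T * Btilde p \<Sigma> * (G_mat p t j s * B_mat t)"
    by (rule assoc_mult_mat[OF mult_carrier_mat[OF mult_carrier_mat[OF B_mat_carrier GT] Btilde_carrier]
          G_mat_carrier B_mat_carrier])
  ultimately show ?thesis by (simp only: Chat_seq_def)
qed

lemma Chat_seq_carrier: "Chat_seq p t \<Sigma> s i j \<in> carrier_mat t t"
  unfolding Chat_seq_eq
  by (intro mult_carrier_mat[OF mult_carrier_mat[OF _ Btilde_carrier] G_B_carrier])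
    (simp add: G_B_carrier)

lemma Chat_seq_index:
  "a < t \<Longrightarrow> b < t \<Longrightarrow> Chat_seq p t \<Sigma> s i j $$ (a, b) = bl (g i s a) (g j s b)"
  unfolding Chat_seq_eq g_def[abs_def] by (rule bl_mat[OF G_B_carrier G_B_carrier])

lemma c_seq_eq: "c_seq p t \<Sigma> s i j = (\<Sum>a<t. bl (g i s a) (g j s a))"
proof -
  have "c_seq p t \<Sigma> s i j = (\<Sum>a<t. Chat_seq p t \<Sigma> s i j $$ (a, a))"
    using Chat_seq_carrier[of s i j]
    by (simp add: c_seq_def trace_mat_def diag_mat_def interv_sum_list_conv_sum_set_nat lessThan_atLeast0)
  then show ?thesis by (simp add: Chat_seq_index)
qed

definition gbar :: "(nat list \<Rightarrow> real) \<Rightarrow> nat \<Rightarrow> nat \<Rightarrow> nat \<Rightarrow> real" where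
  "gbar P i a k = (\<Sum>s\<in>seqs p t. P s * g i s a k)"

definition h :: "(nat list \<Rightarrow> real) \<Rightarrow> nat \<Rightarrow> nat list \<Rightarrow> nat \<Rightarrow> nat \<Rightarrow> real" where
  "h P i s a k = g i s a k - gbar P i a k"

abbreviation C :: "(nat list \<Rightarrow> real) \<Rightarrow> nat \<Rightarrow> nat \<Rightarrow> nat \<Rightarrow> nat \<Rightarrow> real" where
  "C P i j a b \<equiv> C_design p t n \<Sigma> P i j $$ (a, b)"

lemma G_design_carrier: "G_design p t P i \<in> carrier_mat p t"
  by (simp add: G_design_def wsum_mat_def)

lemma C_design_carrier: "C_design p t n \<Sigma> P i j \<in> carrier_mat t t"
  unfolding C_design_def
  by (intro minus_carrier_mat smult_carrier_mat
      mult_carrier_mat[OF mult_carrier_mat[OF _ Btilde_carrier] G_design_carrier])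
    (simp add: G_design_carrier)

lemma C_eq:
  assumes "a < t" "b < t"
  shows "C P i j a b = real n * ((\<Sum>s\<in>seqs p t. P s * bl (g i s a) (g j s b)) - bl (gbar P i a) (gbar P j b))"
proof -
  have G: "((G_design p t P i)\<^sup>T * Btilde p \<Sigma> * G_design p t P j) $$ (a, b) = bl (gbar P i a) (gbar P j b)"
    unfolding bl_mat[OF G_design_carrier G_design_carrier assms]
    using assms by (intro bl_cong) (simp_all add: G_design_def wsum_mat_def gbar_def g_def)
  have "(X - r \<cdot>\<^sub>m M) $$ (a, b) = X $$ (a, b) - r * M $$ (a, b)" if "M \<in> carrier_mat t t"
    for X M :: "real mat" and r
    using that assms by simp
  moreover have "(G_design p t P i)\<^sup>T * Btilde p \<Sigma> * G_design p t P j \<in> carrier_mat t t"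
    by (intro mult_carrier_mat[OF mult_carrier_mat[OF _ Btilde_carrier] G_design_carrier])
      (simp add: G_design_carrier)
  ultimately have "C P i j a b = Chat_design p t n \<Sigma> P i j $$ (a, b) -
      real n * ((G_design p t P i)\<^sup>T * Btilde p \<Sigma> * G_design p t P j) $$ (a, b)"
    unfolding C_design_def by blast
  then show ?thesis unfolding G using assms
    by (simp add: Chat_design_def wsum_mat_def Chat_seq_index algebra_simps)
qed

text \<open>The identity "mean of products minus product of means equals mean of products of
  deviations", valid because the weights sum to 1. It exhibits the joint form below as a weighted
  sum of squares.\<close>

lemma C_eq_centred:
  assumes "is_design p t P" "a < t" "b < t"
  shows "C P i j a b = real n * (\<Sum>s\<in>seqs p t. P s * bl (h P i s a) (h P j s b))"
proof -
  have bar: "bl (gbar P i a) w = (\<Sum>s\<in>seqs p t. P s * bl (g i s a) w)"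
    "bl w (gbar P i a) = (\<Sum>s\<in>seqs p t. P s * bl w (g i s a))" for i a w
    unfolding gbar_def[abs_def] by (simp_all add: bl_sum_left bl_sum_right bl_scale_left bl_scale_right)
  have "(\<Sum>s\<in>seqs p t. P s * bl (h P i s a) (h P j s b)) =
    (\<Sum>s\<in>seqs p t. P s * bl (g i s a) (g j s b) - P s * bl (g i s a) (gbar P j b)
      - P s * bl (gbar P i a) (g j s b) + P s * bl (gbar P i a) (gbar P j b))"
    unfolding h_def[abs_def] by (simp add: bl_diff_left bl_diff_right algebra_simps)
  also have "\<dots> = (\<Sum>s\<in>seqs p t. P s * bl (g i s a) (g j s b)) - bl (gbar P i a) (gbar P j b)
      - bl (gbar P i a) (gbar P j b) + (\<Sum>s\<in>seqs p t. P s) * bl (gbar P i a) (gbar P j b)"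
    by (simp add: sum.distrib sum_subtractf bar(1)[of i a "gbar P j b", symmetric]
        bar(2)[of "gbar P i a" j b, symmetric] sum_distrib_right)
  finally show ?thesis using assms by (simp add: C_eq is_design_def)
qed

lemma C_sym: "a < t \<Longrightarrow> b < t \<Longrightarrow> C P i j a b = C P j i b a"
  by (simp add: C_eq bl_commute)

lemma C_row_sum:
  assumes "a < t"
  shows "(\<Sum>b<t. C P i j a b) = 0"
proof -
  have z: "(\<Sum>b<t. bl w (g j s b)) = 0" for w s
  proof -
    have "(\<Sum>b<t. bl w (g j s b)) = bl w (\<lambda>k. \<Sum>b<t. g j s b k)" by (simp add: bl_sum_right)
    also have "\<dots> = bl w (\<lambda>_. 0)" by (intro bl_cong) (simp_all add: g_sum_0)
    finally show ?thesis by (simp add: bl_0_right)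
  qed
  have z': "(\<Sum>b<t. bl w (gbar P j b)) = 0" for w
  proof -
    have "(\<Sum>b<t. bl w (gbar P j b)) = (\<Sum>b<t. \<Sum>s\<in>seqs p t. P s * bl w (g j s b))"
      unfolding gbar_def[abs_def] by (simp add: bl_sum_right bl_scale_right)
    also have "\<dots> = (\<Sum>s\<in>seqs p t. P s * (\<Sum>b<t. bl w (g j s b)))"
      by (subst sum.swap) (simp add: sum_distrib_left)
    finally show ?thesis by (simp add: z)
  qed
  have "(\<Sum>b<t. C P i j a b) = real n * ((\<Sum>b<t. \<Sum>s\<in>seqs p t. P s * bl (g i s a) (g j s b))
      - (\<Sum>b<t. bl (gbar P i a) (gbar P j b)))"
    using assms by (simp add: C_eq sum_distrib_left[symmetric] sum_subtractf)
  also have "(\<Sum>b<t. \<Sum>s\<in>seqs p t. P s * bl (g i s a) (g j s b)) =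
      (\<Sum>s\<in>seqs p t. P s * (\<Sum>b<t. bl (g i s a) (g j s b)))"
    by (subst sum.swap) (simp add: sum_distrib_left)
  finally show ?thesis by (simp add: z z')
qed

lemma C_col_sum: "b < t \<Longrightarrow> (\<Sum>a<t. C P i j a b) = 0"
  using C_row_sum[of b P j i] C_sym[of _ b P i j] by simp

lemma C_form_eq:
  assumes "is_design p t P"
  shows "(\<Sum>a<t. \<Sum>b<t. C P i j a b * u a * w b) =
    real n * (\<Sum>s\<in>seqs p t. P s * bl (\<lambda>k. \<Sum>a<t. u a * h P i s a k) (\<lambda>k. \<Sum>b<t. w b * h P j s b k))"
proof -
  have "(\<Sum>a<t. \<Sum>b<t. C P i j a b * u a * w b) =
    (\<Sum>a<t. \<Sum>b<t. \<Sum>s\<in>seqs p t. real n * (P s * (u a * (w b * bl (h P i s a) (h P j s b)))))"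
    by (intro sum.cong refl) (simp add: C_eq_centred[OF assms] sum_distrib_left sum_distrib_right mult_ac)
  also have "\<dots> = (\<Sum>a<t. \<Sum>s\<in>seqs p t. \<Sum>b<t. real n * (P s * (u a * (w b * bl (h P i s a) (h P j s b)))))"
    by (intro sum.cong refl sum.swap)
  also have "\<dots> = (\<Sum>s\<in>seqs p t. \<Sum>a<t. \<Sum>b<t. real n * (P s * (u a * (w b * bl (h P i s a) (h P j s b)))))"
    by (rule sum.swap)
  also have "\<dots> = real n * (\<Sum>s\<in>seqs p t. P s * bl (\<lambda>k. \<Sum>a<t. u a * h P i s a k) (\<lambda>k. \<Sum>b<t. w b * h P j s b k))"
    by (simp add: bl_sum_left bl_sum_right bl_scale_left bl_scale_right sum_distrib_left)
  finally show ?thesis .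
qed

definition form :: "(nat list \<Rightarrow> real) \<Rightarrow> nat \<Rightarrow> nat \<Rightarrow> (nat \<Rightarrow> real) \<Rightarrow> (nat \<Rightarrow> real) \<Rightarrow> real" where
  "form P i j u w = (\<Sum>a<t. \<Sum>b<t. C P i j a b * u a * w b)"

lemma form_add_left: "form P i j (\<lambda>a. u a + v a) w = form P i j u w + form P i j v w"
  and form_add_right: "form P i j w (\<lambda>a. u a + v a) = form P i j w u + form P i j w v"
  and form_scale_left: "form P i j (\<lambda>a. c * u a) w = c * form P i j u w"
  and form_scale_right: "form P i j w (\<lambda>a. c * u a) = c * form P i j w u"
  by (simp_all add: form_def algebra_simps sum.distrib sum_distrib_left)

lemma form_sym: "form P i j u w = form P j i w u"
  unfolding form_def
  by (subst sum.swap, intro sum.cong refl) (simp add: C_sym[of _ _ P i j] mult_ac)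

text \<open>The 2 x 2 block matrix of the \<open>C_dij\<close> is nonnegative definite: its form at
  \<open>(u, w)\<close> is \<open>n\<close> times the weighted mean of \<open>bl\<close> at the
  combined deviation of direct and carryover columns.\<close>

lemma joint_form_nonneg:
  assumes "is_design p t P"
  shows "form P 1 1 u u + 2 * form P 1 2 u w + form P 2 2 w w \<ge> 0"
proof -
  define x where "x i u s = (\<lambda>k. \<Sum>a<t. u a * h P i s a k)" for i u s
  have f: "form P i j u w = real n * (\<Sum>s\<in>seqs p t. P s * bl (x i u s) (x j w s))" for i j u w
    unfolding form_def C_form_eq[OF assms] x_def ..
  have "form P 1 1 u u + 2 * form P 1 2 u w + form P 2 2 w w =
    form P 1 1 u u + form P 1 2 u w + form P 2 1 w u + form P 2 2 w w"
    using form_sym[of P 1 2 u w] by simp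
  also have "\<dots> = real n * (\<Sum>s\<in>seqs p t. P s * bl (\<lambda>k. x 1 u s k + x 2 w s k) (\<lambda>k. x 1 u s k + x 2 w s k))"
    unfolding f by (simp add: bl_add_left bl_add_right algebra_simps sum.distrib)
  also have "\<dots> \<ge> 0"
    using assms by (intro mult_nonneg_nonneg sum_nonneg bl_nonneg) (auto simp: is_design_def)
  finally show ?thesis .
qed

end

section \<open>The information matrix as a Schur complement\<close>

lemma mult_outer_product_index:
  fixes X Y :: "real mat" and \<tau> :: "nat \<Rightarrow> real"
  assumes X: "X \<in> carrier_mat t t" and Y: "Y \<in> carrier_mat t t" and ab: "a < t" "b < t"
  shows "(X * mat t t (\<lambda>(i, j). vec t \<tau> $ i * vec t \<tau> $ j) * Y) $$ (a, b) =
    (\<Sum>c<t. X $$ (a, c) * \<tau> c) * (\<Sum>d<t. \<tau> d * Y $$ (d, b))"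
proof -
  let ?O = "mat t t (\<lambda>(i, j). vec t \<tau> $ i * vec t \<tau> $ j)"
  have O: "X * ?O \<in> carrier_mat t t" using X by simp
  have "(M * Y) $$ (a, b) = (\<Sum>d<t. M $$ (a, d) * Y $$ (d, b))" if "M \<in> carrier_mat t t" for M
    using that Y ab by (simp add: scalar_prod_def lessThan_atLeast0)
  then have "(X * ?O * Y) $$ (a, b) = (\<Sum>d<t. (X * ?O) $$ (a, d) * Y $$ (d, b))"
    using O by blast
  also have "\<dots> = (\<Sum>d<t. (\<Sum>c<t. X $$ (a, c) * \<tau> c) * (\<tau> d * Y $$ (d, b)))"
    using X ab by (intro sum.cong refl)
      (simp add: scalar_prod_def lessThan_atLeast0 sum_distrib_left sum_distrib_right mult_ac)
  finally show ?thesis by (simp add: sum_distrib_left)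
qed

context crossover begin

text \<open>The vector \<open>(C_d12 + x C_d22) \<tau>\<close>; the term subtracted in
  \<open>info_mat\<close> is the rank-one matrix \<open>z z' / h\<close> with
  \<open>h = \<tau>' C_d22 \<tau>\<close>.\<close>

definition z :: "(nat list \<Rightarrow> real) \<Rightarrow> real \<Rightarrow> (nat \<Rightarrow> real) \<Rightarrow> nat \<Rightarrow> real" where
  "z P x \<tau> a = (\<Sum>c<t. (C P 1 2 a c + x * C P 2 2 a c) * \<tau> c)"

definition Cx :: "(nat list \<Rightarrow> real) \<Rightarrow> real \<Rightarrow> nat \<Rightarrow> nat \<Rightarrow> real" where
  "Cx P x a b = C P 1 1 a b + x * (C P 1 2 a b + C P 2 1 a b) + x\<^sup>2 * C P 2 2 a b"

lemma C_design_dim [simp]: "dim_row (C_design p t n \<Sigma> P i j) = t" "dim_col (C_design p t n \<Sigma> P i j) = t"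
  using C_design_carrier by auto

lemma info_mat_carrier: "info_mat p t n \<Sigma> P (vec t \<tau>) x \<in> carrier_mat t t"
proof -
  let ?K = "C_design p t n \<Sigma> P"
  have K: "?K i j + x \<cdot>\<^sub>m ?K 2 2 \<in> carrier_mat t t" for i j
    by (intro add_carrier_mat smult_carrier_mat C_design_carrier)
  show ?thesis
    unfolding info_mat_def Let_def
    by (rule minus_carrier_mat, split if_split,
        intro conjI impI zero_carrier_mat smult_carrier_mat mult_carrier_mat[OF mult_carrier_mat[OF K mat_carrier] K])
qed

lemma info_mat_index:
  assumes "a < t" "b < t"
  shows "info_mat p t n \<Sigma> P (vec t \<tau>) x $$ (a, b) = Cx P x a b -
    (if form P 2 2 \<tau> \<tau> = 0 then 0 else z P x \<tau> a * z P x \<tau> b / form P 2 2 \<tau> \<tau>)"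
proof -
  let ?K = "C_design p t n \<Sigma> P"
  let ?X = "?K 1 2 + x \<cdot>\<^sub>m ?K 2 2" and ?Y = "?K 2 1 + x \<cdot>\<^sub>m ?K 2 2"
  let ?O = "mat t t (\<lambda>(i, j). vec t \<tau> $ i * vec t \<tau> $ j)"
  have X: "?X \<in> carrier_mat t t" and Y: "?Y \<in> carrier_mat t t"
    by (intro add_carrier_mat smult_carrier_mat C_design_carrier)+
  have hh: "vec t \<tau> \<bullet> (?K 2 2 *\<^sub>v vec t \<tau>) = form P 2 2 \<tau> \<tau>"
    unfolding form_def by (rule scalar_prod_mat_vec[OF C_design_carrier])
  have "(?X * ?O * ?Y) $$ (a, b) = (\<Sum>c<t. ?X $$ (a, c) * \<tau> c) * (\<Sum>d<t. \<tau> d * ?Y $$ (d, b))"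
    by (rule mult_outer_product_index[OF X Y assms])
  also have "(\<Sum>c<t. ?X $$ (a, c) * \<tau> c) = z P x \<tau> a"
    unfolding z_def using assms by (intro sum.cong refl) simp
  also have "(\<Sum>d<t. \<tau> d * ?Y $$ (d, b)) = z P x \<tau> b"
    unfolding z_def using assms by (intro sum.cong refl) (simp add: C_sym[of _ b P])
  finally have XOY: "(?X * ?O * ?Y) $$ (a, b) = z P x \<tau> a * z P x \<tau> b" .
  have M: "?X * ?O * ?Y \<in> carrier_mat t t"
    by (rule mult_carrier_mat[OF mult_carrier_mat[OF X mat_carrier] Y])
  have "(A - (1 / r) \<cdot>\<^sub>m N) $$ (a, b) = A $$ (a, b) - N $$ (a, b) / r" if "N \<in> carrier_mat t t"
    for A N :: "real mat" and r
    using that assms by simp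
  from this[OF M] have 1: "(A - (1 / r) \<cdot>\<^sub>m (?X * ?O * ?Y)) $$ (a, b) = A $$ (a, b) - z P x \<tau> a * z P x \<tau> b / r"
    for A r by (simp only: XOY)
  show ?thesis
  proof (cases "form P 2 2 \<tau> \<tau> = 0")
    case True
    then show ?thesis unfolding info_mat_def Let_def hh using assms by (simp add: Cx_def)
  next
    case False
    then show ?thesis
      unfolding info_mat_def Let_def hh if_not_P[OF False] 1 using assms by (simp add: Cx_def)
  qed
qed

lemma info_mat_symmetric: "(info_mat p t n \<Sigma> P (vec t \<tau>) x)\<^sup>T = info_mat p t n \<Sigma> P (vec t \<tau>) x"
proof (rule eq_matI)
  fix a b assume "a < dim_row (info_mat p t n \<Sigma> P (vec t \<tau>) x)" "b < dim_col (info_mat p t n \<Sigma> P (vec t \<tau>) x)"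
  then have ab: "a < t" "b < t" using info_mat_carrier[of P \<tau> x] by auto
  have "Cx P x b a = Cx P x a b"
    using C_sym[OF ab, of P 1 1] C_sym[OF ab, of P 1 2] C_sym[OF ab, of P 2 1] C_sym[OF ab, of P 2 2]
    by (simp add: Cx_def)
  then show "(info_mat p t n \<Sigma> P (vec t \<tau>) x)\<^sup>T $$ (a, b) = info_mat p t n \<Sigma> P (vec t \<tau>) x $$ (a, b)"
    using ab info_mat_carrier[of P \<tau> x] by (simp add: info_mat_index)
qed (use info_mat_carrier[of P \<tau> x] in auto)

lemma Cx_col_sum: "b < t \<Longrightarrow> (\<Sum>a<t. Cx P x a b) = 0"
  by (simp add: Cx_def sum.distrib sum_distrib_left[symmetric] C_col_sum)

lemma z_sum: "(\<Sum>a<t. z P x \<tau> a) = 0"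
proof -
  have "(\<Sum>a<t. z P x \<tau> a) = (\<Sum>c<t. \<Sum>a<t. (C P 1 2 a c + x * C P 2 2 a c) * \<tau> c)"
    unfolding z_def by (rule sum.swap)
  also have "\<dots> = (\<Sum>c<t. (\<Sum>a<t. C P 1 2 a c + x * C P 2 2 a c) * \<tau> c)"
    by (simp only: sum_distrib_right)
  also have "\<dots> = 0"
    by (simp add: sum.distrib sum_distrib_left[symmetric] C_col_sum)
  finally show ?thesis .
qed

lemma info_mat_col_sum:
  assumes "b < t"
  shows "(\<Sum>a<t. info_mat p t n \<Sigma> P (vec t \<tau>) x $$ (a, b)) = 0"
proof -
  have "(\<Sum>a<t. info_mat p t n \<Sigma> P (vec t \<tau>) x $$ (a, b)) = (\<Sum>a<t. Cx P x a b) -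
    (if form P 2 2 \<tau> \<tau> = 0 then 0 else (\<Sum>a<t. z P x \<tau> a) * z P x \<tau> b / form P 2 2 \<tau> \<tau>)"
    using assms by (simp add: info_mat_index sum_subtractf sum_distrib_right sum_divide_distrib)
  then show ?thesis using assms by (simp add: z_sum Cx_col_sum)
qed

definition Q :: "(nat list \<Rightarrow> real) \<Rightarrow> real \<Rightarrow> (nat \<Rightarrow> real) \<Rightarrow> real" where
  "Q P x u = (\<Sum>a<t. \<Sum>b<t. Cx P x a b * u a * u b)"

lemma Q_eq_form: "Q P x u = form P 1 1 u u + 2 * x * form P 1 2 u u + x\<^sup>2 * form P 2 2 u u"
proof -
  have "Q P x u = form P 1 1 u u + x * (form P 1 2 u u + form P 2 1 u u) + x\<^sup>2 * form P 2 2 u u"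
    by (simp add: Q_def Cx_def form_def algebra_simps sum.distrib sum_distrib_left)
  then show ?thesis using form_sym[of P 2 1 u u] by simp
qed

lemma z_form: "(\<Sum>a<t. z P x \<tau> a * u a) = form P 1 2 u \<tau> + x * form P 2 2 u \<tau>"
  by (simp add: z_def form_def algebra_simps sum.distrib sum_distrib_left sum_distrib_right)

text \<open>The left-hand side is the joint quadratic form of direct and carryover effects at
  \<open>(u, x u + c \<tau>)\<close>; minimizing it over \<open>c\<close> gives the quadratic form of the information matrix,
  which is therefore nonnegative and dominated by every choice of \<open>c\<close>.\<close>

lemma Q_shift:
  assumes "is_design p t P"
  shows "Q P x u + 2 * c * (\<Sum>a<t. z P x \<tau> a * u a) + c\<^sup>2 * form P 2 2 \<tau> \<tau> \<ge> 0"
proof -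
  have "Q P x u + 2 * c * (\<Sum>a<t. z P x \<tau> a * u a) + c\<^sup>2 * form P 2 2 \<tau> \<tau> =
    form P 1 1 u u + 2 * form P 1 2 u (\<lambda>a. x * u a + c * \<tau> a) +
      form P 2 2 (\<lambda>a. x * u a + c * \<tau> a) (\<lambda>a. x * u a + c * \<tau> a)"
    unfolding Q_eq_form z_form form_add_left form_add_right form_scale_left form_scale_right
    using form_sym[of P 2 2 u \<tau>] by (simp add: algebra_simps power2_eq_square)
  then show ?thesis using joint_form_nonneg[OF assms] by simp
qed

lemma form22_nonneg:
  assumes "is_design p t P"
  shows "form P 2 2 u u \<ge> 0"
  using joint_form_nonneg[OF assms, of "\<lambda>_. 0" u] by (simp add: form_def)

lemma info_mat_form:
  "(\<Sum>a<t. \<Sum>b<t. info_mat p t n \<Sigma> P (vec t \<tau>) x $$ (a, b) * u a * u b) = Q P x u -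
    (if form P 2 2 \<tau> \<tau> = 0 then 0 else (\<Sum>a<t. z P x \<tau> a * u a)\<^sup>2 / form P 2 2 \<tau> \<tau>)"
proof (cases "form P 2 2 \<tau> \<tau> = 0")
  case True
  then show ?thesis by (simp add: info_mat_index Q_def)
next
  case False
  have "(\<Sum>a<t. \<Sum>b<t. info_mat p t n \<Sigma> P (vec t \<tau>) x $$ (a, b) * u a * u b) =
    (\<Sum>a<t. \<Sum>b<t. Cx P x a b * u a * u b - (z P x \<tau> a * u a) * (z P x \<tau> b * u b) / form P 2 2 \<tau> \<tau>)"
    using False by (intro sum.cong refl) (simp add: info_mat_index algebra_simps)
  also have "\<dots> = Q P x u - (\<Sum>a<t. z P x \<tau> a * u a)\<^sup>2 / form P 2 2 \<tau> \<tau>"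
    by (simp add: sum_subtractf Q_def power2_eq_square sum_product sum_divide_distrib)
  finally show ?thesis using False by simp
qed

lemma info_mat_psd:
  assumes "is_design p t P"
  shows "(\<Sum>a<t. \<Sum>b<t. info_mat p t n \<Sigma> P (vec t \<tau>) x $$ (a, b) * u a * u b) \<ge> 0"
proof (cases "form P 2 2 \<tau> \<tau> = 0")
  case True
  then show ?thesis using Q_shift[OF assms, of x u 0 \<tau>] by (simp add: info_mat_form)
next
  case False
  define f where "f = form P 2 2 \<tau> \<tau>"
  define y where "y = (\<Sum>a<t. z P x \<tau> a * u a)"
  \<comment> \<open>\<open>- y / f\<close> is the minimizer of the quadratic in
    \<open>c\<close>.\<close>
  have "Q P x u + 2 * (- y / f) * y + (- y / f)\<^sup>2 * f \<ge> 0"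
    using Q_shift[OF assms, of x u "- y / f" \<tau>] by (simp only: f_def y_def)
  then show ?thesis using False unfolding info_mat_form f_def[symmetric] y_def[symmetric]
    by (simp add: power2_eq_square)
qed

text \<open>At \<open>u = \<tau>\<close> the shift \<open>c = y - x\<close> moves the carryover
  argument from \<open>x \<tau>\<close> to \<open>y \<tau>\<close>, so the minimum over
  \<open>c\<close> lies below the form with \<open>y\<close> in place of \<open>x\<close>.\<close>

lemma info_mat_form_le:
  assumes "is_design p t P"
  shows "(\<Sum>a<t. \<Sum>b<t. info_mat p t n \<Sigma> P (vec t \<tau>) x $$ (a, b) * \<tau> a * \<tau> b) \<le> Q P y \<tau>"
proof -
  define f where "f = form P 2 2 \<tau> \<tau>"
  define r where "r = (\<Sum>a<t. z P x \<tau> a * \<tau> a)"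
  have "Q P y \<tau> = Q P x \<tau> + 2 * (y - x) * r + (y - x)\<^sup>2 * f"
    unfolding r_def f_def z_form Q_eq_form by (simp add: algebra_simps power2_eq_square)
  moreover have "- (if f = 0 then 0 else r\<^sup>2 / f) \<le> 2 * (y - x) * r + (y - x)\<^sup>2 * f"
  proof (cases "f = 0")
    case True
    \<comment> \<open>With \<open>f = 0\<close> the shifted form is affine in \<open>c\<close> and
      bounded below, so its slope vanishes; the value of \<open>c\<close> chosen below would make it
      \<open>- 1\<close>.\<close>
    have "r = 0"
    proof (rule ccontr)
      assume "r \<noteq> 0"
      have "Q P x \<tau> + 2 * c * r \<ge> 0" for c
        using Q_shift[OF assms, of x \<tau> c \<tau>] True by (simp add: f_def r_def)
      from this[of "- (Q P x \<tau> + 1) / (2 * r)"] show False using \<open>r \<noteq> 0\<close> by (simp add: field_simps)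
    qed
    then show ?thesis using True by simp
  next
    case False
    then have "f > 0" using form22_nonneg[OF assms, of \<tau>] by (simp add: f_def)
    have "0 \<le> f * ((y - x) + r / f)\<^sup>2" using \<open>f > 0\<close> by simp
    also have "\<dots> = 2 * (y - x) * r + (y - x)\<^sup>2 * f + r\<^sup>2 / f"
      using \<open>f > 0\<close> by (simp add: power2_eq_square field_simps)
    finally show ?thesis using False by simp
  qed
  ultimately show ?thesis unfolding info_mat_form f_def[symmetric] r_def[symmetric] by linarith
qed

definition tr_Cx :: "(nat list \<Rightarrow> real) \<Rightarrow> real \<Rightarrow> real" where
  "tr_Cx P x = (\<Sum>a<t. Cx P x a a)"

text \<open>The left side is the trace over the orthogonal complement of \<open>\<tau>\<close>. The
  subtracted rank-one matrix is nonnegative there, which is Cauchy-Schwarz for \<open>z\<close> and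
  \<open>\<tau>\<close>, so dropping it only increases the trace.\<close>

lemma info_mat_trace_le:
  assumes "is_design p t P" and N: "N = (\<Sum>a<t. (\<tau> a)\<^sup>2)" "N > 0"
  shows "(\<Sum>a<t. info_mat p t n \<Sigma> P (vec t \<tau>) x $$ (a, a)) -
      (\<Sum>a<t. \<Sum>b<t. info_mat p t n \<Sigma> P (vec t \<tau>) x $$ (a, b) * \<tau> a * \<tau> b) / N
    \<le> tr_Cx P x - Q P x \<tau> / N"
proof (cases "form P 2 2 \<tau> \<tau> = 0")
  case True
  then show ?thesis by (simp add: info_mat_form) (simp add: info_mat_index tr_Cx_def)
next
  case False
  define f where "f = form P 2 2 \<tau> \<tau>"
  define r where "r = (\<Sum>a<t. z P x \<tau> a * \<tau> a)"
  define y where "y = (\<Sum>a<t. (z P x \<tau> a)\<^sup>2)"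
  have f: "f > 0" using False form22_nonneg[OF assms(1), of \<tau>] by (simp add: f_def)
  have "r\<^sup>2 \<le> y * N" unfolding r_def y_def N(1) by (rule Cauchy_Schwarz_ineq_sum)
  then have "r\<^sup>2 / N / f \<le> y / f" using f N(2) by (simp add: divide_right_mono pos_divide_le_eq)
  moreover have "(\<Sum>a<t. info_mat p t n \<Sigma> P (vec t \<tau>) x $$ (a, a)) = tr_Cx P x - y / f"
    using False by (simp add: info_mat_index f_def tr_Cx_def y_def sum_subtractf sum_divide_distrib power2_eq_square)
  ultimately show ?thesis
    using False unfolding info_mat_form f_def[symmetric] r_def[symmetric]
    by (simp add: diff_divide_distrib mult.commute)
qed

end

section \<open>Projections attached to a direction, and the criterion relative to them\<close>

definition nsq :: "nat \<Rightarrow> (nat \<Rightarrow> real) \<Rightarrow> real" where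
  "nsq t \<tau> = (\<Sum>i<t. (\<tau> i)\<^sup>2)"

locale direction =
  fixes t :: nat and \<tau> :: "nat \<Rightarrow> real"
  assumes t: "t \<ge> 2" and sum_0: "(\<Sum>i<t. \<tau> i) = 0" and nsq_pos: "nsq t \<tau> > 0"
begin

text \<open>The orthogonal projections onto the span of \<open>\<tau>\<close> and onto the orthogonal complement of
  \<open>\<tau>\<close> and the all-ones vector.\<close>

definition E :: "nat \<Rightarrow> nat \<Rightarrow> real" where
  "E j k = \<tau> j * \<tau> k / nsq t \<tau>"

definition F :: "nat \<Rightarrow> nat \<Rightarrow> real" where
  "F j k = (if j = k then 1 else 0) - 1 / real t - E j k"

lemma E_commute: "E j k = E k j"
  by (simp add: E_def)

lemma F_commute: "F j k = F k j"
  by (auto simp: F_def E_commute)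

lemma E_row_sum: "(\<Sum>k<t. E j k) = 0"
  unfolding E_def using sum_0 by (simp add: sum_divide_distrib[symmetric] sum_distrib_left[symmetric])

lemma F_row_sum: "j < t \<Longrightarrow> (\<Sum>k<t. F j k) = 0"
  unfolding F_def using t by (simp add: sum_subtractf E_row_sum)

lemma E_trace: "(\<Sum>j<t. E j j) = 1"
  unfolding E_def using nsq_pos
  by (simp add: sum_divide_distrib[symmetric] power2_eq_square[symmetric] nsq_def)

lemma F_trace: "(\<Sum>j<t. F j j) = real t - 2"
proof -
  have "(\<Sum>j<t. F j j) = real t * (1 - 1 / real t) - 1"
    unfolding F_def by (simp add: sum_subtractf E_trace)
  then show ?thesis using t by (simp add: right_diff_distrib)
qed

lemma E_E: "(\<Sum>l<t. E j l * E l k) = E j k"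
proof -
  have "(\<Sum>l<t. E j l * E l k) = (\<Sum>l<t. (\<tau> l)\<^sup>2 * (\<tau> j * \<tau> k / (nsq t \<tau> * nsq t \<tau>)))"
    by (intro sum.cong refl) (simp add: E_def power2_eq_square)
  also have "\<dots> = nsq t \<tau> * (\<tau> j * \<tau> k / (nsq t \<tau> * nsq t \<tau>))"
    unfolding nsq_def sum_distrib_right ..
  also have "\<dots> = E j k" using nsq_pos by (simp add: E_def)
  finally show ?thesis .
qed

lemma F_E: assumes "j < t" shows "(\<Sum>l<t. F j l * E l k) = 0"
proof -
  have "(\<Sum>l<t. F j l * E l k) = (\<Sum>l<t. (if l = j then E l k else 0) - E k l / real t - E j l * E l k)"
    by (intro sum.cong refl) (auto simp: F_def E_commute[of k] algebra_simps)
  also have "\<dots> = E j k - (\<Sum>l<t. E k l) / real t - (\<Sum>l<t. E j l * E l k)"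
    using assms by (simp add: sum_subtractf sum_divide_distrib)
  finally show ?thesis by (simp add: E_row_sum E_E)
qed

lemma E_F: "k < t \<Longrightarrow> (\<Sum>l<t. E j l * F l k) = 0"
  using F_E[of k j] by (simp add: F_commute[of k] E_commute[of _ j] mult.commute)

lemma F_F: assumes "j < t" "k < t" shows "(\<Sum>l<t. F j l * F l k) = F j k"
proof -
  have "(\<Sum>l<t. F j l * F l k) = (\<Sum>l<t. (if l = k then F j l else 0) - F j l / real t - F j l * E l k)"
    by (intro sum.cong refl) (simp add: F_def[of _ k] algebra_simps)
  also have "\<dots> = F j k - (\<Sum>l<t. F j l) / real t - (\<Sum>l<t. F j l * E l k)"
    using assms by (simp add: sum_subtractf sum_divide_distrib)
  finally show ?thesis using assms by (simp add: F_row_sum F_E)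
qed

lemma F_E_product:
  assumes "j < t" "k < t"
  shows "(\<Sum>l<t. (x * F j l + y * E j l) * (x' * F l k + y' * E l k)) = x * x' * F j k + y * y' * E j k"
proof -
  have "(\<Sum>l<t. (x * F j l + y * E j l) * (x' * F l k + y' * E l k)) =
      x * x' * (\<Sum>l<t. F j l * F l k) + x * y' * (\<Sum>l<t. F j l * E l k)
      + x' * y * (\<Sum>l<t. E j l * F l k) + y * y' * (\<Sum>l<t. E j l * E l k)"
    by (simp add: algebra_simps sum.distrib sum_distrib_left)
  then show ?thesis using assms by (simp add: F_F F_E E_F E_E)
qed

lemma F_E_row_sum: "j < t \<Longrightarrow> (\<Sum>k<t. x * F j k + y * E j k) = 0"
  by (simp add: sum.distrib sum_distrib_left[symmetric] E_row_sum F_row_sum)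

lemma F_E_trace: "(\<Sum>j<t. x * F j j + y * E j j) = (real t - 2) * x + y"
  by (simp add: sum.distrib sum_distrib_left[symmetric] E_trace F_trace)

text \<open>Take \<open>D = x F + y E\<close> in \<open>Phi_A_le\<close>. Orthogonality of the
  projections gives \<open>D' D = x^2 F + y^2 E\<close>, and zero column sums of \<open>C\<close>
  make the part of the trace along \<open>F\<close> equal to the full trace minus
  \<open>q\<close>.\<close>

lemma Phi_A_le_direction:
  assumes C: "C \<in> carrier_mat t t" and sym: "C\<^sup>T = C"
    and psd: "\<And>u :: nat \<Rightarrow> real. (\<Sum>j<t. \<Sum>k<t. C $$ (j, k) * u j * u k) \<ge> 0"
    and cols: "\<And>k. k < t \<Longrightarrow> (\<Sum>j<t. C $$ (j, k)) = 0"
    and q: "q = (\<Sum>j<t. \<Sum>k<t. C $$ (j, k) * \<tau> j * \<tau> k) / nsq t \<tau>"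
  shows "Phi_A t C * ((real t - 2) * x + y)\<^sup>2 \<le>
    (real t - 1) * (x\<^sup>2 * ((\<Sum>j<t. C $$ (j, j)) - q) + y\<^sup>2 * q)"
proof -
  define D where "D j k = x * F j k + y * E j k" for j k
  have DD: "(\<Sum>l<t. D l j * D l k) = x\<^sup>2 * F j k + y\<^sup>2 * E j k" if "j < t" "k < t" for j k
    using F_E_product[OF that, of x y x y]
    by (simp add: D_def power2_eq_square F_commute[of j] E_commute[of j])
  have D1: "(\<Sum>k<t. D j k) = 0" if "j < t" for j
    unfolding D_def by (rule F_E_row_sum[OF that])
  have qE: "(\<Sum>j<t. \<Sum>k<t. C $$ (j, k) * E j k) = q"
    unfolding q E_def by (simp add: sum_divide_distrib mult_ac)
  have qF: "(\<Sum>j<t. \<Sum>k<t. C $$ (j, k) * F j k) = (\<Sum>j<t. C $$ (j, j)) - q"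
  proof -
    have "(\<Sum>j<t. \<Sum>k<t. C $$ (j, k) * F j k) =
      (\<Sum>j<t. \<Sum>k<t. (if k = j then C $$ (j, k) else 0) - C $$ (j, k) / real t - C $$ (j, k) * E j k)"
      by (intro sum.cong refl) (auto simp: F_def algebra_simps)
    also have "\<dots> = (\<Sum>j<t. C $$ (j, j)) - (\<Sum>j<t. \<Sum>k<t. C $$ (j, k)) / real t - q"
      by (simp add: sum_subtractf sum_divide_distrib qE)
    also have "(\<Sum>j<t. \<Sum>k<t. C $$ (j, k)) = (\<Sum>k<t. \<Sum>j<t. C $$ (j, k))" by (rule sum.swap)
    finally show ?thesis by (simp add: cols)
  qed
  have "(\<Sum>l<t. \<Sum>j<t. \<Sum>k<t. C $$ (j, k) * D l j * D l k) =
      (\<Sum>j<t. \<Sum>l<t. \<Sum>k<t. C $$ (j, k) * D l j * D l k)" by (rule sum.swap)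
  also have "\<dots> = (\<Sum>j<t. \<Sum>k<t. \<Sum>l<t. C $$ (j, k) * D l j * D l k)"
    by (intro sum.cong refl sum.swap)
  also have "\<dots> = (\<Sum>j<t. \<Sum>k<t. C $$ (j, k) * (x\<^sup>2 * F j k + y\<^sup>2 * E j k))"
    by (intro sum.cong refl) (simp add: sum_distrib_left mult.assoc flip: DD)
  also have "\<dots> = x\<^sup>2 * (\<Sum>j<t. \<Sum>k<t. C $$ (j, k) * F j k) + y\<^sup>2 * (\<Sum>j<t. \<Sum>k<t. C $$ (j, k) * E j k)"
    by (simp add: algebra_simps sum.distrib sum_distrib_left)
  finally show ?thesis
    using Phi_A_le[where D = D, OF t C sym psd cols D1]
    by (simp only: D_def F_E_trace qE qF)
qed

text \<open>The Moore-Penrose inverse of \<open>\<alpha> F + \<beta> E\<close> is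
  \<open>F / \<alpha> + E / \<beta>\<close>, with trace
  \<open>(t - 2) / \<alpha> + 1 / \<beta>\<close>.\<close>

lemma Phi_A_eq_direction:
  assumes C: "C \<in> carrier_mat t t" and sym: "C\<^sup>T = C"
    and psd: "\<And>u :: nat \<Rightarrow> real. (\<Sum>j<t. \<Sum>k<t. C $$ (j, k) * u j * u k) \<ge> 0"
    and cols: "\<And>k. k < t \<Longrightarrow> (\<Sum>j<t. C $$ (j, k)) = 0"
    and C_index: "\<And>j k. j < t \<Longrightarrow> k < t \<Longrightarrow> C $$ (j, k) = \<alpha> * F j k + \<beta> * E j k"
    and pos: "\<alpha> > 0" "\<beta> > 0"
  shows "Phi_A t C = (real t - 1) / ((real t - 2) / \<alpha> + 1 / \<beta>)"
proof -
  define D where "D j k = 1 / \<alpha> * F j k + 1 / \<beta> * E j k" for j k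
  have "(\<Sum>k<t. D j k * C $$ (k, l)) = (if j = l then 1 else 0) - 1 / real t" if "j < t" "l < t" for j l
  proof -
    have "(\<Sum>k<t. D j k * C $$ (k, l)) = (\<Sum>k<t. D j k * (\<alpha> * F k l + \<beta> * E k l))"
      using that by (intro sum.cong refl) (simp add: C_index)
    also have "\<dots> = F j l + E j l"
      unfolding D_def F_E_product[OF that] using pos by simp
    finally show ?thesis by (simp add: F_def)
  qed
  then have "Phi_A t C = (real t - 1) / (\<Sum>j<t. D j j)"
    by (intro Phi_A_eq[OF t C sym psd cols]) (simp_all only: D_def F_E_row_sum)
  also have "(\<Sum>j<t. D j j) = (real t - 2) * (1 / \<alpha>) + 1 / \<beta>"
    unfolding D_def by (rule F_E_trace)
  finally show ?thesis by simp
qed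

end

lemma Phi_A_nonneg:
  assumes t: "t \<ge> 2" and C: "C \<in> carrier_mat t t" and sym: "C\<^sup>T = C"
    and psd: "\<And>u :: nat \<Rightarrow> real. (\<Sum>j<t. \<Sum>k<t. C $$ (j, k) * u j * u k) \<ge> 0"
  shows "Phi_A t C \<ge> 0"
proof -
  define a where "a = eigenvalue_list C"
  obtain v where v: "eigenbasis C a v" using eigenbasis_exists[OF C sym] unfolding a_def by blast
  note orth = eigenbasisD(3)[OF v C] and eig = eigenbasisD(5)[OF v C]
  have nonneg: "a ! i \<ge> 0" if "i < t" for i
    using psd_eigenvalue_list_nonneg[OF psd] orth[OF that that] eig[OF that] by simp
  have "(\<Sum>i = 1..t - 1. inverse (a ! i)) \<ge> 0"
    using t nonneg by (intro sum_nonneg) auto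
  then show ?thesis using t by (simp add: Phi_A_def a_def[symmetric] Let_def)
qed

section \<open>Exchangeable priors\<close>

text \<open>Index pairs have two orbits, diagonal and off-diagonal. Zero row sums tie the two values
  together, leaving a multiple of \<open>B_t\<close> fixed by the trace. Applied both to the prior
  and to the \<open>C_dij\<close>.\<close>

lemma permutation_invariant_matrix:
  fixes E :: "nat \<Rightarrow> nat \<Rightarrow> real"
  assumes t: "t \<ge> 2" and ij: "i < t" "j < t"
    and inv: "\<And>\<sigma> i j. \<sigma> permutes {..<t} \<Longrightarrow> i < t \<Longrightarrow> j < t \<Longrightarrow> E (\<sigma> i) (\<sigma> j) = E i j"
    and rows: "\<And>i. i < t \<Longrightarrow> (\<Sum>j<t. E i j) = 0"
  shows "E i j = (\<Sum>k<t. E k k) / (real t - 1) * ((if i = j then 1 else 0) - 1 / real t)"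
proof -
  have tr: "Transposition.transpose a b permutes {..<t}" if "a < t" "b < t" for a b
    using that by (intro permutes_swap_id) auto
  have diag: "E k k = E 0 0" if "k < t" for k
    using inv[OF tr[of 0 k], of 0 0] that t by simp
  have "(\<Sum>i<t. E i i) = (\<Sum>i<t. E 0 0)" by (intro sum.cong refl diag) auto
  then have T: "(\<Sum>i<t. E i i) = real t * E 0 0" by simp
  show ?thesis
  proof (cases "i = j")
    case True
    then show ?thesis unfolding T using diag[OF ij(1)] t by (simp add: field_simps)
  next
    case False
    have off: "E i k = E i j" if "k < t" "k \<noteq> i" for k
      using inv[OF tr[of j k], of i j] that False ij by simp
    have "0 = E i i + (\<Sum>k\<in>{..<t} - {i}. E i k)"
      using rows[OF ij(1)] ij(1) by (simp add: sum.remove[of "{..<t}" i])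
    also have "(\<Sum>k\<in>{..<t} - {i}. E i k) = (\<Sum>k\<in>{..<t} - {i}. E i j)"
      by (intro sum.cong refl off) auto
    also have "\<dots> = (real t - 1) * E i j" using ij t by (simp add: of_nat_diff)
    finally have "E 0 0 + (real t - 1) * E i j = 0" using diag[OF ij(1)] by simp
    then show ?thesis unfolding T using False t by (simp add: field_simps)
  qed
qed

locale exchangeable_prior =
  fixes t :: nat and \<mu> :: "(nat \<Rightarrow> real) measure"
  assumes t: "t \<ge> 2" and prior: "is_prior t \<mu>" and exch: "exchangeable t \<mu>"
begin

lemma prior_prob_space: "prob_space \<mu>"
  and prior_sets: "sets \<mu> = sets (PiM {..<t} (\<lambda>_. borel))"
  and prior_AE: "AE \<tau> in \<mu>. (\<Sum>i<t. \<tau> i) = 0 \<and> (\<exists>i<t. \<tau> i \<noteq> 0)"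
  using prior by (simp_all add: is_prior_def)

lemma coordinate_measurable: "i < t \<Longrightarrow> (\<lambda>\<tau>. \<tau> i) \<in> borel_measurable \<mu>"
  using measurable_component_singleton[of i "{..<t}" "\<lambda>_. borel"]
  by (simp add: measurable_cong_sets[OF prior_sets refl])

lemma nsq_measurable: "nsq t \<in> borel_measurable \<mu>"
  unfolding nsq_def[abs_def] by (intro borel_measurable_sum borel_measurable_power coordinate_measurable) simp

lemma nsq_pos: "(\<exists>i<t. \<tau> i \<noteq> 0) \<Longrightarrow> nsq t \<tau> > 0"
  unfolding nsq_def by (auto intro: sum_pos2)

text \<open>Normalization bounds the integrand by 1, whatever the tails of the prior; where
  \<open>nsq\<close> is 0 the quotient is 0 by convention.\<close>

lemma direction_integrable:
  assumes "i < t" "j < t"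
  shows "integrable \<mu> (\<lambda>\<tau>. \<tau> i * \<tau> j / nsq t \<tau>)"
proof -
  interpret prob_space \<mu> by (rule prior_prob_space)
  have b: "\<bar>\<tau> i * \<tau> j / nsq t \<tau>\<bar> \<le> 1" for \<tau> :: "nat \<Rightarrow> real"
  proof (cases "nsq t \<tau> = 0")
    case False
    have N: "nsq t \<tau> > 0" using False sum_nonneg[of "{..<t}" "\<lambda>i. (\<tau> i)\<^sup>2"] by (simp add: nsq_def less_le)
    have "(\<tau> k)\<^sup>2 \<le> nsq t \<tau>" if "k < t" for k
      unfolding nsq_def using that by (intro member_le_sum) auto
    then have "\<bar>\<tau> k\<bar> \<le> sqrt (nsq t \<tau>)" if "k < t" for k
      using that by (metis real_sqrt_le_mono real_sqrt_abs)
    then have "\<bar>\<tau> i\<bar> * \<bar>\<tau> j\<bar> \<le> sqrt (nsq t \<tau>) * sqrt (nsq t \<tau>)"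
      using assms N by (intro mult_mono) auto
    then show ?thesis using N by (simp add: abs_mult)
  qed simp
  show ?thesis
    by (rule integrable_const_bound[where B = 1])
      (use b assms in \<open>auto intro!: borel_measurable_divide borel_measurable_times coordinate_measurable nsq_measurable\<close>)
qed

definition E :: "nat \<Rightarrow> nat \<Rightarrow> real" where
  "E i j = (\<integral>\<tau>. \<tau> i * \<tau> j / nsq t \<tau> \<partial>\<mu>)"

lemma E_permute:
  assumes \<sigma>: "\<sigma> permutes {..<t}" and ij: "i < t" "j < t"
  shows "E (\<sigma> i) (\<sigma> j) = E i j"
proof -
  let ?T = "\<lambda>\<tau>. \<lambda>i\<in>{..<t}. \<tau> (\<sigma> i) :: real"
  have lt: "\<sigma> i < t" if "i < t" for i using permutes_in_image[OF \<sigma>, of i] that by simp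
  have T: "?T \<in> measurable \<mu> \<mu>"
    unfolding measurable_cong_sets[OF refl prior_sets]
    by (rule measurable_restrict) (simp add: coordinate_measurable lt)
  have nsq_T: "nsq t (?T \<tau>) = nsq t \<tau>" for \<tau>
    unfolding nsq_def using sum.permute[OF \<sigma>, of "\<lambda>i. (\<tau> i)\<^sup>2"] by (simp add: o_def)
  have "E i j = (\<integral>\<tau>. \<tau> i * \<tau> j / nsq t \<tau> \<partial>(distr \<mu> \<mu> ?T))"
    using exch \<sigma> by (simp add: E_def exchangeable_def)
  also have "\<dots> = (\<integral>\<tau>. ?T \<tau> i * ?T \<tau> j / nsq t (?T \<tau>) \<partial>\<mu>)"
    by (rule integral_distr[OF T])
      (intro borel_measurable_divide borel_measurable_times coordinate_measurable nsq_measurable ij)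
  also have "\<dots> = E (\<sigma> i) (\<sigma> j)"
    unfolding E_def nsq_T using ij by simp
  finally show ?thesis by simp
qed

lemma E_row_sum: assumes "i < t" shows "(\<Sum>j<t. E i j) = 0"
proof -
  have "(\<Sum>j<t. E i j) = (\<integral>\<tau>. (\<Sum>j<t. \<tau> i * \<tau> j / nsq t \<tau>) \<partial>\<mu>)"
    unfolding E_def using assms by (intro Bochner_Integration.integral_sum[symmetric] direction_integrable) auto
  also have "\<dots> = (\<integral>\<tau>. 0 \<partial>\<mu>)"
  proof (rule integral_cong_AE)
    show "(\<lambda>\<tau>. \<Sum>j<t. \<tau> i * \<tau> j / nsq t \<tau>) \<in> borel_measurable \<mu>"
      using assms direction_integrable by (intro borel_measurable_sum borel_measurable_integrable) auto
    show "AE \<tau> in \<mu>. (\<Sum>j<t. \<tau> i * \<tau> j / nsq t \<tau>) = 0"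
      using prior_AE
      by eventually_elim (simp add: sum_divide_distrib[symmetric] sum_distrib_left[symmetric])
  qed simp
  finally show ?thesis by simp
qed

lemma E_trace: "(\<Sum>i<t. E i i) = 1"
proof -
  interpret prob_space \<mu> by (rule prior_prob_space)
  have "(\<Sum>i<t. E i i) = (\<integral>\<tau>. (\<Sum>i<t. \<tau> i * \<tau> i / nsq t \<tau>) \<partial>\<mu>)"
    unfolding E_def by (intro Bochner_Integration.integral_sum[symmetric] direction_integrable) auto
  also have "\<dots> = (\<integral>\<tau>. 1 \<partial>\<mu>)"
  proof (rule integral_cong_AE)
    show "(\<lambda>\<tau>. \<Sum>i<t. \<tau> i * \<tau> i / nsq t \<tau>) \<in> borel_measurable \<mu>"
      using direction_integrable by (intro borel_measurable_sum borel_measurable_integrable) auto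
    show "AE \<tau> in \<mu>. (\<Sum>i<t. \<tau> i * \<tau> i / nsq t \<tau>) = 1"
      using prior_AE
    proof eventually_elim
      case (elim \<tau>)
      then have "nsq t \<tau> > 0" by (intro nsq_pos) simp
      then show ?case by (simp add: sum_divide_distrib[symmetric] power2_eq_square[symmetric] nsq_def)
    qed
  qed simp
  finally show ?thesis by (simp add: prob_space)
qed

lemma E_eq:
  assumes "i < t" "j < t"
  shows "E i j = ((if i = j then 1 else 0) - 1 / real t) / (real t - 1)"
  using permutation_invariant_matrix[where E = E, OF t assms E_permute E_row_sum] by (simp add: E_trace)

text \<open>The expectation is the trace of \<open>M\<close> times the mean projection
  \<open>B_t / (t - 1)\<close>; the all-ones part of \<open>B_t\<close> contributes the total sum of
  \<open>M\<close>, which is 0.\<close>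

lemma exchangeable_expectation_form:
  assumes M: "(\<Sum>a<t. \<Sum>b<t. M a b) = 0"
  shows "integrable \<mu> (\<lambda>\<tau>. (\<Sum>a<t. \<Sum>b<t. M a b * \<tau> a * \<tau> b) / nsq t \<tau>)"
    and "(\<integral>\<tau>. (\<Sum>a<t. \<Sum>b<t. M a b * \<tau> a * \<tau> b) / nsq t \<tau> \<partial>\<mu>) = (\<Sum>a<t. M a a) / (real t - 1)"
proof -
  have eq: "(\<Sum>a<t. \<Sum>b<t. M a b * \<tau> a * \<tau> b) / nsq t \<tau> = (\<Sum>a<t. \<Sum>b<t. M a b * (\<tau> a * \<tau> b / nsq t \<tau>))"
    for \<tau> by (simp add: sum_divide_distrib mult_ac)
  show "integrable \<mu> (\<lambda>\<tau>. (\<Sum>a<t. \<Sum>b<t. M a b * \<tau> a * \<tau> b) / nsq t \<tau>)"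
    unfolding eq by (intro Bochner_Integration.integrable_sum integrable_mult_right direction_integrable) auto
  have "(\<integral>\<tau>. (\<Sum>a<t. \<Sum>b<t. M a b * \<tau> a * \<tau> b) / nsq t \<tau> \<partial>\<mu>) =
    (\<integral>\<tau>. (\<Sum>a<t. \<Sum>b<t. M a b * (\<tau> a * \<tau> b / nsq t \<tau>)) \<partial>\<mu>)"
    by (simp only: eq)
  also have "\<dots> = (\<Sum>a<t. \<integral>\<tau>. (\<Sum>b<t. M a b * (\<tau> a * \<tau> b / nsq t \<tau>)) \<partial>\<mu>)"
    by (intro Bochner_Integration.integral_sum Bochner_Integration.integrable_sum integrable_mult_right
        direction_integrable) auto
  also have "\<dots> = (\<Sum>a<t. \<Sum>b<t. \<integral>\<tau>. M a b * (\<tau> a * \<tau> b / nsq t \<tau>) \<partial>\<mu>)"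
    by (intro sum.cong refl Bochner_Integration.integral_sum integrable_mult_right direction_integrable) auto
  also have "\<dots> = (\<Sum>a<t. \<Sum>b<t. M a b * E a b)"
    by (simp only: E_def integral_mult_right_zero)
  also have "\<dots> = (\<Sum>a<t. \<Sum>b<t. (if b = a then M a b / (real t - 1) else 0) - M a b / (real t * (real t - 1)))"
    using t by (intro sum.cong refl) (auto simp: E_eq diff_divide_distrib algebra_simps)
  also have "\<dots> = (\<Sum>a<t. M a a) / (real t - 1) - (\<Sum>a<t. \<Sum>b<t. M a b) / (real t * (real t - 1))"
    by (simp add: sum_subtractf sum_divide_distrib)
  finally show "(\<integral>\<tau>. (\<Sum>a<t. \<Sum>b<t. M a b * \<tau> a * \<tau> b) / nsq t \<tau> \<partial>\<mu>) = (\<Sum>a<t. M a a) / (real t - 1)"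
    by (simp add: M)
qed

end

section \<open>The upper bound for an arbitrary design\<close>

context crossover begin

lemma C_trace:
  "(\<Sum>a<t. C P i j a a) = c_design p t n \<Sigma> P i j - real n * (\<Sum>a<t. bl (gbar P i a) (gbar P j a))"
proof -
  have "(\<Sum>a<t. C P i j a a) = real n * ((\<Sum>a<t. \<Sum>s\<in>seqs p t. P s * bl (g i s a) (g j s a))
      - (\<Sum>a<t. bl (gbar P i a) (gbar P j a)))"
    by (simp add: C_eq sum_distrib_left[symmetric] sum_subtractf)
  also have "(\<Sum>a<t. \<Sum>s\<in>seqs p t. P s * bl (g i s a) (g j s a)) =
    (\<Sum>s\<in>seqs p t. P s * c_seq p t \<Sigma> s i j)"
    by (subst sum.swap) (simp add: c_seq_eq sum_distrib_left)
  finally show ?thesis by (simp add: c_design_def right_diff_distrib)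
qed

text \<open>Removing the period means subtracts the sum over treatments of \<open>bl\<close> at
  \<open>gbar P 1 a + x * gbar P 2 a\<close>, which is nonnegative.\<close>

lemma tr_Cx_le: "tr_Cx P x \<le> real n * q_design p t \<Sigma> P x"
proof -
  define G where "G i j = (\<Sum>a<t. bl (gbar P i a) (gbar P j a))" for i j
  have tr: "(\<Sum>a<t. C P i j a a) = real n * ((\<Sum>s\<in>seqs p t. P s * c_seq p t \<Sigma> s i j) - G i j)" for i j
    by (simp add: C_trace c_design_def G_def right_diff_distrib)
  have "G 1 1 + 2 * x * G 1 2 + x\<^sup>2 * G 2 2 =
    (\<Sum>a<t. bl (\<lambda>k. gbar P 1 a k + x * gbar P 2 a k) (\<lambda>k. gbar P 1 a k + x * gbar P 2 a k))"
    unfolding G_def bl_add_left bl_add_right bl_scale_left bl_scale_right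
    by (simp add: bl_commute[of "gbar P 2 a" "gbar P (Suc 0) a" for a] algebra_simps power2_eq_square sum.distrib sum_distrib_left)
  also have "\<dots> \<ge> 0" by (intro sum_nonneg bl_nonneg)
  finally have G: "G 1 1 + 2 * x * G 1 2 + x\<^sup>2 * G 2 2 \<ge> 0" .
  have c21: "(\<Sum>a<t. C P 2 1 a a) = (\<Sum>a<t. C P 1 2 a a)"
    by (intro sum.cong refl) (rule C_sym, auto)
  have "tr_Cx P x = (\<Sum>a<t. C P 1 1 a a) + x * ((\<Sum>a<t. C P 1 2 a a) + (\<Sum>a<t. C P 2 1 a a)) + x\<^sup>2 * (\<Sum>a<t. C P 2 2 a a)"
    by (simp add: tr_Cx_def Cx_def sum.distrib sum_distrib_left[symmetric])
  also have "\<dots> = real n * (q_design p t \<Sigma> P x - (G 1 1 + 2 * x * G 1 2 + x\<^sup>2 * G 2 2))"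
    unfolding c21 tr q_design_def q_seq_def
    by (simp add: algebra_simps sum.distrib sum_distrib_left)
  also have "\<dots> \<le> real n * q_design p t \<Sigma> P x"
    using G by (intro mult_left_mono) auto
  finally show ?thesis .
qed

lemma Cx_sum: "(\<Sum>a<t. \<Sum>b<t. Cx P x a b) = 0"
  by (subst sum.swap) (simp add: Cx_col_sum)

text \<open>The weights \<open>x\<close>, \<open>y\<close> and the point \<open>x0\<close> stay
  free: inverse values of \<open>q_d\<close> at a pseudo symmetric design give optimality, and
  \<open>(0, 1)\<close> gives positivity of \<open>q_d(x_d)\<close>.\<close>

theorem A_crit_le:
  assumes prior: "is_prior t \<mu>" and exch: "exchangeable t \<mu>" and P: "is_design p t P"
    and pos: "(real t - 2) * x + y > 0"
  shows "A_crit p t n \<Sigma> \<mu> lam P * ((real t - 2) * x + y)\<^sup>2 \<le>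
    real n * ((real t - 2) * x\<^sup>2 * q_design p t \<Sigma> P lam + y\<^sup>2 * q_design p t \<Sigma> P x0)"
proof -
  interpret exchangeable_prior t \<mu> using t prior exch by unfold_locales
  interpret prob_space \<mu> by (rule prior_prob_space)
  define K where "K = ((real t - 2) * x + y)\<^sup>2"
  have K: "K > 0" using pos by (simp add: K_def)
  let ?N = "nsq t"
  \<comment> \<open>The pointwise bound: \<open>lam\<close> across \<open>\<tau>\<close>,
    \<open>x0\<close> along \<open>\<tau>\<close>. It depends on \<open>\<tau>\<close> only through
    normalized quadratic forms, whose means are known.\<close>
  define R where "R \<tau> = (real t - 1) / K * (x\<^sup>2 * (tr_Cx P lam - Q P lam \<tau> / ?N \<tau>) + y\<^sup>2 * (Q P x0 \<tau> / ?N \<tau>))" for \<tau>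
  note EQ = exchangeable_expectation_form[OF Cx_sum, folded Q_def tr_Cx_def]
  have "AE \<tau> in \<mu>. Phi_A t (info_mat p t n \<Sigma> P (vec t \<tau>) lam) \<le> R \<tau>"
    using prior_AE
  proof eventually_elim
    case (elim \<tau>)
    let ?M = "info_mat p t n \<Sigma> P (vec t \<tau>) lam"
    have N: "?N \<tau> > 0" using elim nsq_pos by blast
    have dir: "direction t \<tau>" using elim t N by unfold_locales auto
    define q where "q = (\<Sum>j<t. \<Sum>k<t. ?M $$ (j, k) * \<tau> j * \<tau> k) / ?N \<tau>"
    have "Phi_A t ?M * K \<le> (real t - 1) * (x\<^sup>2 * ((\<Sum>j<t. ?M $$ (j, j)) - q) + y\<^sup>2 * q)"
      unfolding K_def
      by (rule direction.Phi_A_le_direction[OF dir info_mat_carrier info_mat_symmetric info_mat_psd[OF P]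
            info_mat_col_sum q_def])
    also have "\<dots> \<le> (real t - 1) * (x\<^sup>2 * (tr_Cx P lam - Q P lam \<tau> / ?N \<tau>) + y\<^sup>2 * (Q P x0 \<tau> / ?N \<tau>))"
      unfolding q_def using t N
      by (intro mult_left_mono add_mono info_mat_trace_le[OF P nsq_def N] divide_right_mono info_mat_form_le[OF P]) auto
    finally show ?case using K by (simp add: R_def field_simps)
  qed
  moreover have "AE \<tau> in \<mu>. 0 \<le> R \<tau>"
    using calculation
    by eventually_elim
      (meson Phi_A_nonneg[OF t info_mat_carrier info_mat_symmetric info_mat_psd[OF P]] order_trans)
  moreover have intR: "integrable \<mu> R"
    unfolding R_def[abs_def]
    by (intro integrable_mult_right Bochner_Integration.integrable_add Bochner_Integration.integrable_diff EQ(1) integrable_const)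
  \<comment> \<open>Only \<open>R\<close> has to be integrable: a non-integrable criterion has the junk value 0.\<close>
  ultimately have "A_crit p t n \<Sigma> \<mu> lam P \<le> (\<integral>\<tau>. R \<tau> \<partial>\<mu>)"
    unfolding A_crit_def by (intro integral_mono_AE')
  also have "(\<integral>\<tau>. R \<tau> \<partial>\<mu>) = (real t - 1) / K * (x\<^sup>2 * (tr_Cx P lam - tr_Cx P lam / (real t - 1)) + y\<^sup>2 * (tr_Cx P x0 / (real t - 1)))"
  proof -
    have "(\<integral>\<tau>. c * (a * (T - f \<tau>) + b * f' \<tau>) \<partial>\<mu>) = c * (a * (T - (\<integral>\<tau>. f \<tau> \<partial>\<mu>)) + b * (\<integral>\<tau>. f' \<tau> \<partial>\<mu>))"
      if "integrable \<mu> f" "integrable \<mu> f'" for f f' and a b c T :: real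
      using that by (simp add: prob_space)
    from this[OF EQ(1) EQ(1)] show ?thesis
      unfolding R_def[abs_def] by (simp only: EQ(2))
  qed
  also have "\<dots> = ((real t - 2) * x\<^sup>2 * tr_Cx P lam + y\<^sup>2 * tr_Cx P x0) / K"
  proof -
    have "r / K * (x\<^sup>2 * (T - T / r) + y\<^sup>2 * (T' / r)) = ((r - 1) * x\<^sup>2 * T + y\<^sup>2 * T') / K"
      if "r > 0" for r T T'
      using that K by (simp add: field_simps)
    from this[of "real t - 1"] show ?thesis using t by simp
  qed
  also have "\<dots> \<le> ((real t - 2) * x\<^sup>2 * (real n * q_design p t \<Sigma> P lam) + y\<^sup>2 * (real n * q_design p t \<Sigma> P x0)) / K"
    using t K by (intro divide_right_mono add_mono mult_left_mono tr_Cx_le) auto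
  finally show ?thesis using K unfolding K_def[symmetric] by (simp add: field_simps)
qed

section \<open>Symmetrization over treatment labels\<close>

text \<open>\<open>C_dij = c_dij / (t - 1) B_t\<close>, the form shared by pseudo symmetric and
  relabelling-invariant designs. The scalar uses the uncentred trace, so the period means must not
  contribute to the traces.\<close>

definition balanced :: "(nat list \<Rightarrow> real) \<Rightarrow> bool" where
  "balanced P \<longleftrightarrow> (\<forall>i\<in>{1, 2}. \<forall>j\<in>{1, 2}. \<forall>a<t. \<forall>b<t.
     C P i j a b = c_design p t n \<Sigma> P i j / (real t - 1) * ((if a = b then 1 else 0) - 1 / real t))"

lemma balancedI:
  assumes gbar: "\<And>i a k. i \<in> {1, 2} \<Longrightarrow> a < t \<Longrightarrow> k < p \<Longrightarrow> gbar P i a k = 0"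
    and inv: "\<And>i j \<sigma> a b. i \<in> {1, 2} \<Longrightarrow> j \<in> {1, 2} \<Longrightarrow> \<sigma> permutes {..<t} \<Longrightarrow> a < t \<Longrightarrow> b < t \<Longrightarrow>
      C P i j (\<sigma> a) (\<sigma> b) = C P i j a b"
  shows "balanced P"
  unfolding balanced_def
proof (intro ballI allI impI)
  fix i j :: nat and a b assume ij: "i \<in> {1, 2}" "j \<in> {1, 2}" and ab: "a < t" "b < t"
  have "(\<Sum>a<t. bl (gbar P i a) (gbar P j a)) = (\<Sum>a<t. bl (\<lambda>_. 0) (\<lambda>_. 0))"
    using gbar ij by (intro sum.cong refl bl_cong) auto
  then have "(\<Sum>a<t. C P i j a a) = c_design p t n \<Sigma> P i j"
    unfolding C_trace by (simp add: bl_0_left)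
  then show "C P i j a b = c_design p t n \<Sigma> P i j / (real t - 1) * ((if a = b then 1 else 0) - 1 / real t)"
    using permutation_invariant_matrix[where E = "C P i j", OF t ab inv[OF ij] C_row_sum] by simp
qed

text \<open>Equal replication in period \<open>k\<close> makes the mean direct column vanish there.
  The carryover column of period \<open>k\<close> is the direct one of period \<open>k - 1\<close>,
  and is zero in the first period.\<close>

lemma pseudo_symmetric_balanced:
  assumes P: "is_design p t P" and ps: "pseudo_symmetric p t n \<Sigma> P"
  shows "balanced P"
proof (rule balancedI)
  fix i a k assume i: "i \<in> {1, 2::nat}" and a: "a < t" and k: "k < p"
  have rep: "(\<Sum>s\<in>seqs p t. P s * ((if s ! l = a then 1 else 0) - 1 / real t)) = 0" if "l < p" for l
  proof -
    have "(\<Sum>s\<in>seqs p t. P s * ((if s ! l = a then 1 else 0) - 1 / real t)) =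
      (\<Sum>s\<in>seqs p t. if s ! l = a then P s else 0) - (\<Sum>s\<in>seqs p t. P s) / real t"
      unfolding sum_divide_distrib sum_subtractf[symmetric]
      by (intro sum.cong refl) (auto simp: algebra_simps)
    also have "(\<Sum>s\<in>seqs p t. if s ! l = a then P s else 0) = 1 / real t"
      using ps that a by (simp add: pseudo_symmetric_def sum.inter_filter[symmetric])
    finally show ?thesis using P by (simp add: is_design_def)
  qed
  consider "i = 1" | "i \<noteq> 1" "k = 0" | "i \<noteq> 1" "k \<noteq> 0" by blast
  then show "gbar P i a k = 0"
  proof cases
    case 1
    have "gbar P i a k = (\<Sum>s\<in>seqs p t. P s * ((if s ! k = a then 1 else 0) - 1 / real t))"
      unfolding gbar_def using a k 1 by (intro sum.cong refl) (simp add: g_eq)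
    then show ?thesis using rep[OF k] by simp
  next
    case 2
    then show ?thesis unfolding gbar_def using a k by (intro sum.neutral) (simp add: g_eq)
  next
    case 3
    have "gbar P i a k = (\<Sum>s\<in>seqs p t. P s * ((if s ! (k - 1) = a then 1 else 0) - 1 / real t))"
      unfolding gbar_def using a k 3 by (intro sum.cong refl) (simp add: g_eq)
    then show ?thesis using rep[of "k - 1"] k by simp
  qed
next
  fix i j :: nat and \<sigma> a b
  assume ij: "i \<in> {1, 2}" "j \<in> {1, 2}" and \<sigma>: "\<sigma> permutes {..<t}" and ab: "a < t" "b < t"
  obtain \<alpha> \<beta> where M: "C_design p t n \<Sigma> P i j = \<alpha> \<cdot>\<^sub>m 1\<^sub>m t + \<beta> \<cdot>\<^sub>m J_mat t"
    using ps ij unfolding pseudo_symmetric_def completely_symmetric_def by blast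
  have "\<sigma> a < t" "\<sigma> b < t" using ab permutes_in_image[OF \<sigma>] by auto
  moreover have "\<sigma> a = \<sigma> b \<longleftrightarrow> a = b" using permutes_inj[OF \<sigma>] by (simp add: inj_eq)
  ultimately show "C P i j (\<sigma> a) (\<sigma> b) = C P i j a b"
    using ab unfolding M by (simp add: J_mat_def)
qed

lemma map_permutes_seqs: "\<sigma> permutes {..<t} \<Longrightarrow> s \<in> seqs p t \<Longrightarrow> map \<sigma> s \<in> seqs p t"
  using permutes_in_image[of \<sigma> "{..<t}"] by (auto simp: seqs_def)

lemma bij_betw_map_seqs:
  assumes "\<sigma> permutes {..<t}"
  shows "bij_betw (map \<sigma>) (seqs p t) (seqs p t)"
proof (rule bij_betw_byWitness[where f' = "map (inv_into UNIV \<sigma>)"])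
  show "\<forall>s\<in>seqs p t. map (inv_into UNIV \<sigma>) (map \<sigma> s) = s" "\<forall>s\<in>seqs p t. map \<sigma> (map (inv_into UNIV \<sigma>) s) = s"
    using permutes_inverses[OF assms] by (simp_all add: map_idI)
  show "map \<sigma> ` seqs p t \<subseteq> seqs p t" "map (inv_into UNIV \<sigma>) ` seqs p t \<subseteq> seqs p t"
    using map_permutes_seqs[OF assms] map_permutes_seqs[OF permutes_inv[OF assms]] by auto
qed

lemma sum_seqs_permute:
  "\<sigma> permutes {..<t} \<Longrightarrow> (\<Sum>s\<in>seqs p t. f (map \<sigma> s)) = (\<Sum>s\<in>seqs p t. f s)"
  by (rule sum.reindex_bij_betw[OF bij_betw_map_seqs])

lemma g_permute:
  assumes \<sigma>: "\<sigma> permutes {..<t}" and s: "s \<in> seqs p t" and a: "a < t" and k: "k < p"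
  shows "g i (map \<sigma> s) (\<sigma> a) k = g i s a k"
proof -
  have "length s = p" using s by (simp add: seqs_def)
  moreover have "\<sigma> x = \<sigma> y \<longleftrightarrow> x = y" for x y using permutes_inj[OF \<sigma>] by (simp add: inj_eq)
  moreover have "\<sigma> a < t" using a permutes_in_image[OF \<sigma>] by simp
  ultimately show ?thesis
    using map_permutes_seqs[OF \<sigma> s] s a k by (simp add: g_eq)
qed

lemma c_seq_permute:
  assumes \<sigma>: "\<sigma> permutes {..<t}" and s: "s \<in> seqs p t"
  shows "c_seq p t \<Sigma> (map \<sigma> s) i j = c_seq p t \<Sigma> s i j"
proof -
  have "c_seq p t \<Sigma> (map \<sigma> s) i j = (\<Sum>a<t. bl (g i (map \<sigma> s) (\<sigma> a)) (g j (map \<sigma> s) (\<sigma> a)))"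
    unfolding c_seq_eq using sum.permute[OF \<sigma>, of "\<lambda>a. bl (g i (map \<sigma> s) a) (g j (map \<sigma> s) a)"]
    by (simp add: o_def)
  also have "\<dots> = (\<Sum>a<t. bl (g i s a) (g j s a))"
    using assms by (intro sum.cong refl bl_cong g_permute) auto
  finally show ?thesis by (simp add: c_seq_eq)
qed

text \<open>Invariance makes the period means equal for all treatments, and they sum to 0 over
  treatments, so they vanish.\<close>

lemma invariant_design_balanced:
  assumes inv: "\<And>\<sigma> s. \<sigma> permutes {..<t} \<Longrightarrow> s \<in> seqs p t \<Longrightarrow> P (map \<sigma> s) = P s"
  shows "balanced P"
proof -
  have gbar_inv: "gbar P i (\<sigma> a) k = gbar P i a k" if "\<sigma> permutes {..<t}" "a < t" "k < p" for \<sigma> i a k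
  proof -
    have "gbar P i (\<sigma> a) k = (\<Sum>s\<in>seqs p t. P (map \<sigma> s) * g i (map \<sigma> s) (\<sigma> a) k)"
      unfolding gbar_def by (rule sum_seqs_permute[OF that(1), symmetric])
    also have "\<dots> = gbar P i a k"
      unfolding gbar_def using that by (intro sum.cong refl) (simp add: inv g_permute)
    finally show ?thesis .
  qed
  show ?thesis
  proof (rule balancedI)
    fix i a k assume "a < t" "k < p"
    have eq: "gbar P i b k = gbar P i a k" if "b < t" for b
      using gbar_inv[of "Transposition.transpose a b" a k i] that \<open>a < t\<close> \<open>k < p\<close>
      by (simp add: permutes_swap_id)
    have "real t * gbar P i a k = (\<Sum>b<t. gbar P i a k)" by simp
    also have "\<dots> = (\<Sum>b<t. gbar P i b k)" by (intro sum.cong refl) (simp only: eq lessThan_iff)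
    also have "\<dots> = (\<Sum>s\<in>seqs p t. P s * (\<Sum>b<t. g i s b k))"
      unfolding gbar_def by (subst sum.swap) (simp add: sum_distrib_left)
    also have "\<dots> = 0" using \<open>k < p\<close> by (simp add: g_sum_0)
    finally show "gbar P i a k = 0" using t by simp
  next
    fix i j \<sigma> a b
    assume \<sigma>: "\<sigma> permutes {..<t}" and ab: "a < t" "b < t"
    have \<sigma>ab: "\<sigma> a < t" "\<sigma> b < t" using ab permutes_in_image[OF \<sigma>] by auto
    have "(\<Sum>s\<in>seqs p t. P s * bl (g i s (\<sigma> a)) (g j s (\<sigma> b))) =
      (\<Sum>s\<in>seqs p t. P (map \<sigma> s) * bl (g i (map \<sigma> s) (\<sigma> a)) (g j (map \<sigma> s) (\<sigma> b)))"
      by (rule sum_seqs_permute[OF \<sigma>, symmetric])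
    also have "\<dots> = (\<Sum>s\<in>seqs p t. P s * bl (g i s a) (g j s b))"
      using \<sigma> ab by (intro sum.cong refl arg_cong2[of _ _ _ _ "(*)"] bl_cong inv g_permute) auto
    finally have 1: "(\<Sum>s\<in>seqs p t. P s * bl (g i s (\<sigma> a)) (g j s (\<sigma> b))) =
      (\<Sum>s\<in>seqs p t. P s * bl (g i s a) (g j s b))" .
    have 2: "bl (gbar P i (\<sigma> a)) (gbar P j (\<sigma> b)) = bl (gbar P i a) (gbar P j b)"
      using \<sigma> ab by (intro bl_cong gbar_inv)
    show "C P i j (\<sigma> a) (\<sigma> b) = C P i j a b"
      unfolding C_eq[OF ab] C_eq[OF \<sigma>ab] 1 2 ..
  qed
qed

text \<open>Average over all \<open>t!\<close> relabellings. Each \<open>c_seq\<close> is invariant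
  under relabelling, so the weighted sums \<open>c_design\<close> do not change.\<close>

lemma symmetrization:
  assumes P: "is_design p t P"
  obtains P' where "is_design p t P'" "balanced P'"
    "\<And>i j. c_design p t n \<Sigma> P' i j = c_design p t n \<Sigma> P i j"
proof -
  let ?S = "{\<sigma>. \<sigma> permutes {..<t}}"
  define P' where "P' s = (\<Sum>\<sigma>\<in>?S. P (map \<sigma> s)) / fact t" for s
  have cS: "card ?S = fact t" using card_permutations[of "{..<t}" t] by simp
  have wsum: "(\<Sum>s\<in>seqs p t. P' s * f s) = (\<Sum>s\<in>seqs p t. P s * f s)"
    if f: "\<And>\<sigma> s. \<sigma> permutes {..<t} \<Longrightarrow> s \<in> seqs p t \<Longrightarrow> f (map \<sigma> s) = f s" for f :: "nat list \<Rightarrow> real"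
  proof -
    have "(\<Sum>s\<in>seqs p t. P' s * f s) = (\<Sum>s\<in>seqs p t. \<Sum>\<sigma>\<in>?S. P (map \<sigma> s) * f s) / fact t"
      by (simp add: P'_def sum_distrib_right sum_divide_distrib)
    also have "(\<Sum>s\<in>seqs p t. \<Sum>\<sigma>\<in>?S. P (map \<sigma> s) * f s) = (\<Sum>\<sigma>\<in>?S. \<Sum>s\<in>seqs p t. P (map \<sigma> s) * f s)"
      by (rule sum.swap)
    also have "\<dots> = (\<Sum>\<sigma>\<in>?S. \<Sum>s\<in>seqs p t. P (map \<sigma> s) * f (map \<sigma> s))"
      by (intro sum.cong refl) (simp add: f)
    also have "\<dots> = (\<Sum>\<sigma>\<in>?S. \<Sum>s\<in>seqs p t. P s * f s)"
      by (rule sum.cong[OF refl], rule sum_seqs_permute[of _ "\<lambda>s. P s * f s"]) simp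
    finally show ?thesis by (simp add: cS)
  qed
  have "P' s \<ge> 0" if "s \<in> seqs p t" for s
    unfolding P'_def using P that map_permutes_seqs
    by (intro divide_nonneg_nonneg sum_nonneg) (auto simp: is_design_def)
  moreover have "(\<Sum>s\<in>seqs p t. P' s) = 1"
    using wsum[of "\<lambda>_. 1"] P by (simp add: is_design_def)
  ultimately have "is_design p t P'" by (simp add: is_design_def)
  moreover have "balanced P'"
  proof (rule invariant_design_balanced)
    fix \<rho> s assume \<rho>: "\<rho> permutes {..<t}"
    show "P' (map \<rho> s) = P' s"
      unfolding P'_def using sum_permutations_compose_right[OF \<rho>, of "\<lambda>\<sigma>. P (map \<sigma> s)"] by simp
  qed
  moreover have "c_design p t n \<Sigma> P' i j = c_design p t n \<Sigma> P i j" for i j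
    unfolding c_design_def by (simp add: wsum[OF c_seq_permute])
  ultimately show thesis by (rule that)
qed

section \<open>Positivity and minimization of the quadratics \<open>q_s\<close> and
  \<open>q_d\<close>\<close>

lemma q_seq_eq:
  "q_seq p t \<Sigma> s x = (\<Sum>a<t. bl (\<lambda>k. g 1 s a k + x * g 2 s a k) (\<lambda>k. g 1 s a k + x * g 2 s a k))"
  unfolding q_seq_def c_seq_eq bl_add_left bl_add_right bl_scale_left bl_scale_right
  by (simp add: bl_commute[of "g 2 s a" "g (Suc 0) s a" for a] algebra_simps power2_eq_square
      sum.distrib sum_distrib_left)

lemma q_seq_nonneg: "q_seq p t \<Sigma> s x \<ge> 0"
  unfolding q_seq_eq by (intro sum_nonneg bl_nonneg)

lemma q_seq_pos:
  assumes "g 1 s 0 0 + x * g 2 s 0 0 \<noteq> g 1 s 0 1 + x * g 2 s 0 1"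
  shows "q_seq p t \<Sigma> s x > 0"
proof -
  have "bl (\<lambda>k. g 1 s 0 k + x * g 2 s 0 k) (\<lambda>k. g 1 s 0 k + x * g 2 s 0 k) \<noteq> 0"
    using bl_eq_0_imp_const[of "\<lambda>k. g 1 s 0 k + x * g 2 s 0 k" 0 1] assms p2 by auto
  then have "bl (\<lambda>k. g 1 s 0 k + x * g 2 s 0 k) (\<lambda>k. g 1 s 0 k + x * g 2 s 0 k) > 0"
    using bl_nonneg by (simp add: less_le)
  then show ?thesis
    unfolding q_seq_eq using t by (intro sum_pos2[where i = 0] bl_nonneg) auto
qed

text \<open>A centred carryover column is 0 in the first period and \<open>1 - 1 / t\<close> or
  \<open>- 1 / t\<close> in the second, hence never constant. This makes the denominator of
  \<open>x_d\<close> positive for every design.\<close>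

lemma c_seq22_pos:
  assumes "s \<in> seqs p t"
  shows "c_seq p t \<Sigma> s 2 2 > 0"
proof -
  have "g 2 s 0 0 \<noteq> g 2 s 0 1"
    using assms t p2 by (auto simp: g_eq field_simps)
  then have "bl (g 2 s 0) (g 2 s 0) \<noteq> 0"
    using bl_eq_0_imp_const[of "g 2 s 0" 0 1] p2 by auto
  then have "bl (g 2 s 0) (g 2 s 0) > 0"
    using bl_nonneg by (simp add: less_le)
  then show ?thesis
    unfolding c_seq_eq using t by (intro sum_pos2[where i = 0] bl_nonneg) auto
qed

lemma c_design22_pos:
  assumes P: "is_design p t P"
  shows "c_design p t n \<Sigma> P 2 2 > 0"
proof -
  have "\<exists>s\<in>seqs p t. P s \<noteq> 0" using P by (metis is_design_def sum.neutral zero_neq_one)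
  then obtain s where s: "s \<in> seqs p t" "P s > 0" using P by (auto simp: is_design_def less_le)
  have "(\<Sum>s\<in>seqs p t. P s * c_seq p t \<Sigma> s 2 2) > 0"
    using s P c_seq22_pos by (intro sum_pos2[OF _ s(1)]) (auto simp: is_design_def less_imp_le)
  then show ?thesis using n by (simp add: c_design_def)
qed

lemma q_design_eq:
  "real n * q_design p t \<Sigma> P x =
    c_design p t n \<Sigma> P 1 1 + 2 * c_design p t n \<Sigma> P 1 2 * x + c_design p t n \<Sigma> P 2 2 * x\<^sup>2"
  by (simp add: q_design_def q_seq_def c_design_def algebra_simps sum.distrib sum_distrib_left)

lemma q_design_complete_square:
  assumes P: "is_design p t P"
  shows "real n * q_design p t \<Sigma> P x = real n * q_design p t \<Sigma> P (x_design p t n \<Sigma> P) +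
    c_design p t n \<Sigma> P 2 2 * (x - x_design p t n \<Sigma> P)\<^sup>2"
proof -
  have "c_design p t n \<Sigma> P 2 2 \<noteq> 0" using c_design22_pos[OF P] by simp
  then show ?thesis
    unfolding q_design_eq x_design_def by (simp add: field_simps power2_eq_square)
qed

text \<open>The minimum in a form free of \<open>x_d\<close>, so that it can be differentiated along
  a path of designs without following the minimizer.\<close>

lemma q_design_x_design:
  assumes P: "is_design p t P"
  shows "real n * q_design p t \<Sigma> P (x_design p t n \<Sigma> P) =
    c_design p t n \<Sigma> P 1 1 - (c_design p t n \<Sigma> P 1 2)\<^sup>2 / c_design p t n \<Sigma> P 2 2"
  using c_design22_pos[OF P] unfolding q_design_eq x_design_def
  by (simp add: field_simps power2_eq_square)

lemma q_design_min:
  assumes P: "is_design p t P"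
  shows "q_design p t \<Sigma> P (x_design p t n \<Sigma> P) \<le> q_design p t \<Sigma> P x"
proof -
  have "real n * q_design p t \<Sigma> P (x_design p t n \<Sigma> P) \<le> real n * q_design p t \<Sigma> P x"
    using q_design_complete_square[OF P, of x] c_design22_pos[OF P] by simp
  then show ?thesis using n by simp
qed

lemma c_design_21: "c_design p t n \<Sigma> P 2 1 = c_design p t n \<Sigma> P 1 2"
  by (simp add: c_design_def c_seq_eq bl_commute[of "g 2 _ _" "g (Suc 0) _ _"])

section \<open>Optimality\<close>

text \<open>The prior gives zero sum only almost everywhere. The \<open>C_dij\<close> annihilate
  constants, so working with the centred vector gives formulas valid for all
  \<open>\<tau>\<close>.\<close>

definition centred :: "(nat \<Rightarrow> real) \<Rightarrow> nat \<Rightarrow> real" where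
  "centred \<tau> a = \<tau> a - (\<Sum>i<t. \<tau> i) / real t"

lemma centred_sum: "(\<Sum>a<t. centred \<tau> a) = 0"
  using t by (simp add: centred_def sum_subtractf)

section \<open>Explicit criterion of a balanced design\<close>

context
  fixes P :: "nat list \<Rightarrow> real" and lam :: real
  assumes P: "is_design p t P" and bal: "balanced P"
begin

text \<open>\<open>\<alpha>\<close> and \<open>\<beta>\<close> are the eigenvalues of the
  information matrix across and along \<open>\<tau>\<close>; \<open>\<gamma> i j\<close> is the
  factor of \<open>B_t\<close> in \<open>C_dij\<close>.\<close>

definition \<alpha> where "\<alpha> = real n * q_design p t \<Sigma> P lam / (real t - 1)"
definition \<beta> where "\<beta> = real n * q_design p t \<Sigma> P (x_design p t n \<Sigma> P) / (real t - 1)"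
definition \<gamma> where "\<gamma> i j = c_design p t n \<Sigma> P i j / (real t - 1)"

lemma C_balanced:
  assumes "i \<in> {1, 2}" "j \<in> {1, 2}" "a < t" "b < t"
  shows "C P i j a b = \<gamma> i j * ((if a = b then 1 else 0) - 1 / real t)"
  using bal assms unfolding balanced_def \<gamma>_def by blast

lemma C_balanced_apply:
  assumes "i \<in> {1, 2}" "j \<in> {1, 2}" "a < t"
  shows "(\<Sum>c<t. C P i j a c * \<tau> c) = \<gamma> i j * centred \<tau> a"
proof -
  have "(\<Sum>c<t. C P i j a c * \<tau> c) = (\<Sum>c<t. (if a = c then \<gamma> i j * \<tau> c else 0) - \<gamma> i j * (\<tau> c / real t))"
    using assms by (intro sum.cong refl) (simp add: C_balanced algebra_simps)
  also have "\<dots> = \<gamma> i j * centred \<tau> a"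
    using assms by (simp add: sum_subtractf centred_def right_diff_distrib sum_distrib_left[symmetric]
        sum_divide_distrib[symmetric])
  finally show ?thesis .
qed

lemma \<gamma>22_pos: "\<gamma> 2 2 > 0"
  using c_design22_pos[OF P] t by (simp add: \<gamma>_def)

lemma form22_balanced: "form P 2 2 \<tau> \<tau> = \<gamma> 2 2 * nsq t (centred \<tau>)"
proof -
  have "form P 2 2 \<tau> \<tau> = (\<Sum>a<t. \<tau> a * (\<Sum>c<t. C P 2 2 a c * \<tau> c))"
    by (simp add: form_def sum_distrib_left mult_ac)
  also have "\<dots> = (\<Sum>a<t. \<gamma> 2 2 * ((centred \<tau> a)\<^sup>2 + (\<Sum>i<t. \<tau> i) / real t * centred \<tau> a))"
    by (intro sum.cong refl) (subst C_balanced_apply, auto simp: centred_def power2_eq_square algebra_simps)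
  also have "\<dots> = \<gamma> 2 2 * (nsq t (centred \<tau>) + (\<Sum>i<t. \<tau> i) / real t * (\<Sum>a<t. centred \<tau> a))"
    by (simp only: sum_distrib_left[symmetric] sum.distrib nsq_def)
  finally show ?thesis by (simp add: centred_sum)
qed

lemma z_balanced: "a < t \<Longrightarrow> z P lam \<tau> a = (\<gamma> 1 2 + lam * \<gamma> 2 2) * centred \<tau> a"
  using C_balanced_apply[of 1 2 a \<tau>] C_balanced_apply[of 2 2 a \<tau>]
  by (simp add: z_def distrib_right sum.distrib mult.assoc sum_distrib_left[symmetric])

lemma Cx_balanced:
  assumes "a < t" "b < t"
  shows "Cx P lam a b = \<alpha> * ((if a = b then 1 else 0) - 1 / real t)"
proof -
  have \<alpha>: "\<alpha> = \<gamma> 1 1 + lam * (\<gamma> 1 2 + \<gamma> 2 1) + lam\<^sup>2 * \<gamma> 2 2"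
    unfolding \<alpha>_def q_design_eq \<gamma>_def c_design_21 by (simp add: add_divide_distrib mult_ac)
  show ?thesis
    unfolding Cx_def \<alpha> using assms by (simp add: C_balanced distrib_right mult.assoc)
qed

text \<open>Completing the square around \<open>x_d\<close>: the loss along \<open>\<tau>\<close> is
  the squared distance of \<open>lam\<close> from the minimizer, which is the rank-one correction of
  the Schur complement.\<close>

lemma \<alpha>_minus_\<beta>: "\<alpha> - \<beta> = (\<gamma> 1 2 + lam * \<gamma> 2 2)\<^sup>2 / \<gamma> 2 2"
proof -
  define r c b where "r = real t - 1" and "c = c_design p t n \<Sigma> P 2 2" and "b = c_design p t n \<Sigma> P 1 2"
  have r: "r > 0" using t by (simp add: r_def)
  have c: "c > 0" using c_design22_pos[OF P] by (simp add: c_def)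
  have "\<alpha> - \<beta> = (c * (lam - x_design p t n \<Sigma> P)\<^sup>2) / r"
    unfolding \<alpha>_def \<beta>_def q_design_complete_square[OF P, of lam]
    by (simp add: r_def c_def add_divide_distrib)
  also have "x_design p t n \<Sigma> P = - b / c" by (simp add: x_design_def b_def c_def)
  also have "c * (lam - - b / c)\<^sup>2 / r = (b / r + lam * (c / r))\<^sup>2 / (c / r)"
    using r c by (simp add: field_simps power2_eq_square)
  finally show ?thesis by (simp add: \<gamma>_def b_def c_def r_def)
qed

lemma info_mat_balanced:
  assumes "a < t" "b < t"
  shows "info_mat p t n \<Sigma> P (vec t \<tau>) lam $$ (a, b) = \<alpha> * ((if a = b then 1 else 0) - 1 / real t) -
    (if nsq t (centred \<tau>) = 0 then 0
     else (\<alpha> - \<beta>) * (centred \<tau> a * centred \<tau> b / nsq t (centred \<tau>)))"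
  using assms \<gamma>22_pos
  by (simp add: info_mat_index form22_balanced z_balanced Cx_balanced \<alpha>_minus_\<beta> power2_eq_square)

lemma A_crit_balanced:
  assumes prior: "is_prior t \<mu>" and exch: "exchangeable t \<mu>"
    and pos: "q_design p t \<Sigma> P (x_design p t n \<Sigma> P) > 0"
  shows "A_crit p t n \<Sigma> \<mu> lam P =
    real n / ((real t - 2) / q_design p t \<Sigma> P lam + 1 / q_design p t \<Sigma> P (x_design p t n \<Sigma> P))"
proof -
  interpret exchangeable_prior t \<mu> using t prior exch by unfold_locales
  interpret prob_space \<mu> by (rule prior_prob_space)
  have pos': "q_design p t \<Sigma> P lam > 0" using q_design_min[OF P, of lam] pos by linarith
  have \<alpha>\<beta>: "\<alpha> > 0" "\<beta> > 0" using pos pos' n t by (simp_all add: \<alpha>_def \<beta>_def)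
  define \<kappa>1 where "\<kappa>1 = (real t - 1) / ((real t - 2) / \<alpha> + 1 / \<beta>)"
  define \<kappa>2 where "\<kappa>2 = Phi_A t (mat t t (\<lambda>(a, b). \<alpha> * ((if a = b then 1 else 0) - 1 / real t)))"
  \<comment> \<open>The integrand takes just two values, which settles its measurability; \<open>\<kappa>2\<close> occurs on the null set
    of constant vectors, where the formula for \<open>\<kappa>1\<close> fails.\<close>
  have Phi: "Phi_A t (info_mat p t n \<Sigma> P (vec t \<tau>) lam) = (if nsq t (centred \<tau>) = 0 then \<kappa>2 else \<kappa>1)" for \<tau>
  proof (cases "nsq t (centred \<tau>) = 0")
    case True
    have "info_mat p t n \<Sigma> P (vec t \<tau>) lam = mat t t (\<lambda>(a, b). \<alpha> * ((if a = b then 1 else 0) - 1 / real t))"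
      by (rule eq_matI) (use info_mat_carrier[of P \<tau> lam] True in \<open>auto simp: info_mat_balanced\<close>)
    then show ?thesis using True by (simp add: \<kappa>2_def)
  next
    case False
    then have N: "nsq t (centred \<tau>) > 0"
      using sum_nonneg[of "{..<t}" "\<lambda>i. (centred \<tau> i)\<^sup>2"] by (simp add: nsq_def less_le)
    interpret dir: direction t "centred \<tau>" using t centred_sum N by unfold_locales
    have "Phi_A t (info_mat p t n \<Sigma> P (vec t \<tau>) lam) = \<kappa>1"
      unfolding \<kappa>1_def
    proof (rule dir.Phi_A_eq_direction[OF info_mat_carrier info_mat_symmetric info_mat_psd[OF P] info_mat_col_sum _ \<alpha>\<beta>])
      fix j k assume "j < t" "k < t"
      then show "info_mat p t n \<Sigma> P (vec t \<tau>) lam $$ (j, k) = \<alpha> * dir.F j k + \<beta> * dir.E j k"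
        using False by (simp add: info_mat_balanced dir.F_def dir.E_def algebra_simps diff_divide_distrib)
    qed
    then show ?thesis using False by simp
  qed
  have "A_crit p t n \<Sigma> \<mu> lam P = (\<integral>\<tau>. (if nsq t (centred \<tau>) = 0 then \<kappa>2 else \<kappa>1) \<partial>\<mu>)"
    unfolding A_crit_def Phi ..
  also have "\<dots> = (\<integral>\<tau>. \<kappa>1 \<partial>\<mu>)"
  proof (rule integral_cong_AE)
    have "(\<lambda>\<tau>. nsq t (centred \<tau>)) \<in> borel_measurable \<mu>"
      unfolding nsq_def centred_def
      by (intro borel_measurable_sum borel_measurable_power borel_measurable_diff borel_measurable_divide
          coordinate_measurable borel_measurable_const) auto
    then show "(\<lambda>\<tau>. if nsq t (centred \<tau>) = 0 then \<kappa>2 else \<kappa>1) \<in> borel_measurable \<mu>"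
      by measurable
    show "AE \<tau> in \<mu>. (if nsq t (centred \<tau>) = 0 then \<kappa>2 else \<kappa>1) = \<kappa>1"
      using prior_AE
    proof eventually_elim
      case (elim \<tau>)
      then have "nsq t \<tau> > 0" by (intro nsq_pos) simp
      moreover have "centred \<tau> = \<tau>" using elim by (simp add: centred_def fun_eq_iff)
      ultimately show ?case by simp
    qed
  qed simp
  also have "\<dots> = \<kappa>1" by (simp add: prob_space)
  also have "\<dots> = real n / ((real t - 2) / q_design p t \<Sigma> P lam + 1 / q_design p t \<Sigma> P (x_design p t n \<Sigma> P))"
  proof -
    have "r / (m / (N * q / r) + 1 / (N * q' / r)) = N / (m / q + 1 / q')"
      if "r > 0" "N > 0" "q > 0" "q' > 0" "m \<ge> 0" for r N q q' m :: real
    proof -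
      have "m / (N * q / r) + 1 / (N * q' / r) = r / N * (m / q + 1 / q')"
        using that by (simp add: field_simps)
      moreover have "m / q + 1 / q' > 0" using that by (intro add_nonneg_pos) auto
      ultimately show ?thesis using that by simp
    qed
    then show ?thesis unfolding \<kappa>1_def \<alpha>_def \<beta>_def using t n pos pos' by simp
  qed
  finally show ?thesis .
qed

end

section \<open>Sensitivities and the two directions of the equivalence\<close>

lemma weighted_sensitivity:
  assumes pos: "q_design p t \<Sigma> P lam > 0" "q_design p t \<Sigma> P (x_design p t n \<Sigma> P) > 0"
  defines "a \<equiv> 1 / q_design p t \<Sigma> P lam" and "b \<equiv> 1 / q_design p t \<Sigma> P (x_design p t n \<Sigma> P)"
  shows "((real t - 2) * a + b) * sensitivity p t n \<Sigma> lam P s =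
    (real t - 2) * a\<^sup>2 * q_seq p t \<Sigma> s lam + b\<^sup>2 * q_seq p t \<Sigma> s (x_design p t n \<Sigma> P)"
proof -
  define m where "m = real t - 2"
  define K where "K = m * a + b"
  have m: "m \<ge> 0" using t by (simp add: m_def)
  have ab: "a > 0" "b > 0" using pos by (simp_all add: a_def b_def)
  have K: "K > 0" using m ab by (simp add: K_def add_nonneg_pos)
  have q: "q_design p t \<Sigma> P lam = 1 / a" "q_design p t \<Sigma> P (x_design p t n \<Sigma> P) = 1 / b"
    by (simp_all add: a_def b_def)
  \<comment> \<open>Hence \<open>\<pi>_d = b / K\<close> and \<open>1 - \<pi>_d = m a / K\<close>:
    the sensitivity times \<open>K\<close> is the linear functional on the right of
    \<open>A_crit_le\<close> at weights \<open>a\<close>, \<open>b\<close>.\<close>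
  have "1 / a + m * (1 / b) = K / (a * b)"
    using ab by (simp add: K_def field_simps)
  then have \<pi>: "pi_design p t n \<Sigma> lam P = b / K"
    unfolding pi_design_def q m_def[symmetric] using ab K by simp
  have \<pi>': "1 - b / K = m * a / K" using K by (simp add: K_def field_simps)
  show ?thesis
    unfolding sensitivity_def Let_def \<pi> \<pi>' q m_def[symmetric] K_def[symmetric] using K ab
    by (simp add: field_simps power2_eq_square)
qed

lemma weighted_sensitivity_design:
  assumes pos: "q_design p t \<Sigma> P lam > 0" "q_design p t \<Sigma> P (x_design p t n \<Sigma> P) > 0"
  defines "a \<equiv> 1 / q_design p t \<Sigma> P lam" and "b \<equiv> 1 / q_design p t \<Sigma> P (x_design p t n \<Sigma> P)"
  shows "((real t - 2) * a + b) * (\<Sum>s\<in>seqs p t. P' s * sensitivity p t n \<Sigma> lam P s) =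
    (real t - 2) * a\<^sup>2 * q_design p t \<Sigma> P' lam + b\<^sup>2 * q_design p t \<Sigma> P' (x_design p t n \<Sigma> P)"
proof -
  have "((real t - 2) * a + b) * (\<Sum>s\<in>seqs p t. P' s * sensitivity p t n \<Sigma> lam P s) =
    (\<Sum>s\<in>seqs p t. P' s * (((real t - 2) * a + b) * sensitivity p t n \<Sigma> lam P s))"
    by (simp add: sum_distrib_left mult_ac)
  also have "\<dots> = (\<Sum>s\<in>seqs p t. P' s * ((real t - 2) * a\<^sup>2 * q_seq p t \<Sigma> s lam + b\<^sup>2 * q_seq p t \<Sigma> s (x_design p t n \<Sigma> P)))"
    unfolding a_def b_def weighted_sensitivity[OF pos] ..
  also have "\<dots> = (real t - 2) * a\<^sup>2 * q_design p t \<Sigma> P' lam + b\<^sup>2 * q_design p t \<Sigma> P' (x_design p t n \<Sigma> P)"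
    by (simp add: q_design_def sum_distrib_left distrib_left sum.distrib mult_ac)
  finally show ?thesis .
qed

text \<open>At \<open>P\<close> itself the functional gives
  \<open>m a^2 / a + b^2 / b = m a + b\<close>. So no design has all its sensitivities below
  1.\<close>

lemma sensitivity_mean:
  assumes P: "is_design p t P" and pos: "q_design p t \<Sigma> P (x_design p t n \<Sigma> P) > 0"
  shows "(\<Sum>s\<in>seqs p t. P s * sensitivity p t n \<Sigma> lam P s) = 1"
proof -
  have pos': "q_design p t \<Sigma> P lam > 0" using q_design_min[OF P, of lam] pos by linarith
  define m a b where "m = real t - 2" and "a = 1 / q_design p t \<Sigma> P lam"
    and "b = 1 / q_design p t \<Sigma> P (x_design p t n \<Sigma> P)"
  have K: "m * a + b > 0" using t pos pos' by (auto simp: m_def a_def b_def intro!: add_nonneg_pos)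
  have "(m * a + b) * (\<Sum>s\<in>seqs p t. P s * sensitivity p t n \<Sigma> lam P s) = m * a + b"
    using weighted_sensitivity_design[OF pos' pos, of P] pos pos'
    by (simp add: m_def a_def b_def power2_eq_square)
  then show ?thesis using K by simp
qed

lemma optimal_if_sensitivity_le:
  assumes prior: "is_prior t \<mu>" and exch: "exchangeable t \<mu>"
    and P: "is_design p t P" and bal: "balanced P"
    and pos: "q_design p t \<Sigma> P (x_design p t n \<Sigma> P) > 0"
    and le: "\<And>s. s \<in> seqs p t \<Longrightarrow> sensitivity p t n \<Sigma> lam P s \<le> 1"
  shows "A_optimal p t n \<Sigma> \<mu> lam P"
  unfolding A_optimal_def
proof (intro conjI allI impI P)
  fix P' assume P': "is_design p t P'"
  have pos': "q_design p t \<Sigma> P lam > 0" using q_design_min[OF P, of lam] pos by linarith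
  define m a b where "m = real t - 2" and "a = 1 / q_design p t \<Sigma> P lam"
    and "b = 1 / q_design p t \<Sigma> P (x_design p t n \<Sigma> P)"
  define K where "K = m * a + b"
  have K: "K > 0" using t pos pos' by (auto simp: K_def m_def a_def b_def intro!: add_nonneg_pos)
  \<comment> \<open>The weights come from \<open>P\<close>, not from the competitor; the right side
    is then linear in \<open>P'\<close>.\<close>
  have "A_crit p t n \<Sigma> \<mu> lam P' * K\<^sup>2 \<le>
      real n * (m * a\<^sup>2 * q_design p t \<Sigma> P' lam + b\<^sup>2 * q_design p t \<Sigma> P' (x_design p t n \<Sigma> P))"
    using A_crit_le[OF prior exch P', of a b lam "x_design p t n \<Sigma> P"] K by (simp add: K_def m_def)
  also have "\<dots> = real n * (K * (\<Sum>s\<in>seqs p t. P' s * sensitivity p t n \<Sigma> lam P s))"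
    using weighted_sensitivity_design[OF pos' pos, of P'] by (simp add: K_def m_def a_def b_def)
  also have "\<dots> \<le> real n * (K * (\<Sum>s\<in>seqs p t. P' s * 1))"
    using P' K le by (intro mult_left_mono sum_mono) (auto simp: is_design_def)
  also have "\<dots> = real n * K" using P' by (simp add: is_design_def)
  finally have "A_crit p t n \<Sigma> \<mu> lam P' \<le> real n / K"
    using K by (simp add: power2_eq_square pos_le_divide_eq)
  also have "\<dots> = A_crit p t n \<Sigma> \<mu> lam P"
    unfolding A_crit_balanced[OF P bal prior exch pos] K_def m_def a_def b_def by simp
  finally show "A_crit p t n \<Sigma> \<mu> lam P' \<le> A_crit p t n \<Sigma> \<mu> lam P" .
qed

text \<open>The explicit formula needs a balanced design; the symmetrization of \<open>P0\<close> is
  one, with the same \<open>q_d\<close> and \<open>x_d\<close>.\<close>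

lemma crit_value_attained:
  assumes prior: "is_prior t \<mu>" and exch: "exchangeable t \<mu>" and P0: "is_design p t P0"
    and pos: "q_design p t \<Sigma> P0 (x_design p t n \<Sigma> P0) > 0"
  shows "\<exists>P'. is_design p t P' \<and> A_crit p t n \<Sigma> \<mu> lam P' =
    real n / ((real t - 2) / q_design p t \<Sigma> P0 lam + 1 / q_design p t \<Sigma> P0 (x_design p t n \<Sigma> P0))"
proof -
  obtain P' where P': "is_design p t P'" "balanced P'"
    and c: "\<And>i j. c_design p t n \<Sigma> P' i j = c_design p t n \<Sigma> P0 i j"
    using symmetrization[OF P0] by blast
  have x: "x_design p t n \<Sigma> P' = x_design p t n \<Sigma> P0" by (simp add: x_design_def c)
  have q: "q_design p t \<Sigma> P' x = q_design p t \<Sigma> P0 x" for x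
  proof -
    have "real n * q_design p t \<Sigma> P' x = real n * q_design p t \<Sigma> P0 x"
      unfolding q_design_eq c ..
    then show ?thesis using n by simp
  qed
  show ?thesis
    using A_crit_balanced[OF P' prior exch, of lam] pos P'(1) by (auto simp: x q)
qed

text \<open>A constant sequence has positive \<open>q_seq\<close> except at 0, and a sequence that changes treatment
  after the first period has it at 0.\<close>

lemma q_design_pos_exists:
  "\<exists>P0. is_design p t P0 \<and> q_design p t \<Sigma> P0 (x_design p t n \<Sigma> P0) > 0"
proof -
  define s1 where "s1 = replicate p (0::nat)"
  define s2 where "s2 = (0::nat) # replicate (p - 1) 1"
  have s: "s1 \<in> seqs p t" "s2 \<in> seqs p t"
    using t p2 by (auto simp: s1_def s2_def seqs_def set_replicate_conv_if)
  have ne: "s1 \<noteq> s2"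
  proof
    assume "s1 = s2"
    then have "s1 ! 1 = s2 ! 1" by simp
    then show False using p2 by (simp add: s1_def s2_def)
  qed
  define P0 where "P0 s = (if s \<in> {s1, s2} then 1 / 2 else (0::real))" for s
  have sum_P0: "(\<Sum>s\<in>seqs p t. P0 s * f s) = (f s1 + f s2) / 2" for f :: "nat list \<Rightarrow> real"
  proof -
    have "(\<Sum>s\<in>seqs p t. P0 s * f s) = (\<Sum>s\<in>{s1, s2}. f s / 2)"
      using s by (intro sum.mono_neutral_cong_right) (auto simp: P0_def)
    then show ?thesis using ne by (simp add: add_divide_distrib)
  qed
  have P0: "is_design p t P0"
    unfolding is_design_def using sum_P0[of "\<lambda>_. 1"] by (auto simp: P0_def)
  have "q_design p t \<Sigma> P0 x > 0" for x
  proof (cases "x = 0")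
    case True
    have "q_seq p t \<Sigma> s2 x > 0"
      using s t p2 True by (intro q_seq_pos) (simp add: g_eq, simp add: s2_def)
    then show ?thesis
      using q_seq_nonneg[of s1 x] by (simp add: q_design_def sum_P0)
  next
    case False
    have "q_seq p t \<Sigma> s1 x > 0"
      using s t p2 False by (intro q_seq_pos) (simp add: g_eq, simp add: s1_def field_simps)
    then show ?thesis
      using q_seq_nonneg[of s2 x] by (simp add: q_design_def sum_P0)
  qed
  then show ?thesis using P0 by blast
qed

lemma optimal_imp_pos:
  assumes prior: "is_prior t \<mu>" and exch: "exchangeable t \<mu>"
    and opt: "A_optimal p t n \<Sigma> \<mu> lam P"
  shows "q_design p t \<Sigma> P (x_design p t n \<Sigma> P) > 0"
proof (rule ccontr)
  assume neg: "\<not> ?thesis"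
  have P: "is_design p t P" using opt by (simp add: A_optimal_def)
  \<comment> \<open>Weights 0 and 1 keep only the direction \<open>\<tau>\<close>.\<close>
  have "A_crit p t n \<Sigma> \<mu> lam P \<le> real n * q_design p t \<Sigma> P (x_design p t n \<Sigma> P)"
    using A_crit_le[OF prior exch P, of 0 1 lam "x_design p t n \<Sigma> P"] by simp
  also have "\<dots> \<le> 0" using neg by (simp add: mult_nonneg_nonpos)
  finally have le0: "A_crit p t n \<Sigma> \<mu> lam P \<le> 0" .
  obtain P0 where P0: "is_design p t P0" and pos: "q_design p t \<Sigma> P0 (x_design p t n \<Sigma> P0) > 0"
    using q_design_pos_exists by blast
  have pos': "q_design p t \<Sigma> P0 lam > 0" using q_design_min[OF P0, of lam] pos by linarith
  obtain P' where P': "is_design p t P'" and eq: "A_crit p t n \<Sigma> \<mu> lam P' =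
    real n / ((real t - 2) / q_design p t \<Sigma> P0 lam + 1 / q_design p t \<Sigma> P0 (x_design p t n \<Sigma> P0))"
    using crit_value_attained[OF prior exch P0 pos] by blast
  have "A_crit p t n \<Sigma> \<mu> lam P' > 0"
    unfolding eq using t n pos pos' by (intro divide_pos_pos add_nonneg_pos) auto
  then show False using opt P' le0 unfolding A_optimal_def by (meson leD order_trans)
qed

lemma optimal_imp_sensitivity_le:
  assumes prior: "is_prior t \<mu>" and exch: "exchangeable t \<mu>"
    and opt: "A_optimal p t n \<Sigma> \<mu> lam P" and bal: "balanced P" and s: "s \<in> seqs p t"
  shows "sensitivity p t n \<Sigma> lam P s \<le> 1"
proof (rule ccontr)
  assume gt: "\<not> ?thesis"
  have P: "is_design p t P" using opt by (simp add: A_optimal_def)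
  define x where "x = x_design p t n \<Sigma> P"
  have pos: "q_design p t \<Sigma> P x > 0" unfolding x_def by (rule optimal_imp_pos[OF prior exch opt])
  have pos': "q_design p t \<Sigma> P lam > 0" using q_design_min[OF P, of lam] pos by (simp add: x_def)
  define c0 where "c0 i j = c_design p t n \<Sigma> P i j" for i j
  define c1 where "c1 i j = real n * c_seq p t \<Sigma> s i j - c0 i j" for i j
  \<comment> \<open>Move mass \<open>\<epsilon>\<close> to \<open>s\<close>; after symmetrization the criterion is \<open>n / \<psi> \<epsilon>\<close>, and the one-sided derivative
    of \<open>\<psi>\<close> at 0 is the sensitivity condition (the minimizer of the perturbed quadratic contributes
    nothing to first order).\<close>
  define P\<epsilon> where "P\<epsilon> \<epsilon> s' = (1 - \<epsilon>) * P s' + \<epsilon> * (if s' = s then 1 else 0)" for \<epsilon> s'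
  have sum_P\<epsilon>: "(\<Sum>s'\<in>seqs p t. P\<epsilon> \<epsilon> s' * f s') = (1 - \<epsilon>) * (\<Sum>s'\<in>seqs p t. P s' * f s') + \<epsilon> * f s"
    for \<epsilon> f
  proof -
    have "(\<Sum>s'\<in>seqs p t. P\<epsilon> \<epsilon> s' * f s') =
      (\<Sum>s'\<in>seqs p t. (1 - \<epsilon>) * (P s' * f s') + (if s' = s then \<epsilon> * f s' else 0))"
      by (intro sum.cong refl) (auto simp: P\<epsilon>_def algebra_simps)
    then show ?thesis using s by (simp add: sum.distrib sum_distrib_left)
  qed
  have P\<epsilon>: "is_design p t (P\<epsilon> \<epsilon>)" if "0 \<le> \<epsilon>" "\<epsilon> \<le> 1" for \<epsilon>
    using sum_P\<epsilon>[of \<epsilon> "\<lambda>_. 1"] that P by (auto simp: is_design_def P\<epsilon>_def)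
  have c\<epsilon>: "c_design p t n \<Sigma> (P\<epsilon> \<epsilon>) i j = c0 i j + \<epsilon> * c1 i j" for \<epsilon> i j
    unfolding c_design_def sum_P\<epsilon> c1_def c0_def by (simp add: algebra_simps)
  have q\<epsilon>: "q_design p t \<Sigma> (P\<epsilon> \<epsilon>) y = q_design p t \<Sigma> P y + \<epsilon> * (q_seq p t \<Sigma> s y - q_design p t \<Sigma> P y)" for \<epsilon> y
    unfolding q_design_def sum_P\<epsilon> by (simp add: algebra_simps)
  define M where "M \<epsilon> = ((c0 1 1 + \<epsilon> * c1 1 1) - (c0 1 2 + \<epsilon> * c1 1 2)\<^sup>2 / (c0 2 2 + \<epsilon> * c1 2 2)) / real n" for \<epsilon>
  define L where "L \<epsilon> = q_design p t \<Sigma> P lam + \<epsilon> * (q_seq p t \<Sigma> s lam - q_design p t \<Sigma> P lam)" for \<epsilon>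
  define \<psi> where "\<psi> \<epsilon> = (real t - 2) / L \<epsilon> + 1 / M \<epsilon>" for \<epsilon>
  have M: "q_design p t \<Sigma> (P\<epsilon> \<epsilon>) (x_design p t n \<Sigma> (P\<epsilon> \<epsilon>)) = M \<epsilon>" if "0 \<le> \<epsilon>" "\<epsilon> \<le> 1" for \<epsilon>
    using q_design_x_design[OF P\<epsilon>[OF that]] n unfolding c\<epsilon> M_def by (simp add: field_simps)
  have P\<epsilon>0: "P\<epsilon> 0 = P" by (simp add: P\<epsilon>_def fun_eq_iff)
  have M0: "M 0 = q_design p t \<Sigma> P x" using M[of 0] by (simp add: P\<epsilon>0 x_def)
  have L0: "L 0 = q_design p t \<Sigma> P lam" by (simp add: L_def)
  \<comment> \<open>The share \<open>1 - \<epsilon>\<close> of \<open>P\<close> contributes at least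
    \<open>(1 - \<epsilon>) q_d(x_d)\<close> at any point, and \<open>q_s\<close> is
    nonnegative.\<close>
  have M_pos: "M \<epsilon> > 0" if "0 \<le> \<epsilon>" "\<epsilon> < 1" for \<epsilon>
  proof -
    let ?y = "x_design p t n \<Sigma> (P\<epsilon> \<epsilon>)"
    have "q_design p t \<Sigma> P ?y \<ge> q_design p t \<Sigma> P x" unfolding x_def by (rule q_design_min[OF P])
    then have "0 < (1 - \<epsilon>) * q_design p t \<Sigma> P ?y" using that pos by (intro mult_pos_pos) auto
    also have "\<dots> \<le> (1 - \<epsilon>) * q_design p t \<Sigma> P ?y + \<epsilon> * q_seq p t \<Sigma> s ?y"
      using that q_seq_nonneg by simp
    also have "\<dots> = M \<epsilon>" using M[of \<epsilon>] that by (simp add: q\<epsilon> algebra_simps)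
    finally show ?thesis .
  qed
  have \<psi>_ge: "\<psi> 0 \<le> \<psi> \<epsilon>" if "0 \<le> \<epsilon>" "\<epsilon> < 1" for \<epsilon>
  proof -
    have d: "is_design p t (P\<epsilon> \<epsilon>)" using P\<epsilon> that by simp
    have Mpos: "q_design p t \<Sigma> (P\<epsilon> \<epsilon>) (x_design p t n \<Sigma> (P\<epsilon> \<epsilon>)) > 0" using M_pos M that by simp
    have Lpos: "L \<epsilon> > 0" using q_design_min[OF d, of lam] Mpos by (simp add: q\<epsilon> L_def)
    have val: "q_design p t \<Sigma> (P\<epsilon> \<epsilon>) (x_design p t n \<Sigma> (P\<epsilon> \<epsilon>)) = M \<epsilon>"
      "q_design p t \<Sigma> (P\<epsilon> \<epsilon>) lam = L \<epsilon>"
      using M[of \<epsilon>] that by (simp_all add: L_def q\<epsilon>)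
    obtain P' where P': "is_design p t P'" and "A_crit p t n \<Sigma> \<mu> lam P' = real n / \<psi> \<epsilon>"
      using crit_value_attained[OF prior exch d Mpos, of lam] unfolding \<psi>_def val by blast
    moreover have "A_crit p t n \<Sigma> \<mu> lam P = real n / \<psi> 0"
      using A_crit_balanced[OF P bal prior exch, of lam] pos by (simp add: \<psi>_def M0 L0 x_def)
    ultimately have "real n / \<psi> \<epsilon> \<le> real n / \<psi> 0"
      using opt P' unfolding A_optimal_def by metis
    moreover have "\<psi> \<epsilon> > 0" "\<psi> 0 > 0"
      using t Lpos M_pos[of \<epsilon>] that pos pos' by (auto simp: \<psi>_def L0 M0 intro!: add_nonneg_pos)
    ultimately show ?thesis using n by (simp add: field_simps)
  qed
  have c22: "c0 2 2 > 0" unfolding c0_def by (rule c_design22_pos[OF P])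
  have xc: "x = - c0 1 2 / c0 2 2" by (simp add: x_def x_design_def c0_def)
  have "(M has_real_derivative (c1 1 1 - (2 * c0 1 2 * c1 1 2 * c0 2 2 - (c0 1 2)\<^sup>2 * c1 2 2) / (c0 2 2)\<^sup>2) / real n) (at 0)"
    unfolding M_def using c22 n
    by (auto intro!: derivative_eq_intros simp: power2_eq_square)
  also have "(c1 1 1 - (2 * c0 1 2 * c1 1 2 * c0 2 2 - (c0 1 2)\<^sup>2 * c1 2 2) / (c0 2 2)\<^sup>2) / real n =
    (c1 1 1 + 2 * c1 1 2 * x + c1 2 2 * x\<^sup>2) / real n"
    unfolding xc using c22 by (simp add: field_simps power2_eq_square)
  also have "\<dots> = q_seq p t \<Sigma> s x - q_design p t \<Sigma> P x"
  proof -
    have "c1 1 1 + 2 * c1 1 2 * x + c1 2 2 * x\<^sup>2 = real n * q_seq p t \<Sigma> s x - real n * q_design p t \<Sigma> P x"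
      unfolding q_design_eq q_seq_def c1_def c0_def by (simp add: algebra_simps)
    then show ?thesis using n by (simp add: field_simps)
  qed
  finally have M': "(M has_real_derivative q_seq p t \<Sigma> s x - q_design p t \<Sigma> P x) (at 0)" .
  have L': "(L has_real_derivative q_seq p t \<Sigma> s lam - q_design p t \<Sigma> P lam) (at 0)"
    unfolding L_def by (auto intro!: derivative_eq_intros)
  define D where "D = - (real t - 2) * (q_seq p t \<Sigma> s lam - q_design p t \<Sigma> P lam) / (q_design p t \<Sigma> P lam)\<^sup>2
    - (q_seq p t \<Sigma> s x - q_design p t \<Sigma> P x) / (q_design p t \<Sigma> P x)\<^sup>2"
  have \<psi>': "(\<psi> has_real_derivative D) (at 0)"
    unfolding \<psi>_def D_def using pos pos'
    by (auto intro!: derivative_eq_intros M' L' simp: M0 L0 power2_eq_square diff_divide_distrib left_diff_distrib)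
  have "D < 0"
  proof -
    define m a b where "m = real t - 2" and "a = 1 / q_design p t \<Sigma> P lam"
      and "b = 1 / q_design p t \<Sigma> P x"
    have K: "m * a + b > 0" using t pos pos' by (auto simp: m_def a_def b_def intro!: add_nonneg_pos)
    have "m * a + b < (m * a + b) * sensitivity p t n \<Sigma> lam P s" using gt K by simp
    also have "\<dots> = m * a\<^sup>2 * q_seq p t \<Sigma> s lam + b\<^sup>2 * q_seq p t \<Sigma> s x"
      using weighted_sensitivity[OF pos' pos[unfolded x_def], of s] by (simp add: m_def a_def b_def x_def)
    \<comment> \<open>Uses \<open>a^2 q_d(\<lambda>_0) = a\<close> and
      \<open>b^2 q_d(x_d) = b\<close>.\<close>
    also have "\<dots> = m * a + b - D"
      unfolding D_def m_def a_def b_def using pos pos' by (simp add: field_simps power2_eq_square)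
    finally show ?thesis by simp
  qed
  from DERIV_neg_dec_right[OF \<psi>' this] obtain d where d: "d > 0" "\<And>h. h > 0 \<Longrightarrow> h < d \<Longrightarrow> \<psi> 0 > \<psi> (0 + h)"
    by auto
  \<comment> \<open>Halving the minimum stays below \<open>d\<close> for the decrease and below 1
    for \<open>\<psi>_ge\<close>.\<close>
  have "\<psi> 0 > \<psi> (min d 1 / 2)" using d(2)[of "min d 1 / 2"] d(1) by (auto simp: min_def)
  moreover have "\<psi> 0 \<le> \<psi> (min d 1 / 2)" using d(1) by (intro \<psi>_ge) auto
  ultimately show False by simp
qed

end

theorem theorem7:
  fixes p t n :: nat and \<Sigma> :: "real mat" and lam :: real
    and g :: "(nat \<Rightarrow> real) measure" and P :: "nat list \<Rightarrow> real"
  assumes "p \<ge> 2" and "t \<ge> 2" and "n \<ge> 1"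
    and "symmetric_pos_def p \<Sigma>"
    and "is_prior t g" and "exchangeable t g"
    and "is_design p t P" and "pseudo_symmetric p t n \<Sigma> P"
  shows "(A_optimal p t n \<Sigma> g lam P \<longleftrightarrow>
            q_design p t \<Sigma> P (x_design p t n \<Sigma> P) > 0 \<and>
            Max (sensitivity p t n \<Sigma> lam P ` seqs p t) = 1) \<and>
         (A_optimal p t n \<Sigma> g lam P \<longrightarrow>
            (\<forall>s \<in> seqs p t. P s > 0 \<longrightarrow>
               sensitivity p t n \<Sigma> lam P s = Max (sensitivity p t n \<Sigma> lam P ` seqs p t)))"
proof -
  interpret crossover p \<Sigma> t n using assms by unfold_locales auto
  note prior = assms(5) and exch = assms(6) and P = assms(7)
  have bal: "balanced P" by (rule pseudo_symmetric_balanced[OF assms(7,8)])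
  let ?sens = "sensitivity p t n \<Sigma> lam P"
  have imp: "q_design p t \<Sigma> P (x_design p t n \<Sigma> P) > 0 \<and> Max (?sens ` seqs p t) = 1 \<and>
      (\<forall>s\<in>seqs p t. P s > 0 \<longrightarrow> ?sens s = 1)"
    if opt: "A_optimal p t n \<Sigma> g lam P"
  proof -
    have pos: "q_design p t \<Sigma> P (x_design p t n \<Sigma> P) > 0"
      by (rule optimal_imp_pos[OF prior exch opt])
    have le: "?sens s \<le> 1" if "s \<in> seqs p t" for s
      by (rule optimal_imp_sensitivity_le[OF prior exch opt bal that])
    \<comment> \<open>The mean of the sensitivities is 1 and none exceeds 1, so each sequence of
      positive weight attains 1.\<close>
    have "(\<Sum>s\<in>seqs p t. P s * (1 - ?sens s)) = 0"
      using sensitivity_mean[OF P pos, of lam] P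
      by (simp add: right_diff_distrib sum_subtractf is_design_def)
    then have "\<forall>s\<in>seqs p t. P s * (1 - ?sens s) = 0"
      using P le by (subst (asm) sum_nonneg_eq_0_iff) (auto simp: is_design_def)
    then have eq: "?sens s = 1" if "s \<in> seqs p t" "P s > 0" for s using that by auto
    have "\<exists>s\<in>seqs p t. P s \<noteq> 0" using P by (metis is_design_def sum.neutral zero_neq_one)
    then obtain s where s: "s \<in> seqs p t" "P s > 0" using P by (auto simp: is_design_def less_le)
    have "Max (?sens ` seqs p t) = 1"
      using le s eq by (intro Max_eqI) (auto intro: rev_image_eqI)
    then show ?thesis using pos eq by blast
  qed
  moreover have "A_optimal p t n \<Sigma> g lam P"
    if pos: "q_design p t \<Sigma> P (x_design p t n \<Sigma> P) > 0" and Max: "Max (?sens ` seqs p t) = 1"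
  proof (rule optimal_if_sensitivity_le[OF prior exch P bal pos])
    show "?sens s \<le> 1" if "s \<in> seqs p t" for s
      using Max_ge[of "?sens ` seqs p t" "?sens s"] that Max by simp
  qed
  ultimately show ?thesis by auto
qed

end
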